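(* For $K\in\mathcal{T}_h$ and $\boldsymbol\eta^t,\boldsymbol\eta^n\in\mathbf{L}^2(\partial K)$, write $\boldsymbol\eta=(\boldsymbol\eta^t,\boldsymbol\eta^n)$ and let $(\Sigma_{\boldsymbol\eta},\Phi_{\boldsymbol\eta},\mathbf{U}_{\boldsymbol\eta})\in\mathcal{P}_k(K)\times\mathcal{P}_k(K)\times\boldsymbol{\mathcal{P}}_k(K)$ be the solution of the first local problem: for all $\chi,\varphi\in\mathcal{P}_k(K)$, $\mathbf{z}\in\boldsymbol{\mathcal{P}}_k(K)$, $$(\Sigma_{\boldsymbol\eta},\chi)_K-(\mathbf{U}_{\boldsymbol\eta},\mathbf{curl}\,\chi)_K+\langle\boldsymbol\eta^t\cdot\mathbf{n}^\perp,\chi\rangle_{\partial K}=0,$$ $$(\Phi_{\boldsymbol\eta},\varphi)_K-(\mathbf{U}_{\boldsymbol\eta},\nabla\varphi)_K+\langle\boldsymbol\eta^n\cdot\mathbf{n},\varphi\rangle_{\partial K}=0,$$ $$(\Sigma_{\boldsymbol\eta},\operatorname{rot}\mathbf{z})_K+\langle\check\Sigma_{\boldsymbol\eta},\mathbf{z}\cdot\mathbf{n}^\perp\rangle_{\partial K}-(\Phi_{\boldsymbol\eta},\operatorname{div}\mathbf{z})_K+\langle\hat\Phi_{\boldsymbol\eta},\mathbf{z}\cdot\mathbf{n}\rangle_{\partial K}=0,$$ with $\check\Sigma_{\boldsymbol\eta}=\Sigma_{\boldsymbol\eta}+\alpha^{-1}(\mathbf{U}_{\boldsymbol\eta}-\boldsymbol\eta^t)\cdot\mathbf{n}^\perp$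 and $\hat\Phi_{\boldsymbol\eta}=\Phi_{\boldsymbol\eta}+\tau^{-1}(\mathbf{U}_{\boldsymbol\eta}-\boldsymbol\eta^n)\cdot\mathbf{n}$ on $\partial K$. For $\mathbf{f}\in\mathbf{L}^2(K)$ let $(\Sigma_{\mathbf{f}},\Phi_{\mathbf{f}},\mathbf{U}_{\mathbf{f}})\in\mathcal{P}_k(K)\times\mathcal{P}_k(K)\times\boldsymbol{\mathcal{P}}_k(K)$ be the solution of the second local problem: for all $\chi,\varphi\in\mathcal{P}_k(K)$, $\mathbf{z}\in\boldsymbol{\mathcal{P}}_k(K)$, $$(\Sigma_{\mathbf{f}},\chi)_K-(\mathbf{U}_{\mathbf{f}},\mathbf{curl}\,\chi)_K=0,\qquad (\Phi_{\mathbf{f}},\varphi)_K-(\mathbf{U}_{\mathbf{f}},\nabla\varphi)_K=0,$$ $$(\Sigma_{\mathbf{f}},\operatorname{rot}\mathbf{z})_K+\langle\check\Sigma_{\mathbf{f}},\mathbf{z}\cdot\mathbf{n}^\perp\rangle_{\partial K}-(\Phi_{\mathbf{f}},\operatorname{div}\mathbf{z})_K+\langle\hat\Phi_{\mathbf{f}},\mathbf{z}\cdot\mathbf{n}\rangle_{\partial K}=(\mathbf{f},\mathbf{z})_K,$$ with $\check\Sigma_{\mathbf{f}}=\Sigma_{\mathbf{f}}+\alpha^{-1}\mathbf{U}_{\mathbf{f}}\cdot\mathbf{n}^\perp$ and $\hat\Phi_{\mathbf{f}}=\Phi_{\mathbf{f}}+\tau^{-1}\mathbf{U}_{\mathbf{f}}\cdot\mathbf{n}$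 on $\partial K$. Then the solution $(\sigma_h,\phi_h,\mathbf{u}_h,\check{\mathbf{u}}_h,\hat{\mathbf{u}}_h)$ of the HDG system described in the context satisfies, on each $K\in\mathcal{T}_h$, $$(\sigma_h,\phi_h,\mathbf{u}_h)=(\Sigma_{(\check{\mathbf{u}}_h,\hat{\mathbf{u}}_h)},\Phi_{(\check{\mathbf{u}}_h,\hat{\mathbf{u}}_h)},\mathbf{U}_{(\check{\mathbf{u}}_h,\hat{\mathbf{u}}_h)})+(\Sigma_{\mathbf{f}},\Phi_{\mathbf{f}},\mathbf{U}_{\mathbf{f}}),$$ where $(\check{\mathbf{u}}_h,\hat{\mathbf{u}}_h)\in\mathbf{N}_h^t\times\mathbf{N}_h^n$ is the solution of $$a_h\big((\check{\mathbf{u}}_h,\hat{\mathbf{u}}_h),(\boldsymbol\mu^t,\boldsymbol\mu^n)\big)=l_h(\boldsymbol\mu^t,\boldsymbol\mu^n)\qquad\forall(\boldsymbol\mu^t,\boldsymbol\mu^n)\in\mathbf{N}_h^t\times\mathbf{N}_h^n,$$ with, writing $\boldsymbol\mu=(\boldsymbol\mu^t,\boldsymbol\mu^n)$, $$a_h(\boldsymbol\eta,\boldsymbol\mu)=(\Sigma_{\boldsymbol\eta},\Sigma_{\boldsymbol\mu})_{\mathcal{T}_h}+(\Phi_{\boldsymbol\eta},\Phi_{\boldsymbol\mu})_{\mathcal{T}_h}+\langle\alpha^{-1}(\mathbf{U}_{\boldsymbol\eta}-\boldsymbol\eta^t)\cdot\mathbf{n}^\perp,(\mathbf{U}_{\boldsymbol\mu}-\boldsymbol\mu^t)\cdot\mathbf{n}^\perp\rangle_{\partial\mathcal{T}_h}+\langle\tau^{-1}(\mathbf{U}_{\boldsymbol\eta}-\boldsymbol\eta^n)\cdot\mathbf{n},(\mathbf{U}_{\boldsymbol\mu}-\boldsymbol\mu^n)\cdot\mathbf{n}\rangle_{\partial\mathcal{T}_h},$$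 $$l_h(\boldsymbol\mu)=(\mathbf{f},\mathbf{U}_{\boldsymbol\mu})_{\mathcal{T}_h}.$$ Moreover, $(\check{\mathbf{u}}_h,\hat{\mathbf{u}}_h)$ minimizes the total energy functional $$\mathcal{J}_h(\boldsymbol\mu^t,\boldsymbol\mu^n):=\tfrac12a_h\big((\boldsymbol\mu^t,\boldsymbol\mu^n),(\boldsymbol\mu^t,\boldsymbol\mu^n)\big)-l_h(\boldsymbol\mu^t,\boldsymbol\mu^n)$$ over $(\boldsymbol\mu^t,\boldsymbol\mu^n)\in\mathbf{N}_h^t\times\mathbf{N}_h^n$.
   Context: Domain and operators. $\Omega\subset\mathbb{R}^2$ is a bounded, polygonal, simply connected domain with Lipschitz boundary $\Gamma$; $\mathbf{f}\in\mathbf{L}^2(\Omega)=L^2(\Omega)^2$. $(a,b)^\perp:=(b,-a)$. For scalar $\varphi$ and vector $\mathbf{z}=(z_1,z_2)$: $\nabla\varphi=(\partial_x\varphi,\partial_y\varphi)$, $\mathbf{curl}\,\varphi=(\partial_y\varphi,-\partial_x\varphi)$, $\operatorname{div}\mathbf{z}=\partial_xz_1+\partial_yz_2$, $\operatorname{rot}\mathbf{z}=\partial_xz_2-\partial_yz_1$. Mesh. $\mathcal{T}_h$ is a quasi-uniform mesh of disjoint polygonal elements partitioning $\overline\Omega$, with mesh size $h$ (maximum element diameter); quasi-uniform means that there is $\rho>0$, independent of $h$, such that each $K$ is star-shaped with respect to a ball of diameter at least $\rho h$. $\mathcal{E}_h$ is the set of all edges, $\mathcal{E}_h^{i}$ the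 interior and $\mathcal{E}_h^{\partial}$ the boundary edges. $\mathbf{n}$ is the outward unit normal on $\partial K$. $(\cdot,\cdot)_K$, $\langle\cdot,\cdot\rangle_{\partial K}$ are the $L^2$ inner products on $K$, $\partial K$; $(\cdot,\cdot)_{\mathcal{T}_h}=\sum_K(\cdot,\cdot)_K$, $\langle\cdot,\cdot\rangle_{\partial\mathcal{T}_h}=\sum_K\langle\cdot,\cdot\rangle_{\partial K}$. On an interior edge shared by $K^\pm$, $[\![\mathbf{z}\cdot\mathbf{n}]\!]=\mathbf{z}^+\cdot\mathbf{n}^++\mathbf{z}^-\cdot\mathbf{n}^-$ and $[\![\mathbf{z}\cdot\mathbf{n}^\perp]\!]=\mathbf{z}^+\cdot(\mathbf{n}^\perp)^++\mathbf{z}^-\cdot(\mathbf{n}^\perp)^-$. Discrete spaces. Fix an integer $k\ge0$; $\mathcal{P}_k(A)$ denotes polynomials of degree $\le k$ on $A$ and $\boldsymbol{\mathcal{P}}_k(A)=\mathcal{P}_k(A)^2$. $W_h=\{\varphi\in L^2(\Omega):\varphi|_K\in\mathcal{P}_k(K)\ \forall K\}$; $\mathbf{V}_h=\{\mathbf{z}\in\mathbf{L}^2(\Omega):\mathbf{z}|_K\in\boldsymbol{\mathcal{P}}_k(K)\ \forall K\}$; $\mathbf{M}_h$ is the space of vector functions on $\partial\mathcal{T}_h$ (a separate value from each element $K$) whose restriction to each edge $F\subset\partial K$, $K\in\mathcal{T}_h$, is in $\boldsymbol{\mathcal{P}}_k(F)$; $\mathbf{N}_h^{t}=\{\boldsymbol\mu\in\mathbf{M}_h:\boldsymbol\mu\cdot\mathbf{n}=0\text{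 on }\mathcal{E}_h,\ [\![\boldsymbol\mu\cdot\mathbf{n}^\perp]\!]=0\text{ on }\mathcal{E}_h^{i},\ \boldsymbol\mu\cdot\mathbf{n}^\perp=0\text{ on }\mathcal{E}_h^{\partial}\}$; $\mathbf{N}_h^{n}=\{\boldsymbol\mu\in\mathbf{M}_h:\boldsymbol\mu\cdot\mathbf{n}^\perp=0\text{ on }\mathcal{E}_h,\ [\![\boldsymbol\mu\cdot\mathbf{n}]\!]=0\text{ on }\mathcal{E}_h^{i},\ \boldsymbol\mu\cdot\mathbf{n}=0\text{ on }\mathcal{E}_h^{\partial}\}$. HDG system (Hybridization of Type III, Dirichlet boundary conditions). $\alpha>0$ and $\tau>0$ are fixed constants. Find $(\sigma_h,\phi_h,\mathbf{u}_h,\check{\mathbf{u}}_h,\hat{\mathbf{u}}_h)\in W_h\times W_h\times\mathbf{V}_h\times\mathbf{N}_h^{t}\times\mathbf{N}_h^{n}$ such that for all $(\chi,\varphi,\mathbf{z},\boldsymbol\mu^t,\boldsymbol\mu^n)$ in the same product space: $(\sigma_h,\chi)_{\mathcal{T}_h}-(\mathbf{u}_h,\mathbf{curl}\,\chi)_{\mathcal{T}_h}+\langle\check{\mathbf{u}}_h\cdot\mathbf{n}^\perp,\chi\rangle_{\partial\mathcal{T}_h}=0$; $(\phi_h,\varphi)_{\mathcal{T}_h}-(\mathbf{u}_h,\nabla\varphi)_{\mathcal{T}_h}+\langle\hat{\mathbf{u}}_h\cdot\mathbf{n},\varphi\rangle_{\partial\mathcal{T}_h}=0$; $(\sigma_h,\operatorname{rot}\mathbf{z})_{\mathcal{T}_h}+\langle\check\sigma_h,\mathbf{z}\cdot\mathbf{n}^\perp\rangle_{\partial\mathcal{T}_h}-(\phi_h,\operatorname{div}\mathbf{z})_{\mathcal{T}_h}+\langle\hat\phi_h,\mathbf{z}\cdot\mathbf{n}\rangle_{\partial\mathcal{T}_h}=(\mathbf{f},\mathbf{z})_{\mathcal{T}_h}$;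 $\langle\check\sigma_h,\boldsymbol\mu^t\cdot\mathbf{n}^\perp\rangle_{\partial\mathcal{T}_h}=0$; $\langle\hat\phi_h,\boldsymbol\mu^n\cdot\mathbf{n}\rangle_{\partial\mathcal{T}_h}=0$; where $\check\sigma_h,\hat\phi_h$ are defined on $\partial\mathcal{T}_h$ by $(\check{\mathbf{u}}_h-\mathbf{u}_h)\cdot\mathbf{n}^\perp=\alpha(\sigma_h-\check\sigma_h)$ and $(\hat{\mathbf{u}}_h-\mathbf{u}_h)\cdot\mathbf{n}=\tau(\phi_h-\hat\phi_h)$. Differential operators on discrete functions act elementwise. *)

theory Defs
  imports "HOL-Analysis.Analysis"
begin

type_synonym point = "real \<times> real"

definition perp :: "point \<Rightarrow> point" where
  "perp v = (snd v, - fst v)"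

section \<open>Differential operators\<close>

definition dx :: "(point \<Rightarrow> real) \<Rightarrow> point \<Rightarrow> real" where
  "dx \<phi> p = deriv (\<lambda>s. \<phi> (s, snd p)) (fst p)"

definition dy :: "(point \<Rightarrow> real) \<Rightarrow> point \<Rightarrow> real" where
  "dy \<phi> p = deriv (\<lambda>s. \<phi> (fst p, s)) (snd p)"

definition grad :: "(point \<Rightarrow> real) \<Rightarrow> point \<Rightarrow> point" where
  "grad \<phi> p = (dx \<phi> p, dy \<phi> p)"

definition curl :: "(point \<Rightarrow> real) \<Rightarrow> point \<Rightarrow> point" where
  "curl \<phi> p = (dy \<phi> p, - dx \<phi> p)"

definition divg :: "(point \<Rightarrow> point) \<Rightarrow> point \<Rightarrow> real" where
  "divg z p = dx (\<lambda>q. fst (z q)) p + dy (\<lambda>q. snd (z q)) p"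

definition rot :: "(point \<Rightarrow> point) \<Rightarrow> point \<Rightarrow> real" where
  "rot z p = dx (\<lambda>q. snd (z q)) p - dy (\<lambda>q. fst (z q)) p"

section \<open>The domain\<close>

text \<open>Near every boundary point the set is the strict epigraph of a Lipschitz function in the
  orthonormal coordinates with axes \<open>perp e\<close> and \<open>e\<close>.\<close>

definition lipschitz_boundary :: "point set \<Rightarrow> bool" where
  "lipschitz_boundary \<Omega> \<longleftrightarrow>
    (\<forall>p\<in>frontier \<Omega>. \<exists>r>0. \<exists>e. norm e = 1 \<and>
      (\<exists>L g. L-lipschitz_on UNIV g \<and>
        \<Omega> \<inter> ball p r = {x \<in> ball p r. g (x \<bullet> perp e) < x \<bullet> e}))"

definition polygonal_domain :: "point set \<Rightarrow> bool" where
  "polygonal_domain \<Omega> \<longleftrightarrow>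
    \<Omega> \<noteq> {} \<and> open \<Omega> \<and> connected \<Omega> \<and> bounded \<Omega> \<and> simply_connected \<Omega> \<and>
    (\<exists>S. finite S \<and> frontier \<Omega> = (\<Union>(a, b)\<in>S. closed_segment a b)) \<and>
    lipschitz_boundary \<Omega>"

section \<open>Polygonal elements\<close>

text \<open>An element is the list of its vertices in cyclic order (either orientation). Flat angles
  are allowed, so that a hanging node can be listed as a vertex of both adjacent elements.\<close>

type_synonym element = "point list"

fun polygonal_path :: "point list \<Rightarrow> real \<Rightarrow> point" where
  "polygonal_path [] = linepath 0 0"
| "polygonal_path [a] = linepath a a"
| "polygonal_path [a, b] = linepath a b"
| "polygonal_path (a # b # c # ps) = linepath a b +++ polygonal_path (b # c # ps)"

definition bdry :: "element \<Rightarrow> point set" where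
  "bdry K = path_image (polygonal_path (K @ [hd K]))"

definition cell :: "element \<Rightarrow> point set" where
  "cell K = bdry K \<union> inside (bdry K)"

definition polygon :: "element \<Rightarrow> bool" where
  "polygon K \<longleftrightarrow> K \<noteq> [] \<and> simple_path (polygonal_path (K @ [hd K]))"

definition edge_ends :: "element \<Rightarrow> (point \<times> point) set" where
  "edge_ends K = set (zip K (rotate1 K))"

definition edges :: "element \<Rightarrow> point set set" where
  "edges K = (\<lambda>(a, b). closed_segment a b) ` edge_ends K"

text \<open>Characterized at relative interior points of edges only; the vertices form a null set.\<close>

definition outward_normal :: "element \<Rightarrow> point \<Rightarrow> point" where
  "outward_normal K x = (THE n. norm n = 1 \<and>
     (\<exists>F\<in>edges K. x \<in> rel_interior F \<and> (\<forall>p\<in>F. \<forall>q\<in>F. n \<bullet> (p - q) = 0)) \<and>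
     (\<exists>\<epsilon>>0. \<forall>t\<in>{0<..<\<epsilon>}. x + t *\<^sub>R n \<notin> cell K))"

abbreviation tangential :: "element \<Rightarrow> (point \<Rightarrow> point) \<Rightarrow> point \<Rightarrow> real" where
  "tangential K z \<equiv> \<lambda>x. z x \<bullet> perp (outward_normal K x)"

abbreviation normal_comp :: "element \<Rightarrow> (point \<Rightarrow> point) \<Rightarrow> point \<Rightarrow> real" where
  "normal_comp K z \<equiv> \<lambda>x. z x \<bullet> outward_normal K x"

section \<open>The mesh\<close>

definition all_edges :: "element set \<Rightarrow> point set set" where
  "all_edges T = (\<Union>K\<in>T. edges K)"

definition interior_edges :: "element set \<Rightarrow> point set set" where
  "interior_edges T = {F. \<exists>K\<in>T. \<exists>K'\<in>T. K \<noteq> K' \<and> F \<in> edges K \<and> F \<in> edges K'}"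

definition boundary_edges :: "point set \<Rightarrow> element set \<Rightarrow> point set set" where
  "boundary_edges \<Omega> T = {F \<in> all_edges T. F \<subseteq> frontier \<Omega>}"

definition mesh_size :: "element set \<Rightarrow> real" where
  "mesh_size T = Max ((\<lambda>K. diameter (cell K)) ` T)"

definition star_shaped_wrt_ball :: "point set \<Rightarrow> point \<Rightarrow> real \<Rightarrow> bool" where
  "star_shaped_wrt_ball S c r \<longleftrightarrow> (\<forall>y\<in>ball c r. \<forall>x\<in>S. closed_segment y x \<subseteq> S)"

definition quasi_uniform_mesh :: "point set \<Rightarrow> real \<Rightarrow> element set \<Rightarrow> bool" where
  "quasi_uniform_mesh \<Omega> \<rho> T \<longleftrightarrow>
    finite T \<and> (\<forall>K\<in>T. polygon K) \<and>
    (\<Union>K\<in>T. cell K) = closure \<Omega> \<and>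
    (\<forall>K\<in>T. \<forall>K'\<in>T. K \<noteq> K' \<longrightarrow> interior (cell K) \<inter> interior (cell K') = {}) \<and>
    all_edges T = interior_edges T \<union> boundary_edges \<Omega> T \<and>
    \<rho> > 0 \<and>
    (\<forall>K\<in>T. \<exists>c r. 2 * r \<ge> \<rho> * mesh_size T \<and> star_shaped_wrt_ball (cell K) c r)"

section \<open>Square-integrable functions and inner products\<close>

definition L2 :: "'a::euclidean_space set \<Rightarrow> ('a \<Rightarrow> 'b::euclidean_space) set" where
  "L2 A = {f \<in> borel_measurable (lebesgue_on A).
             integrable (lebesgue_on A) (\<lambda>x. (norm (f x))\<^sup>2)}"

text \<open>Functions on the boundary of an element are integrated by arc length, using
  \<open>linepath a b\<close> on \<open>[0,1]\<close>, which has constant speed \<open>norm (b - a)\<close>.\<close>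

definition L2_bdry :: "element \<Rightarrow> (point \<Rightarrow> 'b::euclidean_space) set" where
  "L2_bdry K = {\<eta>. \<forall>(a, b)\<in>edge_ends K. (\<lambda>t. \<eta> (linepath a b t)) \<in> L2 {0..1}}"

definition ip :: "element \<Rightarrow> (point \<Rightarrow> 'b) \<Rightarrow> (point \<Rightarrow> 'b::euclidean_space) \<Rightarrow> real" where
  "ip K f g = (LINT x|lebesgue_on (cell K). f x \<bullet> g x)"

definition bip :: "element \<Rightarrow> (point \<Rightarrow> real) \<Rightarrow> (point \<Rightarrow> real) \<Rightarrow> real" where
  "bip K f g = (\<Sum>(a, b)\<in>edge_ends K. norm (b - a) *
                 (LINT t|lebesgue_on {0..1}. f (linepath a b t) * g (linepath a b t)))"

section \<open>Discrete spaces\<close>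

text \<open>Elements have nonempty interior, so a polynomial on an element is identified with the
  polynomial function on the whole plane that it determines.\<close>

definition polys :: "nat \<Rightarrow> (point \<Rightarrow> real) set" where
  "polys k = {p. \<exists>c. p = (\<lambda>(x, y). \<Sum>i\<le>k. \<Sum>j\<le>k - i. c i j * x ^ i * y ^ j)}"

definition vpolys :: "nat \<Rightarrow> (point \<Rightarrow> point) set" where
  "vpolys k = {z. (\<lambda>x. fst (z x)) \<in> polys k \<and> (\<lambda>x. snd (z x)) \<in> polys k}"

text \<open>Piecewise polynomials on the mesh are families indexed by the elements. As members of
  \<open>L2 \<Omega>\<close> they are classes modulo null sets, so nothing is prescribed about their values on the
  mesh skeleton; the family provides the elementwise derivatives and one-sided traces.\<close>

definition W_space :: "element set \<Rightarrow> nat \<Rightarrow> (element \<Rightarrow> point \<Rightarrow> real) set" where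
  "W_space T k = (\<Pi>\<^sub>E K\<in>T. polys k)"

definition V_space :: "element set \<Rightarrow> nat \<Rightarrow> (element \<Rightarrow> point \<Rightarrow> point) set" where
  "V_space T k = (\<Pi>\<^sub>E K\<in>T. vpolys k)"

text \<open>Traces live on the boundary of each element with the vertices removed: a trace may have
  different limits at a vertex along the two edges meeting there.\<close>

definition edge_poly_space :: "element \<Rightarrow> nat \<Rightarrow> (point \<Rightarrow> point) set" where
  "edge_poly_space K k =
    {m \<in> extensional (\<Union>F\<in>edges K. rel_interior F).
       \<forall>F\<in>edges K. \<exists>p\<in>vpolys k. \<forall>x\<in>rel_interior F. m x = p x}"

definition M_space :: "element set \<Rightarrow> nat \<Rightarrow> (element \<Rightarrow> point \<Rightarrow> point) set" where
  "M_space T k = (\<Pi>\<^sub>E K\<in>T. edge_poly_space K k)"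

definition Nt_space :: "point set \<Rightarrow> element set \<Rightarrow> nat \<Rightarrow> (element \<Rightarrow> point \<Rightarrow> point) set" where
  "Nt_space \<Omega> T k = {\<mu> \<in> M_space T k.
     (\<forall>K\<in>T. \<forall>F\<in>edges K. \<forall>x\<in>rel_interior F. normal_comp K (\<mu> K) x = 0) \<and>
     (\<forall>K\<in>T. \<forall>K'\<in>T. K \<noteq> K' \<longrightarrow> (\<forall>F\<in>edges K \<inter> edges K'. \<forall>x\<in>rel_interior F.
        tangential K (\<mu> K) x + tangential K' (\<mu> K') x = 0)) \<and>
     (\<forall>K\<in>T. \<forall>F\<in>edges K \<inter> boundary_edges \<Omega> T. \<forall>x\<in>rel_interior F.
        tangential K (\<mu> K) x = 0)}"

definition Nn_space :: "point set \<Rightarrow> element set \<Rightarrow> nat \<Rightarrow> (element \<Rightarrow> point \<Rightarrow> point) set" where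
  "Nn_space \<Omega> T k = {\<mu> \<in> M_space T k.
     (\<forall>K\<in>T. \<forall>F\<in>edges K. \<forall>x\<in>rel_interior F. tangential K (\<mu> K) x = 0) \<and>
     (\<forall>K\<in>T. \<forall>K'\<in>T. K \<noteq> K' \<longrightarrow> (\<forall>F\<in>edges K \<inter> edges K'. \<forall>x\<in>rel_interior F.
        normal_comp K (\<mu> K) x + normal_comp K' (\<mu> K') x = 0)) \<and>
     (\<forall>K\<in>T. \<forall>F\<in>edges K \<inter> boundary_edges \<Omega> T. \<forall>x\<in>rel_interior F.
        normal_comp K (\<mu> K) x = 0)}"

section \<open>The HDG system\<close>

text \<open>\<open>check_trace\<close> and \<open>hat_trace\<close> are the numerical traces, i.e. the relations
  \<open>(\<eta> - U) \<bullet> perp n = \<alpha> (\<Sigma> - check)\<close> and \<open>(\<eta> - U) \<bullet> n = \<tau> (\<Phi> - hat)\<close> solved for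
  \<open>check\<close> and \<open>hat\<close>.\<close>

definition check_trace ::
  "real \<Rightarrow> element \<Rightarrow> (point \<Rightarrow> real) \<Rightarrow> (point \<Rightarrow> point) \<Rightarrow> (point \<Rightarrow> point) \<Rightarrow> point \<Rightarrow> real" where
  "check_trace \<alpha> K S U \<eta> = (\<lambda>x. S x + inverse \<alpha> * tangential K (\<lambda>y. U y - \<eta> y) x)"

definition hat_trace ::
  "real \<Rightarrow> element \<Rightarrow> (point \<Rightarrow> real) \<Rightarrow> (point \<Rightarrow> point) \<Rightarrow> (point \<Rightarrow> point) \<Rightarrow> point \<Rightarrow> real" where
  "hat_trace \<tau> K P U \<eta> = (\<lambda>x. P x + inverse \<tau> * normal_comp K (\<lambda>y. U y - \<eta> y) x)"

definition hdg_solution ::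
  "point set \<Rightarrow> element set \<Rightarrow> nat \<Rightarrow> real \<Rightarrow> real \<Rightarrow> (point \<Rightarrow> point) \<Rightarrow>
   (element \<Rightarrow> point \<Rightarrow> real) \<times> (element \<Rightarrow> point \<Rightarrow> real) \<times> (element \<Rightarrow> point \<Rightarrow> point) \<times>
   (element \<Rightarrow> point \<Rightarrow> point) \<times> (element \<Rightarrow> point \<Rightarrow> point) \<Rightarrow> bool" where
  "hdg_solution \<Omega> T k \<alpha> \<tau> f = (\<lambda>(\<sigma>, \<phi>, u, uc, uh).
    \<sigma> \<in> W_space T k \<and> \<phi> \<in> W_space T k \<and> u \<in> V_space T k \<and>
    uc \<in> Nt_space \<Omega> T k \<and> uh \<in> Nn_space \<Omega> T k \<and>
    (\<forall>\<xi>\<in>W_space T k.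
       (\<Sum>K\<in>T. ip K (\<sigma> K) (\<xi> K)) - (\<Sum>K\<in>T. ip K (u K) (curl (\<xi> K)))
       + (\<Sum>K\<in>T. bip K (tangential K (uc K)) (\<xi> K)) = 0) \<and>
    (\<forall>\<psi>\<in>W_space T k.
       (\<Sum>K\<in>T. ip K (\<phi> K) (\<psi> K)) - (\<Sum>K\<in>T. ip K (u K) (grad (\<psi> K)))
       + (\<Sum>K\<in>T. bip K (normal_comp K (uh K)) (\<psi> K)) = 0) \<and>
    (\<forall>z\<in>V_space T k.
       (\<Sum>K\<in>T. ip K (\<sigma> K) (rot (z K)))
       + (\<Sum>K\<in>T. bip K (check_trace \<alpha> K (\<sigma> K) (u K) (uc K)) (tangential K (z K)))
       - (\<Sum>K\<in>T. ip K (\<phi> K) (divg (z K)))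
       + (\<Sum>K\<in>T. bip K (hat_trace \<tau> K (\<phi> K) (u K) (uh K)) (normal_comp K (z K)))
       = (\<Sum>K\<in>T. ip K f (z K))) \<and>
    (\<forall>\<mu>\<in>Nt_space \<Omega> T k.
       (\<Sum>K\<in>T. bip K (check_trace \<alpha> K (\<sigma> K) (u K) (uc K)) (tangential K (\<mu> K))) = 0) \<and>
    (\<forall>\<mu>\<in>Nn_space \<Omega> T k.
       (\<Sum>K\<in>T. bip K (hat_trace \<tau> K (\<phi> K) (u K) (uh K)) (normal_comp K (\<mu> K))) = 0))"

section \<open>The local problems\<close>

definition local_problem_trace ::
  "nat \<Rightarrow> real \<Rightarrow> real \<Rightarrow> element \<Rightarrow> (point \<Rightarrow> point) \<Rightarrow> (point \<Rightarrow> point) \<Rightarrow>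
   (point \<Rightarrow> real) \<times> (point \<Rightarrow> real) \<times> (point \<Rightarrow> point) \<Rightarrow> bool" where
  "local_problem_trace k \<alpha> \<tau> K \<eta>t \<eta>n = (\<lambda>(S, P, U).
    S \<in> polys k \<and> P \<in> polys k \<and> U \<in> vpolys k \<and>
    (\<forall>\<xi>\<in>polys k.
       ip K S \<xi> - ip K U (curl \<xi>) + bip K (tangential K \<eta>t) \<xi> = 0) \<and>
    (\<forall>\<psi>\<in>polys k.
       ip K P \<psi> - ip K U (grad \<psi>) + bip K (normal_comp K \<eta>n) \<psi> = 0) \<and>
    (\<forall>z\<in>vpolys k.
       ip K S (rot z) + bip K (check_trace \<alpha> K S U \<eta>t) (tangential K z)
       - ip K P (divg z) + bip K (hat_trace \<tau> K P U \<eta>n) (normal_comp K z) = 0))"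

definition local_problem_source ::
  "nat \<Rightarrow> real \<Rightarrow> real \<Rightarrow> element \<Rightarrow> (point \<Rightarrow> point) \<Rightarrow>
   (point \<Rightarrow> real) \<times> (point \<Rightarrow> real) \<times> (point \<Rightarrow> point) \<Rightarrow> bool" where
  "local_problem_source k \<alpha> \<tau> K f = (\<lambda>(S, P, U).
    S \<in> polys k \<and> P \<in> polys k \<and> U \<in> vpolys k \<and>
    (\<forall>\<xi>\<in>polys k. ip K S \<xi> - ip K U (curl \<xi>) = 0) \<and>
    (\<forall>\<psi>\<in>polys k. ip K P \<psi> - ip K U (grad \<psi>) = 0) \<and>
    (\<forall>z\<in>vpolys k.
       ip K S (rot z) + bip K (check_trace \<alpha> K S U (\<lambda>_. 0)) (tangential K z)
       - ip K P (divg z) + bip K (hat_trace \<tau> K P U (\<lambda>_. 0)) (normal_comp K z)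
       = ip K f z))"

definition trace_sol ::
  "nat \<Rightarrow> real \<Rightarrow> real \<Rightarrow> element \<Rightarrow> (point \<Rightarrow> point) \<Rightarrow> (point \<Rightarrow> point) \<Rightarrow>
   (point \<Rightarrow> real) \<times> (point \<Rightarrow> real) \<times> (point \<Rightarrow> point)" where
  "trace_sol k \<alpha> \<tau> K \<eta>t \<eta>n = (THE s. local_problem_trace k \<alpha> \<tau> K \<eta>t \<eta>n s)"

definition source_sol ::
  "nat \<Rightarrow> real \<Rightarrow> real \<Rightarrow> element \<Rightarrow> (point \<Rightarrow> point) \<Rightarrow>
   (point \<Rightarrow> real) \<times> (point \<Rightarrow> real) \<times> (point \<Rightarrow> point)" where
  "source_sol k \<alpha> \<tau> K f = (THE s. local_problem_source k \<alpha> \<tau> K f s)"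

definition Sigma_trace where "Sigma_trace k \<alpha> \<tau> K \<eta>t \<eta>n = fst (trace_sol k \<alpha> \<tau> K \<eta>t \<eta>n)"
definition Phi_trace where "Phi_trace k \<alpha> \<tau> K \<eta>t \<eta>n = fst (snd (trace_sol k \<alpha> \<tau> K \<eta>t \<eta>n))"
definition U_trace where "U_trace k \<alpha> \<tau> K \<eta>t \<eta>n = snd (snd (trace_sol k \<alpha> \<tau> K \<eta>t \<eta>n))"

definition Sigma_source where "Sigma_source k \<alpha> \<tau> K f = fst (source_sol k \<alpha> \<tau> K f)"
definition Phi_source where "Phi_source k \<alpha> \<tau> K f = fst (snd (source_sol k \<alpha> \<tau> K f))"
definition U_source where "U_source k \<alpha> \<tau> K f = snd (snd (source_sol k \<alpha> \<tau> K f))"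

section \<open>The condensed problem\<close>

type_synonym trace_pair = "(element \<Rightarrow> point \<Rightarrow> point) \<times> (element \<Rightarrow> point \<Rightarrow> point)"

definition a_form ::
  "element set \<Rightarrow> nat \<Rightarrow> real \<Rightarrow> real \<Rightarrow> trace_pair \<Rightarrow> trace_pair \<Rightarrow> real" where
  "a_form T k \<alpha> \<tau> = (\<lambda>(\<eta>t, \<eta>n) (\<mu>t, \<mu>n).
     (\<Sum>K\<in>T. ip K (Sigma_trace k \<alpha> \<tau> K (\<eta>t K) (\<eta>n K)) (Sigma_trace k \<alpha> \<tau> K (\<mu>t K) (\<mu>n K)))
   + (\<Sum>K\<in>T. ip K (Phi_trace k \<alpha> \<tau> K (\<eta>t K) (\<eta>n K)) (Phi_trace k \<alpha> \<tau> K (\<mu>t K) (\<mu>n K)))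
   + (\<Sum>K\<in>T. bip K
        (\<lambda>x. inverse \<alpha> * tangential K (\<lambda>y. U_trace k \<alpha> \<tau> K (\<eta>t K) (\<eta>n K) y - \<eta>t K y) x)
        (tangential K (\<lambda>y. U_trace k \<alpha> \<tau> K (\<mu>t K) (\<mu>n K) y - \<mu>t K y)))
   + (\<Sum>K\<in>T. bip K
        (\<lambda>x. inverse \<tau> * normal_comp K (\<lambda>y. U_trace k \<alpha> \<tau> K (\<eta>t K) (\<eta>n K) y - \<eta>n K y) x)
        (normal_comp K (\<lambda>y. U_trace k \<alpha> \<tau> K (\<mu>t K) (\<mu>n K) y - \<mu>n K y))))"

definition l_form ::
  "element set \<Rightarrow> nat \<Rightarrow> real \<Rightarrow> real \<Rightarrow> (point \<Rightarrow> point) \<Rightarrow> trace_pair \<Rightarrow> real" where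
  "l_form T k \<alpha> \<tau> f = (\<lambda>(\<mu>t, \<mu>n). \<Sum>K\<in>T. ip K f (U_trace k \<alpha> \<tau> K (\<mu>t K) (\<mu>n K)))"

definition condensed_solution ::
  "point set \<Rightarrow> element set \<Rightarrow> nat \<Rightarrow> real \<Rightarrow> real \<Rightarrow> (point \<Rightarrow> point) \<Rightarrow> trace_pair \<Rightarrow> bool" where
  "condensed_solution \<Omega> T k \<alpha> \<tau> f \<eta> \<longleftrightarrow>
     \<eta> \<in> Nt_space \<Omega> T k \<times> Nn_space \<Omega> T k \<and>
     (\<forall>\<mu>\<in>Nt_space \<Omega> T k \<times> Nn_space \<Omega> T k. a_form T k \<alpha> \<tau> \<eta> \<mu> = l_form T k \<alpha> \<tau> f \<mu>)"

definition energy ::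
  "element set \<Rightarrow> nat \<Rightarrow> real \<Rightarrow> real \<Rightarrow> (point \<Rightarrow> point) \<Rightarrow> trace_pair \<Rightarrow> real" where
  "energy T k \<alpha> \<tau> f \<mu> = 1 / 2 * a_form T k \<alpha> \<tau> \<mu> \<mu> - l_form T k \<alpha> \<tau> f \<mu>"

end

theory Submission
  imports Defs "HOL-Computational_Algebra.Polynomial"
begin

text \<open>
  Integration by parts on an element gives the reciprocity identity: for a local solution with
  data \<open>(\<eta>, g)\<close> and one with data \<open>(\<mu>, g')\<close>, the element form equals \<open>(g, U')\<close> minus the pairings of the
  numerical traces of the first with the components of \<open>\<mu>\<close>. Summed over the mesh, the conservation
  equations of the HDG system become \<open>a\<^sub>h(\<eta>, \<mu>) = l\<^sub>h(\<mu>)\<close>.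

  If the element form vanishes on \<open>(\<eta>, \<eta>)\<close>, then \<open>\<Sigma> = \<Phi> = 0\<close>, the traces of \<open>U\<close> agree with \<open>\<eta>\<close>, and \<open>U\<close> is
  divergence and rotation free on each element. As the traces cancel across the skeleton, the
  piecewise field \<open>U\<close> is orthogonal to \<open>grad \<phi>\<close> and \<open>curl \<phi>\<close> for polynomials \<open>\<phi>\<close> of every degree on
  the whole domain. The Laplacian is surjective on polynomials, so these span all polynomial
  fields, and Weierstrass approximation yields \<open>U = 0\<close>; no regularity theory or connectivity of the
  mesh is needed. The same argument on a single element gives unique solvability of the local
  problems, and existence follows from uniqueness by finite dimensionality.

  The divergence theorem on an element is proved by cutting it into triangles with apex in the
  center of the ball of star-shapedness.
\<close>

section \<open>Finite-dimensional Riesz representation and bivariate polynomials\<close>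

text \<open>The local equations are tested with degree \<open>k\<close> only, while the potentials
  \<phi> of the orthogonality argument have arbitrary degree. The gap closes because
  \<open>rot U\<close> and \<open>divg U\<close> are themselves of degree at most \<open>k\<close>:
  tested with them, the equations make both vanish, and integration by parts against a polynomial of
  any degree then leaves boundary terms only.

  Existence is taken from a Riesz representation for symmetric forms, not from a dimension count.
  The local system is not symmetric; its first two equations express \<Sigma> and \<Phi> through
  \<open>U\<close>, and what remains for \<open>U\<close> is symmetric and positive definite. The
  condensed form is symmetric from the start.

  \<open>Sigma_trace\<close>, \<open>Phi_trace\<close> and \<open>U_trace\<close> are definite
  descriptions, so even their linearity in the traces rests on unique solvability of the local
  problems. Traces carry no information at vertices: identities between them hold on relative
  interiors of edges, and insensitivity of the integrals to null sets absorbs the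
  difference.\<close>

text \<open>The vector space structure enters only through \<open>cb x c y\<close>, standing for \<open>x + c y\<close>; this allows
  spaces of extensional functions. Induction over the functionals: \<open>W\<close> is the kernel of the new
  functional plus at most one orthogonal direction.\<close>

lemma finite_riesz_aux:
  fixes B :: "'v \<Rightarrow> 'v \<Rightarrow> real" and cb :: "'v \<Rightarrow> real \<Rightarrow> 'v \<Rightarrow> 'v"
    and ev :: "'d \<Rightarrow> 'v \<Rightarrow> real"
  assumes "finite D"
    and "W \<noteq> {}"
    and cb: "\<And>x y c. x \<in> W \<Longrightarrow> y \<in> W \<Longrightarrow> cb x c y \<in> W"
    and d: "\<And>d x y c. d \<in> D \<Longrightarrow> x \<in> W \<Longrightarrow> y \<in> W \<Longrightarrow> ev d (cb x c y) = ev d x + c * ev d y"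
    and B: "\<And>x y z c. x \<in> W \<Longrightarrow> y \<in> W \<Longrightarrow> z \<in> W \<Longrightarrow> B (cb x c y) z = B x z + c * B y z"
    and sym: "\<And>x y. x \<in> W \<Longrightarrow> y \<in> W \<Longrightarrow> B x y = B y x"
    and L: "\<And>x y c. x \<in> W \<Longrightarrow> y \<in> W \<Longrightarrow> L (cb x c y) = L x + c * L y"
    and def: "\<And>w. w \<in> W \<Longrightarrow> B w w = 0 \<Longrightarrow> L w = 0 \<and> (\<forall>v\<in>W. B w v = 0)"
    and sep: "\<And>w. w \<in> W \<Longrightarrow> \<forall>d\<in>D. ev d w = 0 \<Longrightarrow> L w = 0 \<and> (\<forall>v\<in>W. B w v = 0)"
  shows "\<exists>v\<in>W. \<forall>w\<in>W. B v w = L w"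
  using assms
proof (induction D arbitrary: W L rule: finite_induct)
  case empty
  then show ?case by (metis all_not_in_conv empty_iff)
next
  case (insert d D)
  define W' where "W' = {w\<in>W. ev d w = 0}"
  note W = insert.prems
  show ?case
  proof (cases "\<forall>w\<in>W. ev d w = 0")
    case True
    show ?thesis
    proof (rule insert.IH[OF W(1)])
      show "L w = 0 \<and> (\<forall>v\<in>W. B w v = 0)" if "w \<in> W" "\<forall>d\<in>D. ev d w = 0" for w
        using W(8) that True by blast
    qed (rule W(2) W(3)[OF insertI2] W(4) W(5) W(6) W(7); assumption)+
  next
    case False
    then obtain w1 where w1: "w1 \<in> W" "ev d w1 \<noteq> 0" by auto
    \<comment> \<open>\<open>W\<close> comes without a distinguished zero; \<open>w1 - w1\<close>
      takes its place, so that a multiple of \<open>w1\<close> can be formed by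
      \<open>cb\<close>.\<close>
    define o1 where "o1 = cb w1 (-1) w1"
    have o1: "o1 \<in> W" "ev d o1 = 0" using w1 W(2,3) by (auto simp: o1_def)
    define w0 where "w0 = cb o1 (1 / ev d w1) w1"
    have w0: "w0 \<in> W" "ev d w0 = 1" using w1 o1 W(2,3) by (auto simp: w0_def)
    have ex: "\<exists>v\<in>W'. \<forall>w\<in>W'. B v w = M w"
      if M: "\<And>x y c. x \<in> W \<Longrightarrow> y \<in> W \<Longrightarrow> M (cb x c y) = M x + c * M y"
        and Mdef: "\<And>w. w \<in> W \<Longrightarrow> B w w = 0 \<Longrightarrow> M w = 0"
        and Msep: "\<And>w. w \<in> W \<Longrightarrow> \<forall>d\<in>insert d D. ev d w = 0 \<Longrightarrow> M w = 0" for M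
    proof (rule insert.IH)
      show "W' \<noteq> {}" using o1 by (auto simp: W'_def)
      show "cb x c y \<in> W'" if "x \<in> W'" "y \<in> W'" for x y c
        using that W(2) W(3)[OF insertI1] by (simp add: W'_def)
      show "M w = 0 \<and> (\<forall>v\<in>W'. B w v = 0)" if "w \<in> W'" "B w w = 0" for w
        using that Mdef W(7) unfolding W'_def by blast
      show "M w = 0 \<and> (\<forall>v\<in>W'. B w v = 0)" if "w \<in> W'" "\<forall>d\<in>D. ev d w = 0" for w
        using that Msep W(8) unfolding W'_def by blast
    qed ((rule M W(3)[OF insertI2] W(4) W(5); simp add: W'_def)+)
    obtain v where v: "v \<in> W'" "\<And>w. w \<in> W' \<Longrightarrow> B v w = L w"
      using ex[of L] W(6-8) by blast
    \<comment> \<open>\<open>p\<close> is the \<open>B\<close>-projection of \<open>w0\<close> to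
      the kernel \<open>W'\<close>, again by the induction hypothesis; \<open>w0 - p\<close> is the
      one direction orthogonal to \<open>W'\<close>.\<close>
    obtain p where p: "p \<in> W'" "\<And>w. w \<in> W' \<Longrightarrow> B p w = B w0 w"
      proof -
      have "\<exists>v\<in>W'. \<forall>w\<in>W'. B v w = B w w0" proof (rule ex)
        show "B w w0 = 0" if "w \<in> W" "B w w = 0" for w using that W(7) w0 by blast
        show "B w w0 = 0" if "w \<in> W" "\<forall>d\<in>insert d D. ev d w = 0" for w using that W(8) w0 by blast
      qed (rule W(4); (assumption | rule w0))
      then show ?thesis using that W(5) w0 by (auto simp: W'_def)
    qed
    have [simp]: "v \<in> W" "p \<in> W" "ev d v = 0" "ev d p = 0" using v p by (auto simp: W'_def)
    define q where "q = cb w0 (-1) p"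
    have q: "q \<in> W" "ev d q = 1" using w0 W(2,3) by (auto simp: q_def)
    have qW: "B q w = 0" if "w \<in> W'" for w
      using that p(2)[OF that] W(4) w0 by (auto simp: q_def W'_def)
    have split: "L w - B v w = ev d w * (L q - B v q) \<and> B q w = ev d w * B q q" if w: "w \<in> W" for w
    proof -
      define w' where "w' = cb w (- ev d w) q"
      have w': "w' \<in> W'" using w q W(2,3) by (auto simp: w'_def W'_def)
      then have "w' \<in> W" by (simp add: W'_def)
      have "L w' = L w - ev d w * L q" using w q W(6) by (simp add: w'_def)
      moreover have Bz: "B z w' = B z w - ev d w * B z q" if "z \<in> W" for z
        using W(5)[OF that \<open>w' \<in> W\<close>] W(5)[OF that w] W(5)[OF that q(1)] W(4)[OF w q(1) that]
        by (simp add: w'_def)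
      ultimately show ?thesis
        using v(2)[OF w'] qW[OF w'] Bz[OF q(1)] Bz[of v] by (simp add: algebra_simps)
    qed
    show ?thesis
    \<comment> \<open>If \<open>B q q = 0\<close>, then \<open>q\<close> is in the kernel of both
      \<open>L\<close> and \<open>B\<close>, and \<open>v\<close> already represents
      \<open>L\<close>. Otherwise the coefficient of \<open>q\<close> is the residual of
      \<open>v\<close> at \<open>q\<close> divided by \<open>B q q\<close>.\<close>
    proof (cases "B q q = 0")
      case True
      then have "L q = 0" "B q v = 0" using W(7) q \<open>v \<in> W\<close> by blast+
      then have "L q - B v q = 0" using W(5)[OF \<open>v \<in> W\<close> q(1)] by simp
      then show ?thesis using split by (intro bexI[of _ v]) auto
    next
      case False
      define u where "u = cb v ((L q - B v q) / B q q) q"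
      have "B u w = L w" if w: "w \<in> W" for w
      proof -
        have "B u w = B v w + (L q - B v q) / B q q * B q w"
          unfolding u_def using W(4) w q by simp
        also have "\<dots> = B v w + (L q - B v q) * ev d w"
          using split[OF w] False by simp
        also have "\<dots> = L w" using split[OF w] by (simp add: mult.commute)
        finally show ?thesis .
      qed
      moreover have "u \<in> W" unfolding u_def using W(2) q by simp
      ultimately show ?thesis by auto
    qed
  qed
qed

text \<open>The form for applications: a null element \<open>z\<close> is named, and both the form
  and finitely many functionals distinguish it from all other elements. The functionals replace a
  basis; there may be more of them than the dimension.\<close>

lemma finite_riesz:
  fixes B :: "'v \<Rightarrow> 'v \<Rightarrow> real" and cb :: "'v \<Rightarrow> real \<Rightarrow> 'v \<Rightarrow> 'v"
    and ev :: "'d \<Rightarrow> 'v \<Rightarrow> real"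
  assumes "finite D"
    and z: "z \<in> W"
    and cb: "\<And>x y c. x \<in> W \<Longrightarrow> y \<in> W \<Longrightarrow> cb x c y \<in> W"
    and d: "\<And>d x y c. d \<in> D \<Longrightarrow> x \<in> W \<Longrightarrow> y \<in> W \<Longrightarrow> ev d (cb x c y) = ev d x + c * ev d y"
    and B: "\<And>x y z c. x \<in> W \<Longrightarrow> y \<in> W \<Longrightarrow> z \<in> W \<Longrightarrow> B (cb x c y) z = B x z + c * B y z"
    and sym: "\<And>x y. x \<in> W \<Longrightarrow> y \<in> W \<Longrightarrow> B x y = B y x"
    and L: "\<And>x y c. x \<in> W \<Longrightarrow> y \<in> W \<Longrightarrow> L (cb x c y) = L x + c * L y"
    and def: "\<And>w. w \<in> W \<Longrightarrow> B w w = 0 \<Longrightarrow> w = z"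
    and sep: "\<And>w. w \<in> W \<Longrightarrow> \<forall>d\<in>D. ev d w = 0 \<Longrightarrow> w = z"
  shows "\<exists>v\<in>W. \<forall>w\<in>W. B v w = L w"
proof -
  \<comment> \<open>Nothing says that \<open>z\<close> acts as a zero. Separation by the functionals
    gives \<open>z - z = z\<close>, and hence every linear map vanishes at \<open>z\<close>.\<close>
  have zz: "cb z (-1) z = z" using z cb d by (intro sep) auto
  have "L z = 0" using L[OF z z, of "-1"] by (simp add: zz)
  moreover have "B z v = 0" if "v \<in> W" for v using B[OF z z that, of "-1"] by (simp add: zz)
  ultimately have null: "L w = 0 \<and> (\<forall>v\<in>W. B w v = 0)" if "w = z" for w
    using that by blast
  show ?thesis
  proof (rule finite_riesz_aux[of D W cb ev])
    show "L w = 0 \<and> (\<forall>v\<in>W. B w v = 0)" if "w \<in> W" "B w w = 0" for w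
      using that by (intro null def)
    show "L w = 0 \<and> (\<forall>v\<in>W. B w v = 0)" if "w \<in> W" "\<forall>d\<in>D. ev d w = 0" for w
      using that by (intro null sep)
    show "W \<noteq> {}" using z by blast
  qed ((rule assms; assumption)+)
qed

section \<open>Linear structure of the polynomials of bounded degree\<close>

lemma polys_comb:
  assumes "p \<in> polys k" "q \<in> polys k"
  shows "(\<lambda>x. p x + c * q x) \<in> polys k"
proof -
  obtain a b where p: "p = (\<lambda>(x, y). \<Sum>i\<le>k. \<Sum>j\<le>k - i. a i j * x ^ i * y ^ j)"
    and q: "q = (\<lambda>(x, y). \<Sum>i\<le>k. \<Sum>j\<le>k - i. b i j * x ^ i * y ^ j)"
    using assms unfolding polys_def by blast
  have "(\<lambda>x. p x + c * q x) = (\<lambda>(x, y). \<Sum>i\<le>k. \<Sum>j\<le>k - i. (a i j + c * b i j) * x ^ i * y ^ j)"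
    by (simp add: p q fun_eq_iff sum_distrib_left algebra_simps flip: sum.distrib)
  then show ?thesis unfolding polys_def by (intro CollectI exI[of _ "\<lambda>i j. a i j + c * b i j"])
qed

lemma polys_zero: "(\<lambda>_. 0) \<in> polys k"
  unfolding polys_def by (rule CollectI, rule exI[of _ "\<lambda>_ _. 0"]) auto

lemma polys_monom:
  assumes "i + j \<le> k"
  shows "(\<lambda>(x, y). c * x ^ i * y ^ j) \<in> polys k"
proof -
  have "(\<Sum>i'\<le>k. \<Sum>j'\<le>k - i'. (if i' = i \<and> j' = j then c else 0) * x ^ i' * y ^ j') = c * x ^ i * y ^ j"
    for x y :: real
  proof -
    have "(\<Sum>i'\<le>k. \<Sum>j'\<le>k - i'. (if i' = i \<and> j' = j then c else 0) * x ^ i' * y ^ j')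
        = (\<Sum>i'\<le>k. if i' = i then c * x ^ i * y ^ j else 0)"
    proof (rule sum.cong[OF refl], goal_cases)
      case (1 i')
      have "(\<Sum>j'\<le>k - i. (if j' = j then c else 0) * x ^ i * y ^ j') = c * x ^ i * y ^ j"
        using assms by (simp add: if_distrib[of "\<lambda>u. u * _"] sum.delta cong: if_cong)
      then show ?case by auto
    qed
    also have "\<dots> = c * x ^ i * y ^ j" using assms by (simp add: sum.delta)
    finally show ?thesis .
  qed
  then show ?thesis unfolding polys_def
    by (intro CollectI exI[of _ "\<lambda>i' j'. if i' = i \<and> j' = j then c else 0"]) auto
qed

lemma polys_sum: "finite I \<Longrightarrow> (\<And>i. i \<in> I \<Longrightarrow> f i \<in> polys k) \<Longrightarrow> (\<lambda>x. \<Sum>i\<in>I. f i x) \<in> polys k"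
proof (induction I rule: finite_induct)
  case empty
  then show ?case by (simp add: polys_zero)
next
  case (insert i I)
  then show ?case using polys_comb[of "f i" k "\<lambda>x. \<Sum>i\<in>I. f i x" 1] by simp
qed

lemma vpolys_comb:
  assumes "p \<in> vpolys k" "q \<in> vpolys k"
  shows "(\<lambda>x. p x + c *\<^sub>R q x) \<in> vpolys k"
  using assms by (auto simp: vpolys_def intro!: polys_comb)

lemma vpolys_zero: "(\<lambda>_. 0) \<in> vpolys k"
  by (simp add: vpolys_def polys_zero)

section \<open>Partial derivatives of polynomials\<close>

text \<open>\<open>dx\<close> and \<open>dy\<close> are total functions made from
  \<open>deriv\<close>; a total derivative in coordinates is the certificate from which both are
  read off.\<close>

lemma dx_eq: 
  assumes "(p has_derivative (\<lambda>h. a * fst h + b * snd h)) (at x)"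
  shows "dx p x = a" and "dy p x = b"
proof -
  have "((\<lambda>s. (s, snd x)) has_derivative (\<lambda>h. (h, 0))) (at (fst x))"
    by (auto intro!: derivative_eq_intros)
  from has_derivative_compose[OF this, of p "\<lambda>h. a * fst h + b * snd h"] assms
  have "((\<lambda>s. p (s, snd x)) has_derivative (\<lambda>h. a * h)) (at (fst x))" by simp
  then show "dx p x = a" unfolding dx_def
    by (intro DERIV_imp_deriv) (simp add: has_field_derivative_def)
  have "((\<lambda>s. (fst x, s)) has_derivative (\<lambda>h. (0, h))) (at (snd x))"
    by (auto intro!: derivative_eq_intros)
  from has_derivative_compose[OF this, of p "\<lambda>h. a * fst h + b * snd h"] assms
  have "((\<lambda>s. p (fst x, s)) has_derivative (\<lambda>h. b * h)) (at (snd x))" by simp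
  then show "dy p x = b" unfolding dy_def
    by (intro DERIV_imp_deriv) (simp add: has_field_derivative_def)
qed

lemma bounded_linear_plane:
  fixes f :: "point \<Rightarrow> real"
  assumes "bounded_linear f"
  shows "f = (\<lambda>h. f (1, 0) * fst h + f (0, 1) * snd h)"
proof
  fix h
  have "f h = f (fst h *\<^sub>R (1, 0) + snd h *\<^sub>R (0, 1))" by (cases h) simp
  also have "\<dots> = f (1, 0) * fst h + f (0, 1) * snd h"
    using assms by (simp only: linear_simps) simp
  finally show "f h = f (1, 0) * fst h + f (0, 1) * snd h" .
qed

text \<open>With the partial derivatives named existentially, the induction needs no computation
  with \<open>deriv\<close>; \<open>dx_eq\<close> identifies them afterwards.\<close>

lemma real_polynomial_derivative_ex:
  fixes p :: "point \<Rightarrow> real"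
  assumes "real_polynomial_function p"
  shows "\<exists>p1 p2. real_polynomial_function p1 \<and> real_polynomial_function p2 \<and>
    (\<forall>x. (p has_derivative (\<lambda>h. p1 x * fst h + p2 x * snd h)) (at x))"
  using assms
proof (induction rule: real_polynomial_function.induct)
  case (linear f)
  have "(f has_derivative (\<lambda>h. f (1, 0) * fst h + f (0, 1) * snd h)) (at x)" for x
    by (rule has_derivative_eq_rhs[OF bounded_linear_imp_has_derivative[OF linear] bounded_linear_plane[OF linear]])
  then show ?case
    by (intro exI[of _ "\<lambda>_. f (1, 0)"] exI[of _ "\<lambda>_. f (0, 1)"]) (auto intro: real_polynomial_function.intros)
next
  case (const c)
  show ?case
    by (intro exI[of _ "\<lambda>_. 0"]) (auto intro: real_polynomial_function.intros)
next
  case (add f g)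
  from add.IH(1) obtain f1 f2 where f: "real_polynomial_function f1" "real_polynomial_function f2"
    "\<And>x. (f has_derivative (\<lambda>h. f1 x * fst h + f2 x * snd h)) (at x)" by blast
  from add.IH(2) obtain g1 g2 where g: "real_polynomial_function g1" "real_polynomial_function g2"
    "\<And>x. (g has_derivative (\<lambda>h. g1 x * fst h + g2 x * snd h)) (at x)" by blast
  note D = f(3) g(3)
  have "((\<lambda>x. f x + g x) has_derivative (\<lambda>h. (f1 x + g1 x) * fst h + (f2 x + g2 x) * snd h)) (at x)" for x
    by (rule has_derivative_eq_rhs[OF has_derivative_add[OF D]]) (auto simp: algebra_simps)
  then show ?case using f g
    by (intro exI[of _ "\<lambda>x. f1 x + g1 x"] exI[of _ "\<lambda>x. f2 x + g2 x"]) (auto intro: real_polynomial_function.intros)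
next
  case (mult f g)
  from mult.IH(1) obtain f1 f2 where f: "real_polynomial_function f1" "real_polynomial_function f2"
    "\<And>x. (f has_derivative (\<lambda>h. f1 x * fst h + f2 x * snd h)) (at x)" by blast
  from mult.IH(2) obtain g1 g2 where g: "real_polynomial_function g1" "real_polynomial_function g2"
    "\<And>x. (g has_derivative (\<lambda>h. g1 x * fst h + g2 x * snd h)) (at x)" by blast
  note D = f(3) g(3)
  have "((\<lambda>x. f x * g x) has_derivative
      (\<lambda>h. (f1 x * g x + f x * g1 x) * fst h + (f2 x * g x + f x * g2 x) * snd h)) (at x)" for x
    by (rule has_derivative_eq_rhs[OF has_derivative_mult[OF D]]) (auto simp: algebra_simps)
  then show ?case using f g mult.hyps
    by (intro exI[of _ "\<lambda>x. f1 x * g x + f x * g1 x"] exI[of _ "\<lambda>x. f2 x * g x + f x * g2 x"])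
      (auto intro: real_polynomial_function.intros)
qed

lemma
  assumes "real_polynomial_function p"
  shows real_polynomial_has_derivative:
      "(p has_derivative (\<lambda>h. dx p x * fst h + dy p x * snd h)) (at x)"
    and real_polynomial_dx: "real_polynomial_function (dx p)"
    and real_polynomial_dy: "real_polynomial_function (dy p)"
proof -
  obtain p1 p2 where p: "real_polynomial_function p1" "real_polynomial_function p2"
    "\<And>x. (p has_derivative (\<lambda>h. p1 x * fst h + p2 x * snd h)) (at x)"
    using real_polynomial_derivative_ex[OF assms] by blast
  have "dx p = p1" "dy p = p2" using dx_eq[OF p(3)] by auto
  then show "(p has_derivative (\<lambda>h. dx p x * fst h + dy p x * snd h)) (at x)"
    "real_polynomial_function (dx p)" "real_polynomial_function (dy p)" using p by auto
qed

lemma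
  assumes "real_polynomial_function p" "real_polynomial_function q"
  shows dx_add: "dx (\<lambda>x. p x + q x) x = dx p x + dx q x"
    and dy_add: "dy (\<lambda>x. p x + q x) x = dy p x + dy q x"
    and dx_mult: "dx (\<lambda>x. p x * q x) x = dx p x * q x + p x * dx q x"
    and dy_mult: "dy (\<lambda>x. p x * q x) x = dy p x * q x + p x * dy q x"
proof -
  note D = real_polynomial_has_derivative[OF assms(1)] real_polynomial_has_derivative[OF assms(2)]
  have A: "((\<lambda>x. p x + q x) has_derivative (\<lambda>h. (dx p x + dx q x) * fst h + (dy p x + dy q x) * snd h)) (at x)"
    by (rule has_derivative_eq_rhs[OF has_derivative_add[OF D]]) (auto simp: algebra_simps)
  show "dx (\<lambda>x. p x + q x) x = dx p x + dx q x" "dy (\<lambda>x. p x + q x) x = dy p x + dy q x"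
    by (rule dx_eq[OF A])+
  have M: "((\<lambda>x. p x * q x) has_derivative
      (\<lambda>h. (dx p x * q x + p x * dx q x) * fst h + (dy p x * q x + p x * dy q x) * snd h)) (at x)"
    by (rule has_derivative_eq_rhs[OF has_derivative_mult[OF D]]) (auto simp: algebra_simps)
  show "dx (\<lambda>x. p x * q x) x = dx p x * q x + p x * dx q x"
    "dy (\<lambda>x. p x * q x) x = dy p x * q x + p x * dy q x"
    by (rule dx_eq[OF M])+
qed

lemma dx_cmult: "real_polynomial_function p \<Longrightarrow> dx (\<lambda>x. c * p x) x = c * dx p x"
  and dy_cmult: "real_polynomial_function p \<Longrightarrow> dy (\<lambda>x. c * p x) x = c * dy p x"
  using dx_mult[of "\<lambda>_. c" p x] dy_mult[of "\<lambda>_. c" p x]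
  by (auto simp: dx_def dy_def intro: real_polynomial_function.intros)

lemma real_polynomial_fst: "real_polynomial_function (fst :: point \<Rightarrow> real)"
  and real_polynomial_snd: "real_polynomial_function (snd :: point \<Rightarrow> real)"
  by (auto intro: real_polynomial_function.intros bounded_linear_fst bounded_linear_snd)

lemma polys_real_polynomial:
  assumes "p \<in> polys k"
  shows "real_polynomial_function p"
proof -
  obtain c where p: "p = (\<lambda>(x, y). \<Sum>i\<le>k. \<Sum>j\<le>k - i. c i j * x ^ i * y ^ j)"
    using assms unfolding polys_def by blast
  have "real_polynomial_function (\<lambda>z::point. \<Sum>i\<le>k. \<Sum>j\<le>k - i. c i j * fst z ^ i * snd z ^ j)"
    by (intro real_polynomial_function_sum real_polynomial_function.intros(4) real_polynomial_function_power
      real_polynomial_fst real_polynomial_snd real_polynomial_function.intros(2) finite_atMost)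
  then show ?thesis by (simp add: p case_prod_beta')
qed

lemma
  assumes "p \<in> polys k"
  shows dx_polys: "dx p \<in> polys k" and dy_polys: "dy p \<in> polys k"
proof -
  obtain c where p: "p = (\<lambda>(x, y). \<Sum>i\<le>k. \<Sum>j\<le>k - i. c i j * x ^ i * y ^ j)"
    using assms unfolding polys_def by blast
  \<comment> \<open>The truncated exponent \<open>i - 1\<close> is harmless at \<open>i = 0\<close>,
    as the coefficient vanishes there.\<close>
  have "dx p = (\<lambda>z. \<Sum>i\<le>k. \<Sum>j\<le>k - i. (\<lambda>(x, y). (c i j * real i) * x ^ (i - 1) * y ^ j) z)"
    unfolding dx_def p fun_eq_iff
    by (auto intro!: DERIV_imp_deriv derivative_eq_intros sum.cong)
  also have "\<dots> \<in> polys k"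
    by (intro polys_sum polys_monom) auto
  finally show "dx p \<in> polys k" .
  have "dy p = (\<lambda>z. \<Sum>i\<le>k. \<Sum>j\<le>k - i. (\<lambda>(x, y). (c i j * real j) * x ^ i * y ^ (j - 1)) z)"
    unfolding dy_def p fun_eq_iff
    by (auto intro!: DERIV_imp_deriv derivative_eq_intros sum.cong)
  also have "\<dots> \<in> polys k"
    by (intro polys_sum polys_monom) auto
  finally show "dy p \<in> polys k" .
qed

section \<open>Zeros of polynomials on lines, grids and open sets\<close>

text \<open>Both coordinates are affine in the parameter, so a monomial of total degree at most
  \<open>k\<close> stays of degree at most \<open>k\<close> on a line in any direction. This makes
  root counting available on edges.\<close>

lemma polys_line:
  assumes "p \<in> polys k"
  shows "\<exists>q. degree q \<le> k \<and> (\<forall>t. p (linepath a b t) = poly q t)"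
proof -
  obtain c where p: "p = (\<lambda>(x, y). \<Sum>i\<le>k. \<Sum>j\<le>k - i. c i j * x ^ i * y ^ j)"
    using assms unfolding polys_def by blast
  define X where "X = [:fst a, fst b - fst a:]"
  define Y where "Y = [:snd a, snd b - snd a:]"
  define q where "q = (\<Sum>i\<le>k. \<Sum>j\<le>k - i. smult (c i j) (X ^ i * Y ^ j))"
  have "degree (smult (c i j) (X ^ i * Y ^ j)) \<le> k" if "i \<le> k" "j \<le> k - i" for i j
  proof -
    have "degree X \<le> 1" "degree Y \<le> 1" by (auto simp: X_def Y_def)
    then have "degree (X ^ i) \<le> i" "degree (Y ^ j) \<le> j"
      using degree_power_le[of X i] degree_power_le[of Y j]
      by (metis mult.commute mult.right_neutral mult_le_mono2 order_trans)+
    then have "degree (X ^ i * Y ^ j) \<le> i + j"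
      by (meson add_mono degree_mult_le order_trans)
    then show ?thesis using that degree_smult_le[of "c i j" "X ^ i * Y ^ j"] by linarith
  qed
  then have "degree q \<le> k" unfolding q_def
    by (intro degree_sum_le) auto
  moreover have "p (linepath a b t) = poly q t" for t
    by (auto simp: p q_def poly_sum X_def Y_def case_prod_beta linepath_def algebra_simps intro!: sum.cong)
  ultimately show ?thesis by blast
qed

text \<open>A nonzero univariate polynomial of degree at most \<open>k\<close> has at most
  \<open>k\<close> roots. The finite alternative serves grids and nodes on edges, the infinite one
  serves open sets.\<close>

lemma polys_vanish_line:
  assumes p: "p \<in> polys k" and A: "infinite A \<or> card A > k" and z: "\<And>t. t \<in> A \<Longrightarrow> p (linepath a b t) = 0"
  shows "p (linepath a b t) = 0"
proof -
  obtain q where q: "degree q \<le> k" "\<And>t. p (linepath a b t) = poly q t"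
    using polys_line[OF p] by metis
  have "q = 0"
  proof (rule ccontr)
    assume "q \<noteq> 0"
    then have fin: "finite {t. poly q t = 0}" "card {t. poly q t = 0} \<le> degree q"
      by (auto simp: poly_roots_finite card_poly_roots_bound)
    have sub: "A \<subseteq> {t. poly q t = 0}" using z q(2) by auto
    then have "finite A" "card A \<le> degree q" using fin
      by (auto intro: finite_subset dest: card_mono[rotated])
    then show False using A q(1) by auto
  qed
  then show ?thesis using q by simp
qed

text \<open>Root counting on the horizontal grid lines and then on every vertical line. The grid
  values are the separating functionals for \<open>finite_riesz\<close>; they exceed the dimension
  of \<open>polys k\<close> for \<open>k > 0\<close>, which does no harm.\<close>

lemma polys_vanish_grid:
  assumes p: "p \<in> polys k" and z: "\<And>i j. i \<le> k \<Longrightarrow> j \<le> k \<Longrightarrow> p (real i, real j) = 0"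
  shows "p = (\<lambda>_. 0)"
proof -
  have A: "infinite (real ` {..k}) \<or> card (real ` {..k}) > k"
    by (simp add: card_image inj_on_def)
  have 1: "p (x, real j) = 0" if "j \<le> k" for x j
  proof -
    have "p (linepath (0, real j) (1, real j) x) = 0"
      by (rule polys_vanish_line[OF p A]) (use z that in \<open>auto simp: linepath_def algebra_simps\<close>)
    then show ?thesis by (simp add: linepath_def algebra_simps)
  qed
  have "p (x, y) = 0" for x y
  proof -
    have "p (linepath (x, 0) (x, 1) y) = 0"
      by (rule polys_vanish_line[OF p A]) (use 1 in \<open>auto simp: linepath_def algebra_simps\<close>)
    then show ?thesis by (simp add: linepath_def algebra_simps)
  qed
  then show ?thesis by auto
qed

text \<open>The line from \<open>c\<close> to any point starts with a stretch inside
  \<open>S\<close>, which contains infinitely many zeros.\<close>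

lemma polys_vanish_open:
  assumes p: "p \<in> polys k" and S: "open S" "c \<in> S" and z: "\<And>x. x \<in> S \<Longrightarrow> p x = 0"
  shows "p = (\<lambda>_. 0)"
proof
  fix x
  have "((\<lambda>t. linepath c x t) \<longlongrightarrow> linepath c x 0) (at_right 0)"
    unfolding linepath_def by (intro tendsto_intros)
  then have "\<forall>\<^sub>F t in at_right 0. linepath c x t \<in> S"
    using S by (intro topological_tendstoD) (auto simp: linepath_def)
  then obtain e where e: "e > 0" "\<And>t. 0 < t \<Longrightarrow> t < e \<Longrightarrow> linepath c x t \<in> S"
    by (auto simp: eventually_at_right_field)
  have "p (linepath c x 1) = 0"
    by (rule polys_vanish_line[OF p, of "{0<..<e}"]) (use e z infinite_Ioo[OF e(1)] in auto)
  then show "p x = 0" by (simp add: linepath_def)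
qed


lemma polys_mono:
  assumes "p \<in> polys k" "k \<le> l"
  shows "p \<in> polys l"
proof -
  obtain c where p: "p = (\<lambda>(x, y). \<Sum>i\<le>k. \<Sum>j\<le>k - i. c i j * x ^ i * y ^ j)"
    using assms(1) unfolding polys_def by blast
  have "(\<lambda>z. \<Sum>i\<le>k. \<Sum>j\<le>k - i. (\<lambda>(x, y). c i j * x ^ i * y ^ j) z) \<in> polys l"
    using assms(2) by (intro polys_sum polys_monom) auto
  then show ?thesis by (simp add: p case_prod_beta')
qed

lemma polys_mult:
  assumes "p \<in> polys k" "q \<in> polys l"
  shows "(\<lambda>x. p x * q x) \<in> polys (k + l)"
proof -
  obtain c d where p: "p = (\<lambda>(x, y). \<Sum>i\<le>k. \<Sum>j\<le>k - i. c i j * x ^ i * y ^ j)"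
    and q: "q = (\<lambda>(x, y). \<Sum>i\<le>l. \<Sum>j\<le>l - i. d i j * x ^ i * y ^ j)"
    using assms unfolding polys_def by blast
  have "(\<lambda>z. \<Sum>i\<le>k. \<Sum>j\<le>k - i. \<Sum>i'\<le>l. \<Sum>j'\<le>l - i'.
      (\<lambda>(x, y). (c i j * d i' j') * x ^ (i + i') * y ^ (j + j')) z) \<in> polys (k + l)"
    by (intro polys_sum polys_monom) auto
  moreover have "p z * q z = (\<Sum>i\<le>k. \<Sum>j\<le>k - i. \<Sum>i'\<le>l. \<Sum>j'\<le>l - i'.
      (\<lambda>(x, y). (c i j * d i' j') * x ^ (i + i') * y ^ (j + j')) z)" for z
    unfolding p q case_prod_beta' sum_distrib_right
    unfolding sum_distrib_left by (simp add: power_add mult_ac)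
  ultimately show ?thesis by simp
qed

text \<open>Stone-Weierstrass speaks of \<open>real_polynomial_function\<close>, the discrete spaces
  of coefficients; this direction gives access to monomials.\<close>

lemma real_polynomial_polys:
  fixes p :: "point \<Rightarrow> real"
  assumes "real_polynomial_function p"
  shows "\<exists>k. p \<in> polys k"
  using assms
proof (induction rule: real_polynomial_function.induct)
  case (linear f)
  have "(\<lambda>h. f (1, 0) * fst h + f (0, 1) * snd h) \<in> polys 1"
    using polys_comb[OF polys_monom[of 1 0 1 "f (1, 0)"] polys_monom[of 0 1 1 1], of "f (0, 1)"]
    by (simp add: case_prod_beta')
  then show ?case using bounded_linear_plane[OF linear] by auto
next
  case (const c)
  show ?case using polys_monom[of 0 0 0 c] by (auto simp: case_prod_beta')
next
  case (add f g)
  then obtain k l where "f \<in> polys k" "g \<in> polys l" by blast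
  then have "f \<in> polys (max k l)" "g \<in> polys (max k l)" by (auto intro: polys_mono)
  from polys_comb[OF this, of 1] show ?case by auto
next
  case (mult f g)
  then show ?case using polys_mult by blast
qed

section \<open>Surjectivity of the Laplacian on polynomials\<close>

text \<open>Integrating twice in \<open>x\<close> gives \<open>x^(i+2) y^j / ((i+1)(i+2))\<close>,
  whose Laplacian is the monomial up to a multiple of \<open>x^(i+2) y^(j-2)\<close>. The error has
  lower degree in \<open>y\<close> and is removed by induction on \<open>j\<close>; as the power of
  \<open>x\<close> grows, \<open>i\<close> stays arbitrary.\<close>

lemma monomial_laplacian:
  "\<exists>u. real_polynomial_function u \<and>
    (\<forall>z. dx (dx u) z + dy (dy u) z = fst z ^ i * snd z ^ j)"
proof (induction j arbitrary: i rule: less_induct)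
  case (less j)
  define M where "M = (\<lambda>i j (z::point). fst z ^ i * snd z ^ j)"
  have M: "real_polynomial_function (M i j)" for i j
    unfolding M_def
    by (intro real_polynomial_function.intros(4) real_polynomial_function_power real_polynomial_fst real_polynomial_snd)
  have "dx (M i j) = (\<lambda>z. real i * M (i - 1) j z)" for i j
    unfolding dx_def M_def fun_eq_iff by (auto intro!: DERIV_imp_deriv derivative_eq_intros)
  then have "dx (dx (M (Suc (Suc i)) j)) z = real (Suc (Suc i)) * (real (Suc i) * M i j z)" for i j z
    by (simp add: dx_cmult[OF M] del: of_nat_Suc)
  then have dxx: "dx (dx (M (Suc (Suc i)) j)) z = (real i + 1) * (real i + 2) * M i j z" for i j z
    by (simp add: algebra_simps)
  have dyM: "dy (M i j) = (\<lambda>z. real j * M i (j - 1) z)" for i j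
    unfolding dy_def M_def fun_eq_iff by (auto intro!: DERIV_imp_deriv derivative_eq_intros)
  then have dyy: "dy (dy (M i j)) z = real j * (real (j - 1) * M i (j - 2) z)" for i j z
    by (simp add: dy_cmult[OF M] numeral_2_eq_2)
  define a where "a = 1 / ((real i + 1) * (real i + 2))"
  have a: "a * ((real i + 1) * (real i + 2)) = 1" by (simp add: a_def)
  \<comment> \<open>The correction for the error term. For \<open>j < 2\<close> the factor
    \<open>j (j - 1)\<close> vanishes, which also covers the truncated subtraction in the
    exponent.\<close>
  obtain w where w: "real_polynomial_function w"
    "\<And>z. dx (dx w) z + dy (dy w) z = real j * (real (j - 1) * M (Suc (Suc i)) (j - 2) z)"
  proof (cases "j < 2")
    case True
    have "dx (\<lambda>_. 0) = (\<lambda>_. 0)" "dy (\<lambda>_. 0) = (\<lambda>_. 0)" by (simp_all add: dx_def dy_def fun_eq_iff)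
    moreover have "j = 0 \<or> j = 1" using True by auto
    ultimately show ?thesis using that[of "\<lambda>_. 0"] by (auto intro: real_polynomial_function.intros)
  next
    case False
    then obtain v where v: "real_polynomial_function v"
      "\<And>z. dx (dx v) z + dy (dy v) z = M (Suc (Suc i)) (j - 2) z"
      using less[of "j - 2" "Suc (Suc i)"] by (auto simp: M_def)
    define c where "c = real j * real (j - 1)"
    have "dx (\<lambda>z. c * v z) = (\<lambda>z. c * dx v z)" "dy (\<lambda>z. c * v z) = (\<lambda>z. c * dy v z)"
      by (simp_all add: fun_eq_iff dx_cmult dy_cmult v)
    then have "dx (dx (\<lambda>z. c * v z)) z + dy (dy (\<lambda>z. c * v z)) z = c * M (Suc (Suc i)) (j - 2) z" for z
      by (simp add: dx_cmult dy_cmult real_polynomial_dx real_polynomial_dy v flip: v(2) distrib_left)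
    moreover have "real_polynomial_function (\<lambda>z. c * v z)"
      by (intro real_polynomial_function.intros(2-4) v)
    ultimately show ?thesis using that[of "\<lambda>z. c * v z"] by (simp add: c_def mult.assoc del: split_paired_All)
  qed
  define W where "W = (\<lambda>z. (-1) * w z)"
  have W: "real_polynomial_function W" unfolding W_def using w by (auto intro: real_polynomial_function.intros)
  have dW: "dx W = (\<lambda>z. (-1) * dx w z)" "dy W = (\<lambda>z. (-1) * dy w z)"
    by (simp_all only: W_def fun_eq_iff dx_cmult dy_cmult w simp_thms)
  define N where "N = M (Suc (Suc i)) j"
  have N: "real_polynomial_function N" using M by (simp add: N_def)
  define V where "V = (\<lambda>z. N z + W z)"
  have V: "real_polynomial_function V" unfolding V_def using N W by (auto intro: real_polynomial_function.intros)
  have dV: "dx V = (\<lambda>z. dx N z + dx W z)" "dy V = (\<lambda>z. dy N z + dy W z)"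
    by (simp_all only: V_def fun_eq_iff dx_add[OF N W] dy_add[OF N W] simp_thms)
  have lapV: "dx (dx V) z + dy (dy V) z = (real i + 1) * (real i + 2) * M i j z" for z
  proof -
    have "dx (dx V) z = dx (dx N) z + dx (dx W) z" "dy (dy V) z = dy (dy N) z + dy (dy W) z"
      using N W by (simp_all add: dV dx_add dy_add real_polynomial_dx real_polynomial_dy)
    moreover have "dx (dx W) z = - dx (dx w) z" "dy (dy W) z = - dy (dy w) z"
      unfolding dW by (subst dx_cmult dy_cmult; simp add: real_polynomial_dx real_polynomial_dy w)+
    ultimately show ?thesis using w(2)[of z] dxx[of i j z] dyy[of "Suc (Suc i)" j z] by (simp add: N_def)
  qed
  have "dx (\<lambda>z. a * V z) = (\<lambda>z. a * dx V z)" "dy (\<lambda>z. a * V z) = (\<lambda>z. a * dy V z)"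
    by (simp_all add: fun_eq_iff dx_cmult dy_cmult V)
  then have "dx (dx (\<lambda>z. a * V z)) z + dy (dy (\<lambda>z. a * V z)) z = a * (dx (dx V) z + dy (dy V) z)" for z
    by (simp add: dx_cmult dy_cmult real_polynomial_dx real_polynomial_dy V distrib_left)
  then have "dx (dx (\<lambda>z. a * V z)) z + dy (dy (\<lambda>z. a * V z)) z = fst z ^ i * snd z ^ j" for z
    using a by (simp add: lapV M_def flip: mult.assoc)
  then show ?case using V
    by (intro exI[of _ "\<lambda>z. a * V z"]) (auto intro: real_polynomial_function.intros)
qed

lemma real_polynomial_laplacian_ex:
  fixes m :: "point \<Rightarrow> real"
  assumes "real_polynomial_function m"
  shows "\<exists>u. real_polynomial_function u \<and> (\<forall>z. dx (dx u) z + dy (dy u) z = m z)"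
proof -
  define S where "S m \<longleftrightarrow> (\<exists>u. real_polynomial_function u \<and> (\<forall>z. dx (dx u) z + dy (dy u) z = m z))"
    for m :: "point \<Rightarrow> real"
  have comb: "S (\<lambda>z. c * p z + q z)" if "S p" "S q" for p q c
  proof -
    obtain u v where u: "real_polynomial_function u" "\<And>z. dx (dx u) z + dy (dy u) z = p z"
      and v: "real_polynomial_function v" "\<And>z. dx (dx v) z + dy (dy v) z = q z"
      using \<open>S p\<close> \<open>S q\<close> unfolding S_def by blast
    have cu: "real_polynomial_function (\<lambda>z. c * f z)" if "real_polynomial_function f" for f :: "point \<Rightarrow> real"
      using that by (auto intro: real_polynomial_function.intros)
    note rp = u v cu real_polynomial_dx real_polynomial_dy
    have "dx (\<lambda>z. c * u z + v z) = (\<lambda>z. c * dx u z + dx v z)" "dy (\<lambda>z. c * u z + v z) = (\<lambda>z. c * dy u z + dy v z)"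
      by (simp_all add: fun_eq_iff dx_add dy_add dx_cmult dy_cmult rp)
    then have "dx (dx (\<lambda>z. c * u z + v z)) z + dy (dy (\<lambda>z. c * u z + v z)) z
        = c * (dx (dx u) z + dy (dy u) z) + (dx (dx v) z + dy (dy v) z)" for z
      by (simp add: dx_add dy_add dx_cmult dy_cmult rp(1,3,5,6,7) algebra_simps)
    moreover have "real_polynomial_function (\<lambda>z. c * u z + v z)"
      by (intro real_polynomial_function.intros(2-4) u v)
    ultimately show ?thesis unfolding S_def
      by (intro exI[of _ "\<lambda>z. c * u z + v z"]) (simp add: u(2) v(2) del: split_paired_All)
  qed
  have "dx (\<lambda>_. 0) = (\<lambda>_. 0)" "dy (\<lambda>_. 0) = (\<lambda>_. 0)" by (simp_all add: dx_def dy_def fun_eq_iff)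
  then have zero: "S (\<lambda>_. 0)" unfolding S_def
    by (intro exI[of _ "\<lambda>_. 0"]) (simp add: real_polynomial_function.intros(2))
  have sum: "S (\<lambda>z. \<Sum>i\<in>I. f i z)" if "finite I" "\<And>i. i \<in> I \<Longrightarrow> S (f i)" for I and f :: "nat \<Rightarrow> point \<Rightarrow> real"
    using that
  proof (induction I rule: finite_induct)
    case (insert i I)
    then show ?case using comb[of "f i" "\<lambda>z. \<Sum>i\<in>I. f i z" 1] by simp
  qed (simp add: zero)
  have mon: "S (\<lambda>z. c * (fst z ^ i * snd z ^ j))" for c i j
    using comb[OF _ zero, of "\<lambda>z. fst z ^ i * snd z ^ j" c] monomial_laplacian[of i j] by (simp add: S_def)
  obtain k where "m \<in> polys k" using real_polynomial_polys[OF assms] by blast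
  then obtain c where m: "m = (\<lambda>(x, y). \<Sum>i\<le>k. \<Sum>j\<le>k - i. c i j * x ^ i * y ^ j)"
    unfolding polys_def by blast
  have "S (\<lambda>z. \<Sum>i\<le>k. \<Sum>j\<le>k - i. c i j * (fst z ^ i * snd z ^ j))"
    by (intro sum mon finite_atMost)
  then show ?thesis unfolding S_def m by (simp add: case_prod_beta' mult.assoc)
qed

section \<open>Square-integrable functions on cells and boundaries\<close>

text \<open>Traces are unspecified at vertices and the source on the frontier of \<Omega>, so
  measurability must survive changes on null sets. Completeness of Lebesgue measure provides
  this.\<close>

lemma borel_measurable_lebesgue_on_null_cong:
  fixes f g :: "'a::euclidean_space \<Rightarrow> 'b::euclidean_space"
  assumes A: "A \<in> sets lebesgue" and N: "N \<in> null_sets lebesgue"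
    and eq: "\<And>x. x \<in> A \<Longrightarrow> x \<notin> N \<Longrightarrow> f x = g x"
    and f: "f \<in> borel_measurable (lebesgue_on A)"
  shows "g \<in> borel_measurable (lebesgue_on A)"
proof -
  have "(\<lambda>x. if x \<in> A then f x else 0) \<in> borel_measurable lebesgue"
    using f A by (simp add: borel_measurable_if)
  moreover have "AE x in lebesgue. (if x \<in> A then f x else 0) = (if x \<in> A then g x else 0)"
    by (rule AE_I'[OF N]) (use eq in auto)
  ultimately have "(\<lambda>x. if x \<in> A then g x else 0) \<in> borel_measurable lebesgue"
    by (rule borel_measurable_AE)
  then show ?thesis using A by (simp add: borel_measurable_if)
qed

lemma
  fixes f g :: "'a::euclidean_space \<Rightarrow> 'b::euclidean_space"
  assumes A: "A \<in> sets lebesgue" and N: "N \<in> null_sets lebesgue"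
    and eq: "\<And>x. x \<in> A \<Longrightarrow> x \<notin> N \<Longrightarrow> f x = g x"
  shows integrable_lebesgue_on_null_cong: "integrable (lebesgue_on A) f \<longleftrightarrow> integrable (lebesgue_on A) g"
    and integral_lebesgue_on_null_cong: "integral\<^sup>L (lebesgue_on A) f = integral\<^sup>L (lebesgue_on A) g"
proof -
  have iff: "f \<in> borel_measurable (lebesgue_on A) \<longleftrightarrow> g \<in> borel_measurable (lebesgue_on A)"
    using borel_measurable_lebesgue_on_null_cong[OF A N] eq by metis
  have "AE x in lebesgue. x \<notin> N" using N by (rule AE_not_in)
  then have AE: "AE x in lebesgue_on A. f x = g x"
    using A by (subst AE_restrict_space_iff) (auto intro: eq elim: eventually_mono)
  show 1: "integrable (lebesgue_on A) f \<longleftrightarrow> integrable (lebesgue_on A) g"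
    using iff AE by (metis borel_measurable_integrable integrable_cong_AE)
  show "integral\<^sup>L (lebesgue_on A) f = integral\<^sup>L (lebesgue_on A) g"
  proof (cases "f \<in> borel_measurable (lebesgue_on A)")
    case True
    then show ?thesis using iff AE by (intro integral_cong_AE) auto
  next
    case False
    then show ?thesis using iff by (metis borel_measurable_integrable not_integrable_integral_eq)
  qed
qed

lemma L2_null_cong:
  fixes f g :: "'a::euclidean_space \<Rightarrow> 'b::euclidean_space"
  assumes A: "A \<in> sets lebesgue" and N: "N \<in> null_sets lebesgue"
    and eq: "\<And>x. x \<in> A \<Longrightarrow> x \<notin> N \<Longrightarrow> f x = g x"
    and f: "f \<in> L2 A"
  shows "g \<in> L2 A"
proof -
  have "g \<in> borel_measurable (lebesgue_on A)"
    using borel_measurable_lebesgue_on_null_cong[OF A N eq] f by (auto simp: L2_def)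
  moreover have "integrable (lebesgue_on A) (\<lambda>x. (norm (f x))\<^sup>2) \<longleftrightarrow> integrable (lebesgue_on A) (\<lambda>x. (norm (g x))\<^sup>2)"
    by (rule integrable_lebesgue_on_null_cong[OF A N]) (simp add: eq)
  ultimately show ?thesis using f by (auto simp: L2_def)
qed

lemma L2_comb:
  fixes f g :: "'a::euclidean_space \<Rightarrow> 'b::euclidean_space"
  assumes "f \<in> L2 A" "g \<in> L2 A"
  shows "(\<lambda>x. f x + c *\<^sub>R g x) \<in> L2 A"
proof -
  have m[measurable]: "f \<in> borel_measurable (lebesgue_on A)" "g \<in> borel_measurable (lebesgue_on A)"
    and i: "integrable (lebesgue_on A) (\<lambda>x. (norm (f x))\<^sup>2)" "integrable (lebesgue_on A) (\<lambda>x. (norm (g x))\<^sup>2)"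
    using assms by (auto simp: L2_def)
  have "integrable (lebesgue_on A) (\<lambda>x. (norm (f x + c *\<^sub>R g x))\<^sup>2)"
  proof (rule Bochner_Integration.integrable_bound)
    show "integrable (lebesgue_on A) (\<lambda>x. 2 * (norm (f x))\<^sup>2 + 2 * c\<^sup>2 * (norm (g x))\<^sup>2)"
      using i by simp
    show "AE x in lebesgue_on A. norm ((norm (f x + c *\<^sub>R g x))\<^sup>2) \<le> norm (2 * (norm (f x))\<^sup>2 + 2 * c\<^sup>2 * (norm (g x))\<^sup>2)"
    proof (rule AE_I2)
      fix x
      have "(norm (f x + c *\<^sub>R g x))\<^sup>2 \<le> (norm (f x) + \<bar>c\<bar> * norm (g x))\<^sup>2"
        using norm_triangle_ineq[of "f x" "c *\<^sub>R g x"] by (intro power_mono) auto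
      also have "\<dots> \<le> 2 * (norm (f x))\<^sup>2 + 2 * (\<bar>c\<bar> * norm (g x))\<^sup>2"
        using zero_le_power2[of "norm (f x) - \<bar>c\<bar> * norm (g x)"]
        by (simp add: power2_eq_square algebra_simps)
      finally show "norm ((norm (f x + c *\<^sub>R g x))\<^sup>2) \<le> norm (2 * (norm (f x))\<^sup>2 + 2 * c\<^sup>2 * (norm (g x))\<^sup>2)"
        by (simp add: power_mult_distrib)
    qed
  qed measurable
  then show ?thesis by (simp add: L2_def)
qed

lemma L2_inner_integrable:
  fixes f g :: "'a::euclidean_space \<Rightarrow> 'b::euclidean_space"
  assumes "f \<in> L2 A" "g \<in> L2 A"
  shows "integrable (lebesgue_on A) (\<lambda>x. f x \<bullet> g x)"
proof -
  have m[measurable]: "f \<in> borel_measurable (lebesgue_on A)" "g \<in> borel_measurable (lebesgue_on A)"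
    and i: "integrable (lebesgue_on A) (\<lambda>x. (norm (f x))\<^sup>2)" "integrable (lebesgue_on A) (\<lambda>x. (norm (g x))\<^sup>2)"
    using assms by (auto simp: L2_def)
  show ?thesis
  proof (rule Bochner_Integration.integrable_bound)
    show "integrable (lebesgue_on A) (\<lambda>x. (norm (f x))\<^sup>2 + (norm (g x))\<^sup>2)"
      using i by simp
    show "AE x in lebesgue_on A. norm (f x \<bullet> g x) \<le> norm ((norm (f x))\<^sup>2 + (norm (g x))\<^sup>2)"
    proof (rule AE_I2)
      fix x
      have "\<bar>f x \<bullet> g x\<bar> \<le> norm (f x) * norm (g x)" by (rule Cauchy_Schwarz_ineq2)
      also have "\<dots> \<le> (norm (f x))\<^sup>2 + (norm (g x))\<^sup>2"
        using sum_squares_bound[of "norm (f x)" "norm (g x)"] mult_nonneg_nonneg[of "norm (f x)" "norm (g x)"]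
          norm_ge_zero[of "f x"] norm_ge_zero[of "g x"] by linarith
      finally show "norm (f x \<bullet> g x) \<le> norm ((norm (f x))\<^sup>2 + (norm (g x))\<^sup>2)" by simp
    qed
  qed measurable
qed

lemma integrable_lebesgue_on_compact:
  fixes f :: "'a::euclidean_space \<Rightarrow> 'b::euclidean_space"
  assumes "compact A" "continuous_on A f"
  shows "integrable (lebesgue_on A) f"
proof -
  have "integrable lborel (\<lambda>x. indicator A x *\<^sub>R f x)"
    using assms by (rule borel_integrable_compact)
  then have "integrable lebesgue (\<lambda>x. indicator A x *\<^sub>R f x)"
    using integrable_completion borel_measurable_integrable by blast
  moreover have "A \<in> sets lebesgue" using assms(1) by (simp add: lmeasurable_compact fmeasurableD)
  ultimately show ?thesis by (simp add: integrable_restrict_space)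
qed

lemma L2_continuous:
  fixes f :: "'a::euclidean_space \<Rightarrow> 'b::euclidean_space"
  assumes "compact A" "continuous_on A f"
  shows "f \<in> L2 A"
  unfolding L2_def
  by (auto intro!: borel_measurable_integrable integrable_lebesgue_on_compact assms continuous_intros)

text \<open>The function vanishes almost everywhere, and the nonzeros in the interior form an open
  set; an open negligible set is empty.\<close>

lemma continuous_integral_zero:
  fixes f :: "'a::euclidean_space \<Rightarrow> real"
  assumes A: "compact A" and f: "continuous_on A f" "\<And>x. x \<in> A \<Longrightarrow> 0 \<le> f x"
    and z: "integral\<^sup>L (lebesgue_on A) f = 0" and x: "x \<in> interior A"
  shows "f x = 0"
proof (rule ccontr)
  assume "f x \<noteq> 0"
  have AE: "AE x in lebesgue_on A. f x = 0"
    using z integrable_lebesgue_on_compact[OF A f(1)]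
    by (subst (asm) integral_nonneg_eq_0_iff_AE) (auto intro!: AE_I2 f(2))
  have As: "A \<in> sets lebesgue" using A by (simp add: lmeasurable_compact fmeasurableD)
  have "AE x in lebesgue. x \<in> A \<longrightarrow> f x = 0"
    using AE As by (subst (asm) AE_restrict_space_iff) auto
  then have "{x. \<not> (x \<in> A \<longrightarrow> f x = 0)} \<in> null_sets lebesgue"
    by (subst (asm) completion.AE_iff_null_sets) auto
  then have neg: "negligible {x. \<not> (x \<in> A \<longrightarrow> f x = 0)}"
    by (simp add: negligible_iff_null_sets)
  define S where "S = {y \<in> interior A. f y \<in> - {0}}"
  have "open S" unfolding S_def
    using continuous_open_preimage[of "interior A" f "-{0}"] continuous_on_subset[OF f(1) interior_subset]
    by (simp add: vimage_def Int_def open_delete Compl_eq_Diff_UNIV)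
  moreover have "negligible S"
    by (rule negligible_subset[OF neg]) (use interior_subset S_def in auto)
  moreover have "x \<in> S" using x \<open>f x \<noteq> 0\<close> by (simp add: S_def)
  ultimately show False using open_not_negligible by blast
qed

section \<open>Inner products on cells and boundaries\<close>

lemma
  assumes "f \<in> L2 (cell K)" "g \<in> L2 (cell K)" "h \<in> L2 (cell K)"
  shows ip_comb_left: "ip K (\<lambda>x. f x + c *\<^sub>R g x) h = ip K f h + c * ip K g h"
    and ip_comb_right: "ip K h (\<lambda>x. f x + c *\<^sub>R g x) = ip K h f + c * ip K h g"
  using L2_inner_integrable[OF assms(1,3)] L2_inner_integrable[OF assms(2,3)]
  by (simp_all add: ip_def inner_add_left inner_add_right inner_commute)

lemma ip_commute: "ip K f g = ip K g f"
  by (simp add: ip_def inner_commute)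

lemma ip_nonneg: "0 \<le> ip K f f"
  by (simp add: ip_def)

lemma ip_zero_left: "ip K (\<lambda>_. 0) f = 0" and ip_zero_right: "ip K f (\<lambda>_. 0) = 0"
  by (simp_all add: ip_def)

lemma finite_edge_ends [simp]: "finite (edge_ends K)"
  by (simp add: edge_ends_def)

lemma null_endpoints: "{0, 1::real} \<in> null_sets lebesgue"
  using negligible_finite[of "{0, 1::real}"] by (simp add: negligible_iff_null_sets)

text \<open>The end points of the parameter interval are a null set, so values at vertices do not
  matter. Comparing products lets one factor be arbitrary wherever the other one is zero.\<close>

lemma bip_cong:
  assumes "\<And>a b t. (a, b) \<in> edge_ends K \<Longrightarrow> 0 < t \<Longrightarrow> t < 1 \<Longrightarrow>
    f (linepath a b t) * g (linepath a b t) = f' (linepath a b t) * g' (linepath a b t)"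
  shows "bip K f g = bip K f' g'"
  unfolding bip_def
proof (intro sum.cong refl, clarify)
  fix a b assume "(a, b) \<in> edge_ends K"
  then have "(LINT t|lebesgue_on {0..1}. f (linepath a b t) * g (linepath a b t))
      = (LINT t|lebesgue_on {0..1}. f' (linepath a b t) * g' (linepath a b t))"
    by (intro integral_lebesgue_on_null_cong[OF _ null_endpoints] assms) auto
  then show "norm (b - a) * (LINT t|lebesgue_on {0..1}. f (linepath a b t) * g (linepath a b t))
      = norm (b - a) * (LINT t|lebesgue_on {0..1}. f' (linepath a b t) * g' (linepath a b t))"
    by simp
qed

lemma L2_bdry_comb:
  fixes f g :: "point \<Rightarrow> 'b::euclidean_space"
  assumes "f \<in> L2_bdry K" "g \<in> L2_bdry K"
  shows "(\<lambda>x. f x + c *\<^sub>R g x) \<in> L2_bdry K"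
  unfolding L2_bdry_def
proof (clarify)
  fix a b assume e: "(a, b) \<in> edge_ends K"
  then have "(\<lambda>t. f (linepath a b t)) \<in> L2 {0..1}" "(\<lambda>t. g (linepath a b t)) \<in> L2 {0..1}"
    using assms by (auto simp: L2_bdry_def)
  then show "(\<lambda>t. f (linepath a b t) + c *\<^sub>R g (linepath a b t)) \<in> L2 {0..1}"
    by (rule L2_comb)
qed

lemma L2_bdry_continuous:
  fixes f :: "point \<Rightarrow> 'b::euclidean_space"
  assumes "continuous_on UNIV f"
  shows "f \<in> L2_bdry K"
  unfolding L2_bdry_def
proof (clarify)
  fix a b :: point
  show "(\<lambda>t. f (linepath a b t)) \<in> L2 {0..1}"
    by (intro L2_continuous continuous_on_compose2[OF assms] continuous_on_linepath) auto
qed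

lemma L2_bdry_integrable:
  assumes "f \<in> L2_bdry K" "g \<in> L2_bdry K" "(a, b) \<in> edge_ends K"
  shows "integrable (lebesgue_on {0..1}) (\<lambda>t. f (linepath a b t) * g (linepath a b t) :: real)"
  using assms L2_inner_integrable[of "\<lambda>t. f (linepath a b t)" "{0..1}" "\<lambda>t. g (linepath a b t)"]
  unfolding L2_bdry_def by auto

lemma bip_commute: "bip K f g = bip K g f"
  by (simp add: bip_def mult.commute)

lemma bip_comb_left:
  assumes "f \<in> L2_bdry K" "g \<in> L2_bdry K" "h \<in> L2_bdry K"
  shows "bip K (\<lambda>x. f x + c * g x) h = bip K f h + c * bip K g h"
proof -
  have "bip K (\<lambda>x. f x + c * g x) h = (\<Sum>(a, b)\<in>edge_ends K.
      norm (b - a) * (LINT t|lebesgue_on {0..1}. f (linepath a b t) * h (linepath a b t))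
      + c * (norm (b - a) * (LINT t|lebesgue_on {0..1}. g (linepath a b t) * h (linepath a b t))))"
    unfolding bip_def
  proof (intro sum.cong refl, clarify)
    fix a b assume "(a, b) \<in> edge_ends K"
    then have "(LINT t|lebesgue_on {0..1}. (f (linepath a b t) + c * g (linepath a b t)) * h (linepath a b t))
      = (LINT t|lebesgue_on {0..1}. f (linepath a b t) * h (linepath a b t))
        + c * (LINT t|lebesgue_on {0..1}. g (linepath a b t) * h (linepath a b t))"
      using L2_bdry_integrable[OF assms(1,3)] L2_bdry_integrable[OF assms(2,3)]
      by (simp add: ring_distribs mult.assoc)
    then show "norm (b - a) * (LINT t|lebesgue_on {0..1}. (f (linepath a b t) + c * g (linepath a b t)) * h (linepath a b t))
      = norm (b - a) * (LINT t|lebesgue_on {0..1}. f (linepath a b t) * h (linepath a b t))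
      + c * (norm (b - a) * (LINT t|lebesgue_on {0..1}. g (linepath a b t) * h (linepath a b t)))"
      by (simp add: algebra_simps)
  qed
  also have "\<dots> = bip K f h + c * bip K g h"
    unfolding bip_def case_prod_beta' by (simp add: sum.distrib sum_distrib_left)
  finally show ?thesis .
qed

lemma bip_comb_right:
  assumes "f \<in> L2_bdry K" "g \<in> L2_bdry K" "h \<in> L2_bdry K"
  shows "bip K h (\<lambda>x. f x + c * g x) = bip K h f + c * bip K h g"
  using bip_comb_left[OF assms] by (simp add: bip_commute[of K h])

lemma bip_nonneg: "0 \<le> bip K f f"
  unfolding bip_def by (intro sum_nonneg) auto

lemma bip_zero_left: "bip K (\<lambda>_. 0) f = 0" and bip_zero_right: "bip K f (\<lambda>_. 0) = 0"
  by (simp_all add: bip_def)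

text \<open>Along an edge \<open>f\<close> may jump at the vertices; \<open>h\<close> is a
  representative that is continuous up to the ends, to which the vanishing of a continuous
  nonnegative integrand applies.\<close>

lemma bip_eq_zeroD:
  assumes "bip K f f = 0" "(a, b) \<in> edge_ends K" "a \<noteq> b"
    and h: "continuous_on {0..1} h" "\<And>t. 0 < t \<Longrightarrow> t < 1 \<Longrightarrow> f (linepath a b t) = h t"
    and t: "0 < t" "t < 1"
  shows "f (linepath a b t) = 0"
proof -
  have "norm (b - a) * (LINT t|lebesgue_on {0..1}. f (linepath a b t) * f (linepath a b t)) = 0"
    using assms(1,2) unfolding bip_def
    by (subst (asm) sum_nonneg_eq_0_iff) auto
  then have "(LINT t|lebesgue_on {0..1}. f (linepath a b t) * f (linepath a b t)) = 0"
    using \<open>a \<noteq> b\<close> by simp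
  also have "(LINT t|lebesgue_on {0..1}. f (linepath a b t) * f (linepath a b t)) = (LINT t|lebesgue_on {0..1}. h t * h t)"
    by (rule integral_lebesgue_on_null_cong[OF _ null_endpoints]) (auto simp: h)
  finally have "h t * h t = 0"
    by (rule continuous_integral_zero[rotated 3]) (use h t in \<open>auto intro!: continuous_intros\<close>)
  then show ?thesis using h t by simp
qed

section \<open>Star-shaped polygons\<close>

text \<open>The theorem for complex paths is carried over along the linear bijection
  \<open>h\<close> with inverse \<open>g\<close>. That the curve is also the frontier of the outside
  is what later keeps boundary points out of the interior of a cell.\<close>

lemma Jordan_inside_outside_plane:
  fixes p :: "real \<Rightarrow> point"
  assumes "simple_path p" and loop: "pathfinish p = pathstart p"
  defines "B \<equiv> path_image p"
  shows "inside B \<noteq> {}" "open (inside B)" "bounded (inside B)" "open (outside B)"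
    "frontier (inside B) = B" "frontier (outside B) = B"
proof -
  define h where "h = (\<lambda>z::point. Complex (fst z) (snd z))"
  define g where "g = (\<lambda>z. (Re z, Im z))"
  have hg: "h (g z) = z" "g (h x) = x" for z x by (simp_all add: h_def g_def)
  have lh: "linear h" unfolding h_def by (rule linearI) (auto simp: complex_eq_iff)
  have lg: "linear g" unfolding g_def by (rule linearI) auto
  have inj: "inj h" "inj g" by (metis hg injI)+
  have sh: "simple_path (h \<circ> p)" using assms(1) simple_path_linear_image_eq[OF lh inj(1)] by blast
  have "pathfinish (h \<circ> p) = pathstart (h \<circ> p)" using loop by (simp add: pathfinish_def pathstart_def)
  from Jordan_curve[OF sh this] obtain inner outer where
    io: "inner \<noteq> {}" "open inner" "connected inner"
        "outer \<noteq> {}" "open outer" "connected outer"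
        "bounded inner" "\<not> bounded outer" "inner \<inter> outer = {}"
        "inner \<union> outer = - path_image (h \<circ> p)"
        "frontier inner = path_image (h \<circ> p)"
        "frontier outer = path_image (h \<circ> p)" by metis
  define I where "I = g ` inner"
  define U where "U = g ` outer"
  have img: "g ` path_image (h \<circ> p) = B"
    by (simp add: B_def path_image_def image_image hg)
  have gv: "g ` S = h -` S" for S
  proof (rule set_eqI)
    show "x \<in> g ` S \<longleftrightarrow> x \<in> h -` S" for x
      using hg(2)[of x] hg(1) by (metis image_iff vimage_eq)
  qed
  have cont: "continuous_on S h" for S using lh by (simp add: linear_continuous_on linear_linear)
  have opn: "open (g ` S)" if "open S" for S
    unfolding gv using that cont[of UNIV] by (simp add: open_vimage)
  have frt: "frontier (g ` S) = g ` frontier S" if "open S" for S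
    using that opn[OF that] closure_injective_linear_image[OF lg inj(2), of S] inj(2)
    by (simp add: frontier_def interior_open image_set_diff)
  have I: "open I" "bounded I" "connected I" "I \<noteq> {}" "frontier I = B"
    using opn io frt lg img connected_linear_image[OF lg] bounded_linear_image[of inner g]
    by (auto simp: I_def linear_linear)
  have U: "open U" "frontier U = B" using opn io frt img by (auto simp: U_def)
  have IU: "I \<inter> U = {}" "I \<union> U = - B"
  proof -
    show "I \<inter> U = {}" unfolding I_def U_def using io(9) inj(2) by (metis image_Int image_empty)
    have "I \<union> U = g ` (- path_image (h \<circ> p))" by (simp add: I_def U_def io(10)[symmetric] image_Un)
    also have "\<dots> = - B" unfolding img[symmetric] gv by (simp add: vimage_Compl)
    finally show "I \<union> U = - B" .
  qed
  have "\<not> bounded U"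
  proof
    assume "bounded U"
    then have "bounded (h ` U)" using bounded_linear_image linear_linear lh by blast
    moreover have "h ` U = outer" by (simp add: U_def image_image hg)
    ultimately show False using io by simp
  qed
  \<comment> \<open>One inclusion holds because \<open>U\<close> is a connected unbounded part of
    the complement, the other because \<open>I\<close> is open and bounded with frontier
    \<open>B\<close>.\<close>
  have ins: "inside B = I"
  proof
    show "inside B \<subseteq> I"
    proof (rule inside_subset)
      show "connected U" using io connected_linear_image[OF lg] by (simp add: U_def)
      show "\<not> bounded U" by fact
      show "I \<union> U = - B" by fact
    qed
    show "I \<subseteq> inside B"
      using interior_inside_frontier[of I] I by (simp add: interior_open)
  qed
  have out: "outside B = U"
    using outside_inside[of B] ins IU by auto
  show "inside B \<noteq> {}" "open (inside B)" "bounded (inside B)" "open (outside B)"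
    "frontier (inside B) = B" "frontier (outside B) = B"
    using I U ins out by auto
qed

section \<open>Edges of simple polygonal loops\<close>

lemma pathstart_polygonal_path [simp]: "pathstart (polygonal_path (a # L)) = a"
  by (cases "a # L" rule: polygonal_path.cases) auto

lemma pathfinish_polygonal_path [simp]: "L \<noteq> [] \<Longrightarrow> pathfinish (polygonal_path L) = last L"
  by (induction L rule: polygonal_path.induct) auto

lemma path_image_polygonal_path:
  "length L \<ge> 2 \<Longrightarrow> path_image (polygonal_path L) = (\<Union>(x, y)\<in>set (zip L (tl L)). closed_segment x y)"
  by (induction L rule: polygonal_path.induct) (auto simp: path_image_join)

lemma arc_polygonal_path_edges:
  assumes "arc (polygonal_path L)" "e \<in> set (zip L (tl L))"
  shows "fst e \<noteq> snd e"
  using assms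
proof (induction L rule: polygonal_path.induct)
  case (3 a b)
  then show ?case using arc_distinct_ends[of "linepath a b"] by auto
next
  case (4 a b c ps)
  then have "arc (linepath a b)" "arc (polygonal_path (b # c # ps))"
    by (auto simp: arc_join_eq)
  then show ?case using 4 arc_distinct_ends[of "linepath a b"] by auto
qed auto

text \<open>Injectivity of the path shows that the first edge meets the rest in \<open>b\<close>
  only. That \<open>b\<close> is an end of the edge met there follows by comparing this edge with
  \<open>(b, c)\<close> through the induction hypothesis.\<close>

lemma arc_polygonal_path_Int:
  assumes "arc (polygonal_path L)" "e \<in> set (zip L (tl L))" "e' \<in> set (zip L (tl L))" "e \<noteq> e'"
  shows "closed_segment (fst e) (snd e) \<inter> closed_segment (fst e') (snd e')
    \<subseteq> {fst e, snd e} \<inter> {fst e', snd e'}"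
  using assms
proof (induction L arbitrary: e e' rule: polygonal_path.induct)
  case (4 a b c ps)
  define R where "R = set (zip (b # c # ps) (c # ps))"
  have arcs: "arc (polygonal_path (b # c # ps))"
    and disj: "closed_segment a b \<inter> path_image (polygonal_path (b # c # ps)) \<subseteq> {b}"
    using "4.prems"(1) by (auto simp: arc_join_eq)
  have IH: "closed_segment (fst e) (snd e) \<inter> closed_segment (fst e') (snd e')
    \<subseteq> {fst e, snd e} \<inter> {fst e', snd e'}" if "e \<in> R" "e' \<in> R" "e \<noteq> e'" for e e'
    using "4.IH"[OF arcs] that by (simp add: R_def)
  have bc: "(b, c) \<in> R" by (simp add: R_def)
  have sub: "closed_segment (fst e) (snd e) \<subseteq> path_image (polygonal_path (b # c # ps))" if "e \<in> R" for e
    using that by (subst path_image_polygonal_path) (auto simp: R_def)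
  have main: "closed_segment a b \<inter> closed_segment (fst e) (snd e) \<subseteq> {a, b} \<inter> {fst e, snd e}" if e: "e \<in> R" for e
  proof
    fix x assume x: "x \<in> closed_segment a b \<inter> closed_segment (fst e) (snd e)"
    then have "x = b" using disj sub[OF e] by blast
    moreover have "b \<in> {fst e, snd e}"
    proof (cases "e = (b, c)")
      case False
      then show ?thesis using IH[OF bc e] x \<open>x = b\<close> by auto
    qed simp
    ultimately show "x \<in> {a, b} \<inter> {fst e, snd e}" by simp
  qed
  have "e = (a, b) \<or> e \<in> R" "e' = (a, b) \<or> e' \<in> R"
    using "4.prems"(2,3) by (auto simp: R_def)
  then consider "e \<in> R" "e' \<in> R" | "e = (a, b)" "e' \<in> R" | "e \<in> R" "e' = (a, b)"
    using "4.prems"(4) by blast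
  then show ?case
  proof cases
    case 1
    then show ?thesis using IH "4.prems"(4) by blast
  next
    case 2
    then show ?thesis using main[of e'] by simp
  next
    case 3
    then show ?thesis using main[of e] by (simp add: Int_commute)
  qed
qed auto

lemma arc_polygonal_path_distinct: "arc (polygonal_path L) \<Longrightarrow> length L \<ge> 2 \<Longrightarrow> distinct L"
proof (induction L rule: polygonal_path.induct)
  case (3 a b)
  then show ?case using arc_distinct_ends[of "linepath a b"] by auto
next
  case (4 a b c ps)
  then have arcs: "arc (linepath a b)" "arc (polygonal_path (b # c # ps))"
    and disj: "closed_segment a b \<inter> path_image (polygonal_path (b # c # ps)) \<subseteq> {b}"
    by (auto simp: arc_join_eq)
  have "v \<in> path_image (polygonal_path (x # y # L))" if "v \<in> set (x # y # L)" for v x y :: point and L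
    using that
  proof (induction L arbitrary: x y)
    case (Cons z L)
    from Cons.prems consider "v = x" | "v \<in> set (y # z # L)" by auto
    then show ?case
      using Cons.IH[of y z] by cases (auto simp: path_image_join)
  qed auto
  then have "set (b # c # ps) \<subseteq> path_image (polygonal_path (b # c # ps))" by blast
  moreover have "a \<noteq> b" using arc_distinct_ends[OF arcs(1)] by simp
  ultimately have "a \<notin> set (b # c # ps)" using disj ends_in_segment(1)[of a b] by blast
  then show ?case using "4.IH"[OF arcs(2)] by simp
qed auto

lemma edge_ends_zip_tl:
  assumes "K \<noteq> []"
  shows "edge_ends K = set (zip (K @ [hd K]) (tl (K @ [hd K])))"
proof -
  obtain a xs where K: "K = a # xs" using assms by (cases K) auto
  have "zip (K @ [a]) (xs @ [a]) = zip K (xs @ [a])"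
    using zip_append1[of K "[a]" "xs @ [a]"] by (simp add: K)
  then show ?thesis by (simp add: edge_ends_def K)
qed

lemma closed_segment_not_subset_ends:
  fixes a b :: point
  assumes "a \<noteq> b"
  shows "\<not> closed_segment a b \<subseteq> {a, b}"
proof
  assume "closed_segment a b \<subseteq> {a, b}"
  then have "midpoint a b \<in> {a, b}" using midpoint_in_closed_segment[of a b] by blast
  then show False using assms by auto
qed

text \<open>A loop with one vertex is constant, and one with two vertices runs through the same
  segment twice; neither is simple.\<close>

lemma polygon_length:
  assumes "polygon K"
  obtains a b c ps where "K = a # b # c # ps"
proof -
  have ne: "K \<noteq> []" and s: "simple_path (polygonal_path (K @ [hd K]))" using assms by (auto simp: polygon_def)
  have no1: "\<not> simple_path (linepath a a)" for a :: point
  proof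
    assume "simple_path (linepath a a)"
    then have "loop_free (linepath a a)" by (simp add: simple_path_def)
    from this[unfolded loop_free_def, rule_format, of "1/3" "1/2"] show False by simp
  qed
  have no2: "\<not> simple_path (linepath a b +++ linepath b a)" for a b :: point
  proof
    assume "simple_path (linepath a b +++ linepath b a)"
    then have "arc (linepath a b)" "closed_segment a b \<subseteq> {a, b}"
      by (auto simp: simple_path_join_loop_eq closed_segment_commute)
    then show False
      using arc_distinct_ends[of "linepath a b"] closed_segment_not_subset_ends[of a b] by auto
  qed
  show thesis
  proof (cases K rule: polygonal_path.cases)
    case (2 a)
    then show ?thesis using s no1 by simp
  next
    case (3 a b)
    then show ?thesis using s no2 by simp
  qed (use ne that in auto)
qed

lemma polygon_distinct:
  assumes "polygon K"
  shows "distinct K"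
proof -
  obtain a b c ps where K: "K = a # b # c # ps" using polygon_length[OF assms(1)] .
  have "simple_path (linepath a b +++ polygonal_path (b # c # ps @ [a]))"
    using assms(1) by (simp add: polygon_def K)
  then have "arc (polygonal_path (b # c # ps @ [a]))"
    by (auto simp: simple_path_join_loop_eq)
  from arc_polygonal_path_distinct[OF this] show ?thesis by (auto simp: K)
qed

text \<open>Rotating the vertex list only permutes the summands. Distinct vertices are required
  because \<open>edge_ends\<close> is a set, in which repeated pairs would merge.\<close>

lemma sum_edge_ends:
  fixes h :: "point \<Rightarrow> real"
  assumes "polygon K"
  shows "(\<Sum>(a, b)\<in>edge_ends K. h b - h a) = 0"
proof -
  have "distinct (zip K (rotate1 K))" using polygon_distinct[OF assms] by (rule distinct_zipI1)
  then have eq: "(\<Sum>e\<in>edge_ends K. g e) = sum_list (map g (zip K (rotate1 K)))" for g :: "point \<times> point \<Rightarrow> real"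
    by (simp add: edge_ends_def sum_list_distinct_conv_sum_set)
  have "sum_list (map (\<lambda>e. h (snd e)) (zip K (rotate1 K))) = sum_list (map h (map snd (zip K (rotate1 K))))"
    "sum_list (map (\<lambda>e. h (fst e)) (zip K (rotate1 K))) = sum_list (map h (map fst (zip K (rotate1 K))))"
    by (simp_all only: map_map o_def)
  moreover have "sum_list (map h (rotate1 K)) = sum_list (map h K)" by (cases K) auto
  ultimately show ?thesis
    by (simp add: case_prod_beta' sum_subtractf eq)
qed

lemma bdry_Union:
  assumes "K \<noteq> []"
  shows "bdry K = (\<Union>(a, b)\<in>edge_ends K. closed_segment a b)"
  using assms unfolding bdry_def by (cases K) (auto simp: path_image_polygonal_path edge_ends_zip_tl)

text \<open>The loop is its first edge joined to an arc, which it meets in both ends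
  \<open>a\<close> and \<open>b\<close>. An edge of the arc through \<open>b\<close> is compared
  with \<open>(b, c)\<close>, one through \<open>a\<close> with the closing edge
  \<open>(d, a)\<close>.\<close>

lemma
  assumes "polygon K" "e \<in> edge_ends K"
  shows polygon_edge_distinct: "fst e \<noteq> snd e"
    and polygon_edges_Int: "e' \<in> edge_ends K \<Longrightarrow> e \<noteq> e' \<Longrightarrow>
      closed_segment (fst e) (snd e) \<inter> closed_segment (fst e') (snd e')
        \<subseteq> {fst e, snd e} \<inter> {fst e', snd e'}"
proof -
  obtain a b c ps where K: "K = a # b # c # ps" using polygon_length[OF assms(1)] .
  define L where "L = b # c # ps @ [a]"
  define R where "R = set (zip L (tl L))"
  have ends: "edge_ends K = insert (a, b) R"
    by (subst edge_ends_zip_tl) (auto simp: K R_def L_def)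
  have "simple_path (linepath a b +++ polygonal_path L)"
    using assms(1) by (simp add: polygon_def K L_def)
  then have arcs: "arc (linepath a b)" "arc (polygonal_path L)"
    and disj: "closed_segment a b \<inter> path_image (polygonal_path L) \<subseteq> {a, b}"
    by (auto simp: simple_path_join_loop_eq L_def)
  have distR: "fst e \<noteq> snd e" if "e \<in> R" for e
    using arc_polygonal_path_edges[OF arcs(2)] that by (simp add: R_def)
  moreover have "a \<noteq> b" using arc_distinct_ends[OF arcs(1)] by simp
  ultimately show "fst e \<noteq> snd e"
    using assms(2) unfolding ends by (metis fst_conv snd_conv insertE)
  have IH: "closed_segment (fst e) (snd e) \<inter> closed_segment (fst e') (snd e')
    \<subseteq> {fst e, snd e} \<inter> {fst e', snd e'}" if "e \<in> R" "e' \<in> R" "e \<noteq> e'" for e e'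
    using arc_polygonal_path_Int[OF arcs(2)] that by (simp add: R_def)
  have bc: "(b, c) \<in> R" by (simp add: R_def L_def)
  obtain d where da: "(d, a) \<in> R"
  proof -
    have "zip L (tl L) = zip (butlast L) (tl L)"
      using zip_append1[of "butlast L" "[a]" "tl L"] by (simp add: L_def)
    moreover have "last (zip (butlast L) (tl L)) = (last (butlast L), last (tl L))"
      by (rule last_zip) (auto simp: L_def)
    moreover have "zip (butlast L) (tl L) \<noteq> []" by (auto simp: L_def)
    ultimately have "(last (butlast L), last (tl L)) \<in> R" unfolding R_def by (metis last_in_set)
    then show ?thesis using that[of "last (butlast L)"] by (simp add: L_def)
  qed
  have sub: "closed_segment (fst e) (snd e) \<subseteq> path_image (polygonal_path L)" if "e \<in> R" for e
    using that by (subst path_image_polygonal_path) (auto simp: R_def L_def)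
  have main: "closed_segment a b \<inter> closed_segment (fst e) (snd e) \<subseteq> {a, b} \<inter> {fst e, snd e}" if e: "e \<in> R" for e
  proof
    fix x assume x: "x \<in> closed_segment a b \<inter> closed_segment (fst e) (snd e)"
    then have "x \<in> {a, b}" using disj sub[OF e] by blast
    moreover have "b \<in> {fst e, snd e}" if "x = b"
    proof (cases "e = (b, c)")
      case False
      then show ?thesis using IH[OF bc e] x that by auto
    qed simp
    moreover have "a \<in> {fst e, snd e}" if "x = a"
    proof (cases "e = (d, a)")
      case False
      then show ?thesis using IH[OF da e] x that by auto
    qed simp
    ultimately show "x \<in> {a, b} \<inter> {fst e, snd e}" by auto
  qed
  assume e': "e' \<in> edge_ends K" "e \<noteq> e'"
  then have "e = (a, b) \<or> e \<in> R" "e' = (a, b) \<or> e' \<in> R"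
    using assms(2) by (simp_all add: ends)
  then consider "e \<in> R" "e' \<in> R" | "e = (a, b)" "e' \<in> R" | "e \<in> R" "e' = (a, b)"
    using e'(2) by blast
  then show "closed_segment (fst e) (snd e) \<inter> closed_segment (fst e') (snd e')
        \<subseteq> {fst e, snd e} \<inter> {fst e', snd e'}"
  proof cases
    case 1
    then show ?thesis using IH e' by blast
  next
    case 2
    then show ?thesis using main[of e'] by simp
  next
    case 3
    then show ?thesis using main[of e] by (simp add: Int_commute)
  qed
qed

text \<open>Allows sums over ordered end points to be rewritten as sums over edges as point sets.
  Two edges on the same segment would force it into its own end points.\<close>

lemma inj_on_closed_segment_edge_ends:
  assumes "polygon K"
  shows "inj_on (\<lambda>(a, b). closed_segment a b) (edge_ends K)"
proof (rule inj_onI, rule ccontr)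
  fix e e' assume e: "e \<in> edge_ends K" "e' \<in> edge_ends K" "e \<noteq> e'"
    and eq: "(case e of (a, b) \<Rightarrow> closed_segment a b) = (case e' of (a, b) \<Rightarrow> closed_segment a b)"
  have "closed_segment (fst e) (snd e) = closed_segment (fst e') (snd e')"
    using eq by (simp add: case_prod_beta' del: closed_segment_eq)
  then have "closed_segment (fst e) (snd e) \<subseteq> {fst e, snd e}"
    using polygon_edges_Int[OF assms e(1,2,3)] by blast
  then show False using closed_segment_not_subset_ends polygon_edge_distinct[OF assms e(1)] by blast
qed

lemma linepath_in_open_segment:
  fixes a b :: point
  assumes "a \<noteq> b"
  shows "x \<in> open_segment a b \<longleftrightarrow> (\<exists>t. 0 < t \<and> t < 1 \<and> x = linepath a b t)"
  using assms by (auto simp: in_segment linepath_def)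

lemma rel_interior_edge:
  assumes "polygon K" "(a, b) \<in> edge_ends K"
  shows "x \<in> rel_interior (closed_segment a b) \<longleftrightarrow> (\<exists>t. 0 < t \<and> t < 1 \<and> x = linepath a b t)"
  using polygon_edge_distinct[OF assms]
  by (simp add: rel_interior_closed_segment linepath_in_open_segment)

lemma rel_interior_edge_unique:
  assumes "polygon K" "(a, b) \<in> edge_ends K" "F \<in> edges K" "x \<in> F" "x \<in> rel_interior (closed_segment a b)"
  shows "F = closed_segment a b"
proof (rule ccontr)
  assume ne: "F \<noteq> closed_segment a b"
  obtain a' b' where F: "(a', b') \<in> edge_ends K" "F = closed_segment a' b'"
    using assms(3) by (auto simp: edges_def)
  have ab: "a \<noteq> b" using polygon_edge_distinct[OF assms(1,2)] by simp
  have x: "x \<in> open_segment a b" using assms(5) ab by (simp add: rel_interior_closed_segment)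
  have "(a, b) \<noteq> (a', b')" using ne F(2) by auto
  from polygon_edges_Int[OF assms(1,2) F(1) this]
  have "closed_segment a b \<inter> closed_segment a' b' \<subseteq> {a, b}" by simp
  then have "x \<in> {a, b}" using F(2) assms(4) open_closed_segment[OF x] by blast
  then show False using x by (simp add: open_segment_def)
qed


section \<open>Oriented areas and rays\<close>

definition cross :: "point \<Rightarrow> point \<Rightarrow> real" where
  "cross u v = fst u * snd v - snd u * fst v"

lemma norm_perp: "norm (perp v) = norm v"
  by (simp add: perp_def norm_prod_def add.commute)

lemma perp_inner_self: "perp v \<bullet> v = 0"
  by (simp add: perp_def inner_prod_def)

lemma cross_zero_collinear:
  assumes "cross u v = 0" "u \<noteq> 0"
  obtains l where "v = l *\<^sub>R u"
proof (cases "fst u = 0")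
  case True
  then have "snd u \<noteq> 0" using assms(2) by (metis prod.collapse zero_prod_def)
  then have "v = (snd v / snd u) *\<^sub>R u"
    using assms(1) True by (simp add: cross_def prod_eq_iff)
  then show ?thesis by (rule that)
next
  case False
  then have "v = (fst v / fst u) *\<^sub>R u"
    using assms(1) by (simp add: cross_def prod_eq_iff field_simps)
  then show ?thesis by (rule that)
qed

text \<open>Picks points \<open>(1 - e) v + e u\<close> and \<open>(1 - d) v + d w\<close> on one ray when \<open>A = v \<times> w\<close>, \<open>B = v \<times> u\<close>, \<open>C = u \<times> w\<close>.\<close>

lemma collinear_choice:
  fixes A B C :: real
  assumes "A * B > 0"
  obtains e d where "0 < e" "e < 1" "0 < d" "d < 1" "(1 - e) * d * A - e * (1 - d) * B + e * d * C = 0"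
proof -
  have pos: "\<exists>e d. 0 < e \<and> e < 1 \<and> 0 < d \<and> d < 1 \<and> (1 - e) * d * A - e * (1 - d) * B + e * d * C = 0"
    if A: "A > 0" and B: "B > 0" for A B C :: real
  proof -
    \<comment> \<open>Chosen so that \<open>e (A - C) < A\<close>, which makes \<open>D\<close>
      exceed \<open>e B\<close>. The required equation reads \<open>d D = e B\<close> and so has a
      solution \<open>d\<close> below 1.\<close>
    define e where "e = A / (A + \<bar>A - C\<bar> + 1)"
    have e: "0 < e" "e < 1" using A by (auto simp: e_def divide_less_eq)
    have "e * (A - C) \<le> e * \<bar>A - C\<bar>" using e by (intro mult_left_mono) auto
    also have "\<dots> < A"
      using A by (simp add: e_def divide_less_eq)
    finally have AC: "e * (A - C) < A" .
    define D where "D = (1 - e) * A + e * B + e * C"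
    have D: "e * B < D" using AC by (simp add: D_def algebra_simps)
    have eB: "0 < e * B" using e B by simp
    define d where "d = e * B / D"
    have d: "0 < d" "d < 1" "d * D = e * B" using D eB by (auto simp: d_def)
    then have "(1 - e) * d * A - e * (1 - d) * B + e * d * C = 0"
      by (simp add: D_def algebra_simps)
    then show ?thesis using e d by blast
  qed
  consider "A > 0" "B > 0" | "- A > 0" "- B > 0" using assms by (auto simp: zero_less_mult_iff)
  then show ?thesis
  proof cases
    case 1
    then show ?thesis using pos[of A B C] that by blast
  next
    case 2
    then obtain e d where "0 < e" "e < 1" "0 < d" "d < 1" "(1 - e) * d * (- A) - e * (1 - d) * (- B) + e * d * (- C) = 0"
      using pos[of "- A" "- B" "- C"] by blast
    then show ?thesis using that[of e d] by (simp add: algebra_simps)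
  qed
qed

section \<open>Polygons star-shaped with respect to a ball\<close>

locale star_polygon =
  fixes K :: element and c :: point and r :: real
  assumes polygon: "polygon K" and r_pos: "0 < r" and star: "star_shaped_wrt_ball (cell K) c r"
begin

lemma K_ne: "K \<noteq> []"
  using polygon by (simp add: polygon_def)

lemmas edge_distinct = polygon_edge_distinct[OF polygon]

lemma bdry_edges: "bdry K = (\<Union>(a, b)\<in>edge_ends K. closed_segment a b)"
  by (rule bdry_Union[OF K_ne])

lemma edge_subset_bdry: "(a, b) \<in> edge_ends K \<Longrightarrow> closed_segment a b \<subseteq> bdry K"
  by (auto simp: bdry_edges)

text \<open>A cell is the closure of the Jordan interior. No boundary point is interior to the cell,
  since each is also a limit of points outside.\<close>

lemma
  shows cell_bounded: "bounded (cell K)" and cell_closed: "closed (cell K)"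
    and cell_eq: "cell K = bdry K \<union> interior (cell K)"
    and interior_ne: "interior (cell K) \<noteq> {}"
    and bdry_interior: "bdry K \<inter> interior (cell K) = {}"
    and cell_closure: "closure (interior (cell K)) = cell K"
proof -
  define p where "p = polygonal_path (K @ [hd K])"
  have p: "simple_path p" using polygon by (simp add: polygon_def p_def)
  obtain a L where "K @ [hd K] = a # L" "a = hd K" using K_ne by (cases K) auto
  then have "pathfinish p = pathstart p"
    unfolding p_def by (metis append_is_Nil_conv last_snoc not_Cons_self2 pathfinish_polygonal_path pathstart_polygonal_path)
  note J = Jordan_inside_outside_plane[OF p this]
  have B: "path_image p = bdry K" by (simp add: bdry_def p_def)
  note J = J[unfolded B]
  have cl: "closure (inside (bdry K)) = cell K"
    using J(5) closure_Un_frontier[of "inside (bdry K)"] by (auto simp: cell_def)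
  show "bounded (cell K)" "closed (cell K)"
    using J(3) by (auto simp: cl[symmetric])
  have out: "cell K \<inter> outside (bdry K) = {}"
    unfolding cell_def using outside_inside by blast
  have disj: "bdry K \<inter> interior (cell K) = {}"
  proof (rule ccontr)
    assume "bdry K \<inter> interior (cell K) \<noteq> {}"
    then obtain x where x: "x \<in> frontier (outside (bdry K))" "x \<in> interior (cell K)" using J(6) by blast
    then have "x \<in> closure (outside (bdry K))" by (simp add: frontier_def)
    then have "interior (cell K) \<inter> outside (bdry K) \<noteq> {}"
      using x(2) open_Int_closure_eq_empty[OF open_interior] by blast
    then show False using out interior_subset by blast
  qed
  have int: "interior (cell K) = inside (bdry K)"
  proof
    show "interior (cell K) \<subseteq> inside (bdry K)"
      using disj interior_subset[of "cell K"] by (auto simp: cell_def)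
    show "inside (bdry K) \<subseteq> interior (cell K)"
      by (rule interior_maximal) (auto simp: cell_def J)
  qed
  show "cell K = bdry K \<union> interior (cell K)" "interior (cell K) \<noteq> {}" 
    "closure (interior (cell K)) = cell K"
    using J cl by (simp_all add: int) (simp add: cell_def)
  show "bdry K \<inter> interior (cell K) = {}" by fact
qed

lemma cell_compact: "compact (cell K)"
  using cell_bounded cell_closed by (simp add: compact_eq_bounded_closed)

lemma ball_subset: "ball c r \<subseteq> cell K"
proof
  fix y assume y: "y \<in> ball c r"
  obtain x where "x \<in> cell K" using interior_ne interior_subset by blast
  then have "closed_segment y x \<subseteq> cell K" using star y by (auto simp: star_shaped_wrt_ball_def)
  then show "y \<in> cell K" by auto
qed

lemma center_interior: "c \<in> interior (cell K)"
  using ball_subset r_pos by (meson centre_in_ball interiorI open_ball)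

lemma center_notin_bdry: "c \<notin> bdry K"
  using center_interior bdry_interior by blast

text \<open>The homothety with center \<open>x\<close> and ratio \<open>1 - s\<close> maps the ball
  about \<open>c\<close> to a ball of radius \<open>(1 - s) r\<close> about the point in question,
  and star-shapedness keeps this image in the cell.\<close>

lemma star_interior:
  assumes "x \<in> cell K" "0 \<le> s" "s < 1"
  shows "c + s *\<^sub>R (x - c) \<in> interior (cell K)"
proof (rule interiorI[OF open_ball])
  define y where "y = c + s *\<^sub>R (x - c)"
  show "c + s *\<^sub>R (x - c) \<in> ball y ((1 - s) * r)" using assms r_pos by (simp add: y_def)
  show "ball y ((1 - s) * r) \<subseteq> cell K"
  proof
    fix w assume w: "w \<in> ball y ((1 - s) * r)"
    define z where "z = c + (1 / (1 - s)) *\<^sub>R (w - y)"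
    have "norm (w - y) < (1 - s) * r" using w by (simp add: dist_norm norm_minus_commute)
    moreover have "norm (z - c) = norm (w - y) / (1 - s)" using assms by (simp add: z_def)
    ultimately have "norm (z - c) < r" using assms by (simp add: divide_less_eq mult.commute)
    then have "z \<in> ball c r" by (simp add: dist_norm norm_minus_commute)
    then have "closed_segment z x \<subseteq> cell K" using star assms(1) by (auto simp: star_shaped_wrt_ball_def)
    moreover have "(1 - s) *\<^sub>R z = (1 - s) *\<^sub>R c + (w - y)"
      using assms by (simp add: z_def scaleR_add_right)
    then have "w = (1 - s) *\<^sub>R z + s *\<^sub>R x" by (simp add: y_def algebra_simps)
    then have "w \<in> closed_segment z x" using assms by (auto simp: in_segment)
    ultimately show "w \<in> cell K" by blast
  qed
qed

text \<open>Of two boundary points on one ray from the center, the nearer one would be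
  interior.\<close>

lemma star_unique:
  assumes "p \<in> bdry K" "c + s *\<^sub>R (p - c) \<in> bdry K" "0 \<le> s"
  shows "s = 1"
proof (rule ccontr)
  assume "s \<noteq> 1"
  define q where "q = c + s *\<^sub>R (p - c)"
  have cell: "p \<in> cell K" "q \<in> cell K" using assms by (auto simp: cell_def q_def)
  show False
  proof (cases "s < 1")
    case True
    then show False using star_interior[OF cell(1) assms(3)] assms(2) bdry_interior by blast
  next
    case False
    then have "p = c + (1 / s) *\<^sub>R (q - c)" by (simp add: q_def)
    then show False using star_interior[OF cell(2), of "1 / s"] False \<open>s \<noteq> 1\<close> assms(1) bdry_interior by auto
  qed
qed

lemma star_ray:
  assumes "x \<in> cell K" "x \<noteq> c"
  obtains p s where "p \<in> bdry K" "0 < s" "s \<le> 1" "x = c + s *\<^sub>R (p - c)"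
proof -
  obtain d where d: "0 < d" "c + d *\<^sub>R (x - c) \<in> frontier (cell K)"
    using ray_to_frontier[OF cell_bounded center_interior, of "x - c"] assms(2) by auto
  define p where "p = c + d *\<^sub>R (x - c)"
  have p: "p \<in> cell K" "p \<notin> interior (cell K)"
    using d(2) cell_closed by (auto simp: frontier_def p_def)
  then have "p \<in> bdry K" using cell_eq by blast
  moreover have "d \<ge> 1" using star_interior[OF assms(1), of d] d(1) p(2) by (force simp: p_def)
  moreover have "x = c + (1 / d) *\<^sub>R (p - c)" using d by (simp add: p_def)
  ultimately show ?thesis using that[of p "1 / d"] by simp
qed

text \<open>If \<open>a\<close>, \<open>b\<close> and \<open>c\<close> were collinear, then either
  \<open>a\<close> and \<open>b\<close> would be two boundary points on one ray, or \<open>c\<close>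
  would lie on the edge between them.\<close>

lemma cross_edge_nonzero:
  assumes "(a, b) \<in> edge_ends K"
  shows "cross (a - c) (b - c) \<noteq> 0"
proof
  assume z: "cross (a - c) (b - c) = 0"
  have ab: "a \<in> bdry K" "b \<in> bdry K" using edge_subset_bdry[OF assms] by auto
  have "a \<noteq> c" using ab center_notin_bdry by auto
  then obtain l where l: "b - c = l *\<^sub>R (a - c)" using cross_zero_collinear[OF z] by auto
  then have b: "b = c + l *\<^sub>R (a - c)" by (simp add: algebra_simps)
  show False
  proof (cases "l \<ge> 0")
    case True
    then have "l = 1" using star_unique[OF ab(1)] ab(2) b by auto
    then show False using edge_distinct[OF assms] b by simp
  next
    case False
    \<comment> \<open>The parameter at which the segment from \<open>a\<close> to \<open>b\<close>
      passes through \<open>c\<close>, the solution of \<open>1 - t + t l = 0\<close>.\<close>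
    define t where "t = 1 / (1 - l)"
    have t: "0 \<le> t" "t \<le> 1" using False by (auto simp: t_def)
    have t0: "1 - t + t * l = 0" using False by (simp add: t_def field_simps)
    have "(1 - t) *\<^sub>R a + t *\<^sub>R b = c + (1 - t + t * l) *\<^sub>R (a - c)"
      unfolding b by (simp add: algebra_simps)
    then have "(1 - t) *\<^sub>R a + t *\<^sub>R b = c" by (simp add: t0)
    then have "c \<in> closed_segment a b" using t by (auto simp: in_segment)
    then show False using edge_subset_bdry[OF assms] center_notin_bdry by blast
  qed
qed

text \<open>Otherwise both edges lie on the same side of the ray through \<open>v\<close>, and a nearby ray meets both.\<close>

lemma orientation_consecutive:
  assumes "(u, v) \<in> edge_ends K" "(v, w) \<in> edge_ends K"
  shows "sgn (cross (u - c) (v - c)) = sgn (cross (v - c) (w - c))"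
proof (rule ccontr)
  assume ne: "sgn (cross (u - c) (v - c)) \<noteq> sgn (cross (v - c) (w - c))"
  define U V W where "U = u - c" and "V = v - c" and "W = w - c"
  define A B where "A = cross V W" and "B = cross V U"
  have AB: "A \<noteq> 0" "cross U V \<noteq> 0" "cross U V = - B"
    using cross_edge_nonzero assms by (auto simp: A_def B_def U_def V_def W_def cross_def)
  then have "A * B > 0" using ne by (auto simp: A_def U_def V_def W_def zero_less_mult_iff sgn_if split: if_splits)
  then obtain e d where ed: "0 < e" "e < 1" "0 < d" "d < 1"
    "(1 - e) * d * A - e * (1 - d) * B + e * d * cross U W = 0" using collinear_choice by blast
  \<comment> \<open>Points of the two edges, taken relative to \<open>c\<close>. The equation for
    \<open>e\<close> and \<open>d\<close> says that \<open>cross q p\<close> vanishes, so that both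
    lie on one line through \<open>c\<close>.\<close>
  define p q where "p = (1 - e) *\<^sub>R V + e *\<^sub>R U" and "q = (1 - d) *\<^sub>R V + d *\<^sub>R W"
  have cp: "cross V p = e * B" and cq: "cross V q = d * A"
    by (simp_all add: cross_def p_def q_def A_def B_def algebra_simps)
  have "cross q p = - ((1 - e) * d * A - e * (1 - d) * B + e * d * cross U W)"
    by (simp add: cross_def p_def q_def A_def B_def algebra_simps)
  then have "cross q p = 0" using ed by simp
  moreover have "q \<noteq> 0" using cq ed AB by (auto simp: cross_def)
  ultimately obtain l where l: "p = l *\<^sub>R q" using cross_zero_collinear by blast
  have "e * B = l * (d * A)" using cp cq by (simp add: l cross_def algebra_simps)
  \<comment> \<open>The common sign of \<open>A\<close> and \<open>B\<close> makes \<open>l\<close>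
    positive: the two points are on the same ray, not on opposite ones.\<close>
  then have "e * (A * B) = l * (d * A\<^sup>2)" by (simp add: power2_eq_square mult_ac)
  moreover have "0 < e * (A * B)" using ed \<open>A * B > 0\<close> by simp
  moreover have "0 < d * A\<^sup>2" using ed AB by simp
  ultimately have "l > 0" by (metis less_asym zero_less_mult_pos2)
  have pin: "c + p \<in> closed_segment u v"
    unfolding in_segment using ed by (intro exI[of _ "1 - e"]) (simp add: p_def U_def V_def algebra_simps)
  have qin: "c + q \<in> closed_segment v w"
    unfolding in_segment using ed by (intro exI[of _ d]) (simp add: q_def V_def W_def algebra_simps)
  have "c + l *\<^sub>R ((c + q) - c) = c + p" by (simp add: l)
  then have "l = 1"
    using star_unique[of "c + q" l] pin qin edge_subset_bdry assms \<open>l > 0\<close> by (metis less_imp_le subsetD)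
  then have pq: "p = q" by (simp add: l)
  have "(u, v) \<noteq> (v, w)" using edge_distinct[OF assms(1)] by auto
  \<comment> \<open>A common point of two edges is an end of each, whereas \<open>0 < e < 1\<close>
    puts \<open>c + p\<close> strictly inside the first.\<close>
  then have "c + p \<in> {u, v}" using polygon_edges_Int[OF polygon assms] pin qin by (auto simp: pq)
  then have "p = U \<or> p = V" by (auto simp: U_def V_def)
  then have "e * B = B \<or> e * B = 0" using cp unfolding B_def by (auto simp: cross_def)
  then show False using ed AB by auto
qed

lemma orientation_constant: "\<exists>s. \<forall>a b. (a, b) \<in> edge_ends K \<longrightarrow> sgn (cross (a - c) (b - c)) = s"
proof -
  define n where "n = length K"
  have n: "n > 0" using K_ne by (simp add: n_def)
  define E where "E i = (K ! i, K ! (Suc i mod n))" for i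
  have E: "edge_ends K = E ` {..<n}"
    by (auto simp: edge_ends_def set_zip n_def E_def nth_rotate1 image_iff)
  define s where "s i = sgn (cross (K ! i - c) (K ! (Suc i mod n) - c))" for i
  have "s i = s 0" if "i < n" for i
    using that
  proof (induction i)
    case (Suc i)
    have "E i \<in> edge_ends K" "E (Suc i) \<in> edge_ends K" using Suc.prems unfolding E by auto
    then have "s i = s (Suc i)"
      using orientation_consecutive[of "K ! i" "K ! Suc i" "K ! (Suc (Suc i) mod n)"] Suc.prems
      by (simp add: E_def s_def)
    then show ?case using Suc by simp
  qed simp
  then have "sgn (cross (a - c) (b - c)) = s 0" if "(a, b) \<in> edge_ends K" for a b
    using that unfolding E by (auto simp: E_def s_def)
  then show ?thesis by blast
qed

section \<open>Decomposition into triangles at the center\<close>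

text \<open>The triangle \<open>c\<close>, \<open>a\<close>, \<open>b\<close>, written as a cone
  over the edge because its points are compared along rays from the center.\<close>

definition fan :: "point \<Rightarrow> point \<Rightarrow> point set" where
  "fan a b = {c + s *\<^sub>R (p - c) | s p. 0 \<le> s \<and> s \<le> 1 \<and> p \<in> closed_segment a b}"

lemma cell_fans: "cell K = (\<Union>(a, b)\<in>edge_ends K. fan a b)"
proof
  show "cell K \<subseteq> (\<Union>(a, b)\<in>edge_ends K. fan a b)"
  proof
    fix x assume x: "x \<in> cell K"
    show "x \<in> (\<Union>(a, b)\<in>edge_ends K. fan a b)"
    proof (cases "x = c")
      case True
      obtain a b where ab: "(a, b) \<in> edge_ends K"
        using polygon_length[OF polygon] by (metis edge_ends_def list.set_intros(1) rotate1.simps(2) append_Cons zip_Cons_Cons)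
      have "x = c + 0 *\<^sub>R (a - c)" using True by simp
      then have "x \<in> fan a b" unfolding fan_def
        by (metis (mono_tags, lifting) ends_in_segment(1) mem_Collect_eq order_refl zero_le_one)
      then show ?thesis using ab by auto
    next
      case False
      then obtain p s where "p \<in> bdry K" "0 < s" "s \<le> 1" "x = c + s *\<^sub>R (p - c)"
        using star_ray[OF x] by blast
      then show ?thesis unfolding fan_def bdry_edges by fastforce
    qed
  qed
  show "(\<Union>(a, b)\<in>edge_ends K. fan a b) \<subseteq> cell K"
  proof (clarsimp simp: fan_def)
    fix a b s p assume ab: "(a, b) \<in> edge_ends K" and s: "0 \<le> s" "s \<le> (1::real)" "p \<in> closed_segment a b"
    then have p: "p \<in> cell K" using edge_subset_bdry[OF ab] unfolding cell_def by blast
    show "c + s *\<^sub>R (p - c) \<in> cell K"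
    proof (cases "s = 1")
      case True
      then show ?thesis using p by simp
    next
      case False
      then show ?thesis using star_interior[OF p, of s] s interior_subset by auto
    qed
  qed
qed

lemma negligible_segment: "negligible (closed_segment a (b::point))"
  by (subst negligible_convex_interior) (auto simp: interior_closed_segment_ge2)

text \<open>A common point other than \<open>c\<close> determines a ray, and that ray has a single
  boundary point. It lies on both edges, hence is a common vertex, so the overlap is contained in
  two segments from \<open>c\<close>.\<close>

lemma fan_Int_negligible:
  assumes e: "(a, b) \<in> edge_ends K" "(a', b') \<in> edge_ends K" "(a, b) \<noteq> (a', b')"
  shows "negligible (fan a b \<inter> fan a' b')"
proof (rule negligible_subset)
  show "negligible (closed_segment c a \<union> closed_segment c b)"
    by (intro negligible_Un negligible_segment)
  show "fan a b \<inter> fan a' b' \<subseteq> closed_segment c a \<union> closed_segment c b"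
  proof
    fix x assume "x \<in> fan a b \<inter> fan a' b'"
    then have fans: "x \<in> fan a b" "x \<in> fan a' b'" by auto
    from fans(1) obtain s p where 1: "x = c + s *\<^sub>R (p - c)" "0 \<le> s" "s \<le> 1" "p \<in> closed_segment a b"
      unfolding fan_def by blast
    from fans(2) obtain s' p' where 2: "x = c + s' *\<^sub>R (p' - c)" "0 \<le> s'" "s' \<le> 1" "p' \<in> closed_segment a' b'"
      unfolding fan_def by blast
    note x = 1(1) 2(1) and s = 1(2,3) 2(2,3) and p = 1(4) 2(4)
    have pb: "p \<in> bdry K" "p' \<in> bdry K" using p edge_subset_bdry[OF e(1)] edge_subset_bdry[OF e(2)] by blast+
    show "x \<in> closed_segment c a \<union> closed_segment c b"
    proof (cases "x = c")
      case False
      then have "s > 0" "s' > 0" using x s by (auto simp: order_le_less)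
      have "p' = c + (s / s') *\<^sub>R (p - c)"
      proof -
        have "s' *\<^sub>R (p' - c) = s *\<^sub>R (p - c)" using x by (simp add: algebra_simps)
        then have "(1 / s') *\<^sub>R (s' *\<^sub>R (p' - c)) = (1 / s') *\<^sub>R (s *\<^sub>R (p - c))" by simp
        then have "p' - c = (s / s') *\<^sub>R (p - c)" using \<open>s' > 0\<close> by simp
        then show ?thesis by (metis add.commute diff_add_cancel)
      qed
      then have "s / s' = 1" and p': "p' = c + (s / s') *\<^sub>R (p - c)"
        using star_unique[OF pb(1), of "s / s'"] pb(2) s by auto
      then have "p' = p" by simp
      then have "p = a \<or> p = b" using polygon_edges_Int[OF polygon e] p by auto
      moreover have "x = (1 - s) *\<^sub>R c + s *\<^sub>R p" using x(1) by (simp add: algebra_simps)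
      then have "x \<in> closed_segment c p" using s by (auto simp: in_segment)
      ultimately show ?thesis by blast
    qed simp
  qed
qed

section \<open>The outward normal\<close>

text \<open>\<open>perp\<close> turns clockwise, hence outward for a counterclockwise polygon; the
  sign of the oriented area covers the other orientation.\<close>

definition edge_normal :: "point \<Rightarrow> point \<Rightarrow> point" where
  "edge_normal a b = (sgn (cross (a - c) (b - c)) / norm (b - a)) *\<^sub>R perp (b - a)"

text \<open>The side of the edge is decided by radial projection from \<open>c\<close> onto the edge
  line. A point slightly beyond the edge would, if it were in the cell, make its projection
  interior; a point slightly before the edge is a contraction of a boundary point.\<close>

lemma outward_normal_edge:
  assumes e: "(a, b) \<in> edge_ends K" and x: "x \<in> rel_interior (closed_segment a b)"
  shows "outward_normal K x = edge_normal a b"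
proof -
  define \<nu> where "\<nu> = edge_normal a b"
  define D where "D = cross (a - c) (b - c)"
  define l where "l = norm (b - a)"
  have ab: "a \<noteq> b" using edge_distinct[OF e] by simp
  have l: "l > 0" using ab by (simp add: l_def)
  have l2: "l\<^sup>2 = (fst (b - a))\<^sup>2 + (snd (b - a))\<^sup>2"
    by (simp add: l_def norm_prod_def)
  have D: "D \<noteq> 0" using cross_edge_nonzero[OF e] by (simp add: D_def)
  have sgn2: "(sgn D)\<^sup>2 = 1" using D by (simp add: sgn_if)
  have n1: "norm \<nu> = 1" using D l by (simp add: \<nu>_def edge_normal_def norm_perp D_def l_def abs_sgn_eq)
  have orth: "\<nu> \<bullet> (b - a) = 0" by (simp add: \<nu>_def edge_normal_def perp_inner_self)
  obtain \<theta> where th: "0 < \<theta>" "\<theta> < 1" "x = linepath a b \<theta>"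
    using x rel_interior_edge[OF polygon e] by blast
  then have xa: "x = a + \<theta> *\<^sub>R (b - a)" by (simp add: linepath_def algebra_simps)
  \<comment> \<open>The distance from \<open>c\<close> to the line through the edge, twice the
    triangle area divided by the edge length. Together with \<open>w\<close> it gives the
    coordinates of \<open>x - c\<close> in the directions of the normal and of the edge.\<close>
  define H where "H = \<bar>D\<bar> / l"
  have H: "H > 0" using D l by (simp add: H_def)
  define w where "w = ((x - c) \<bullet> (b - a)) / l\<^sup>2"
  have xc: "x - c = H *\<^sub>R \<nu> + w *\<^sub>R (b - a)"
  proof -
    have "H *\<^sub>R \<nu> = (D / l\<^sup>2) *\<^sub>R perp (b - a)"
      using D l by (simp add: H_def \<nu>_def edge_normal_def D_def l_def power2_eq_square abs_mult_sgn)
    moreover have "l\<^sup>2 *\<^sub>R (x - c) = D *\<^sub>R perp (b - a) + ((x - c) \<bullet> (b - a)) *\<^sub>R (b - a)"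
      unfolding l2 D_def xa
      by (simp add: prod_eq_iff perp_def cross_def inner_prod_def power2_eq_square) (simp add: algebra_simps)
    then have "(1 / l\<^sup>2) *\<^sub>R (l\<^sup>2 *\<^sub>R (x - c)) = (1 / l\<^sup>2) *\<^sub>R (D *\<^sub>R perp (b - a) + ((x - c) \<bullet> (b - a)) *\<^sub>R (b - a))"
      by simp
    ultimately show ?thesis using l by (simp add: w_def scaleR_add_right)
  qed
  \<comment> \<open>The radial projection of \<open>x + t *\<^sub>R \<nu>\<close> to the edge line:
    the height above \<open>c\<close> is \<open>H + t\<close> and is scaled back to
    \<open>H\<close>.\<close>
  define z where "z t = c + (H / (H + t)) *\<^sub>R (x + t *\<^sub>R \<nu> - c)" for t
  have zt: "z t = linepath a b (\<theta> - t * w / (H + t))" if "H + t > 0" for t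
  proof -
    have "x + t *\<^sub>R \<nu> - c = (H + t) *\<^sub>R \<nu> + w *\<^sub>R (b - a)"
      using xc by (simp add: algebra_simps)
    then have "z t = c + H *\<^sub>R \<nu> + (H * w / (H + t)) *\<^sub>R (b - a)"
      using that by (simp add: z_def scaleR_add_right)
    also have "c + H *\<^sub>R \<nu> = x - w *\<^sub>R (b - a)" using xc by (simp add: algebra_simps)
    also have "x - w *\<^sub>R (b - a) + (H * w / (H + t)) *\<^sub>R (b - a) = x + (H * w / (H + t) - w) *\<^sub>R (b - a)"
      by (simp add: algebra_simps)
    also have "H * w / (H + t) - w = - (t * w / (H + t))" using that by (simp add: field_simps)
    finally show ?thesis by (simp add: xa linepath_def algebra_simps)
  qed
  \<comment> \<open>As \<open>x\<close> is strictly inside the edge, the projection stays on the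
    edge for small \<open>t\<close> of either sign.\<close>
  have "((\<lambda>t. \<theta> - t * w / (H + t)) \<longlongrightarrow> \<theta> - 0 * w / (H + 0)) (at 0)"
    using H by (intro tendsto_intros) auto
  then have "\<forall>\<^sub>F t in at 0. \<theta> - t * w / (H + t) \<in> {0<..<1}"
    by (rule topological_tendstoD) (use th in auto)
  then obtain e0 where e0: "e0 > 0" "\<And>t. t \<noteq> 0 \<Longrightarrow> \<bar>t\<bar> < e0 \<Longrightarrow> \<theta> - t * w / (H + t) \<in> {0<..<1}"
    by (auto simp: eventually_at dist_real_def)
  define \<epsilon> where "\<epsilon> = min e0 H"
  have eps: "\<epsilon> > 0" using e0 H by (simp add: \<epsilon>_def)
  have zB: "z t \<in> bdry K" if "t \<noteq> 0" "\<bar>t\<bar> < \<epsilon>" for t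
  proof -
    have "H + t > 0" "\<theta> - t * w / (H + t) \<in> {0<..<1}" using that e0(2)[of t] by (auto simp: \<epsilon>_def)
    then have "z t \<in> closed_segment a b" unfolding linepath_image_01[symmetric] using zt by auto
    then show ?thesis using edge_subset_bdry[OF e] by blast
  qed
  have out: "x + t *\<^sub>R \<nu> \<notin> cell K" if "0 < t" "t < \<epsilon>" for t
  proof
    assume "x + t *\<^sub>R \<nu> \<in> cell K"
    then have "z t \<in> interior (cell K)" unfolding z_def
      using that H by (intro star_interior) (auto simp: divide_less_eq)
    then show False using zB[of t] that bdry_interior by auto
  qed
  have inn: "x + (- t) *\<^sub>R \<nu> \<in> cell K" if "0 < t" "t < \<epsilon>" for t
  proof -
    have t: "H - t > 0" "t < H" using that by (auto simp: \<epsilon>_def)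
    have zc: "z (- t) \<in> cell K" using zB[of "- t"] that by (auto simp: cell_def)
    have "x + (- t) *\<^sub>R \<nu> = c + ((H - t) / H) *\<^sub>R (z (- t) - c)"
      using t H by (simp add: z_def)
    moreover have "c + ((H - t) / H) *\<^sub>R (z (- t) - c) \<in> interior (cell K)"
      using t H that by (intro star_interior[OF zc]) (auto simp: divide_less_eq)
    ultimately show ?thesis using interior_subset by auto
  qed
  have F: "closed_segment a b \<in> edges K" using e by (auto simp: edges_def)
  have orth_F: "n \<bullet> (p - q) = 0" if "n \<bullet> (b - a) = 0" "p \<in> closed_segment a b" "q \<in> closed_segment a b" for n p q
  proof -
    from that(2,3) obtain s t where "p = linepath a b s" "q = linepath a b t"
      unfolding linepath_image_01[symmetric] by auto
    moreover have "linepath a b s - linepath a b t = (s - t) *\<^sub>R (b - a)"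
      by (simp add: linepath_def algebra_simps)
    ultimately show ?thesis using that(1) by (simp add: inner_scaleR_right)
  qed
  show ?thesis unfolding outward_normal_def \<nu>_def[symmetric]
  proof (rule the_equality)
    show "norm \<nu> = 1 \<and> (\<exists>F\<in>edges K. x \<in> rel_interior F \<and> (\<forall>p\<in>F. \<forall>q\<in>F. \<nu> \<bullet> (p - q) = 0)) \<and>
      (\<exists>\<epsilon>>0. \<forall>t\<in>{0<..<\<epsilon>}. x + t *\<^sub>R \<nu> \<notin> cell K)"
      using n1 F x orth_F[OF orth] out eps by (intro conjI bexI[of _ "closed_segment a b"] exI[of _ \<epsilon>]) auto
  next
    fix n assume n: "norm n = 1 \<and> (\<exists>F\<in>edges K. x \<in> rel_interior F \<and> (\<forall>p\<in>F. \<forall>q\<in>F. n \<bullet> (p - q) = 0)) \<and>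
      (\<exists>\<epsilon>>0. \<forall>t\<in>{0<..<\<epsilon>}. x + t *\<^sub>R n \<notin> cell K)"
    from n obtain F' where F': "F' \<in> edges K" "x \<in> rel_interior F'"
      and F'n: "\<forall>p\<in>F'. \<forall>q\<in>F'. n \<bullet> (p - q) = 0" by blast
    from n obtain \<delta> where d: "\<delta> > 0" "\<forall>t\<in>{0<..<\<delta>}. x + t *\<^sub>R n \<notin> cell K" by blast
    have "F' = closed_segment a b"
      using rel_interior_edge_unique[OF polygon e F'(1)] F'(2) x rel_interior_subset by blast
    then have "n \<bullet> (b - a) = 0" using F'n by (metis ends_in_segment)
    then have "cross \<nu> n = 0"
    proof -
      have "cross (perp (b - a)) n = n \<bullet> (b - a)"
        by (simp add: cross_def perp_def inner_prod_def algebra_simps)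
      moreover have "cross (k *\<^sub>R u) n = k * cross u n" for k u by (simp add: cross_def algebra_simps)
      ultimately show ?thesis using \<open>n \<bullet> (b - a) = 0\<close> by (simp add: \<nu>_def edge_normal_def)
    qed
    moreover have "\<nu> \<noteq> 0" using n1 by auto
    ultimately obtain m where m: "n = m *\<^sub>R \<nu>" using cross_zero_collinear by blast
    \<comment> \<open>A unit vector orthogonal to the edge is \<nu> or its negative, and the
      negative points into the cell.\<close>
    then have "\<bar>m\<bar> = 1" using n n1 by simp
    moreover have "m \<noteq> -1"
    proof
      assume "m = -1"
      define t where "t = min \<delta> \<epsilon> / 2"
      have "0 < t" "t < \<delta>" "t < \<epsilon>" using d eps by (auto simp: t_def)
      then show False using bspec[OF d(2), of t] inn[of t] m \<open>m = -1\<close> by simp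
    qed
    ultimately show "n = \<nu>" using m by (simp add: abs_if split: if_splits)
  qed
qed

lemma edge_normal_norm: "(a, b) \<in> edge_ends K \<Longrightarrow> norm (edge_normal a b) = 1"
  using edge_distinct[of "(a, b)"] cross_edge_nonzero[of a b]
  by (simp add: edge_normal_def norm_perp abs_sgn_eq)

lemma outward_normal_linepath:
  "(a, b) \<in> edge_ends K \<Longrightarrow> 0 < t \<Longrightarrow> t < 1 \<Longrightarrow> outward_normal K (linepath a b t) = edge_normal a b"
  using outward_normal_edge rel_interior_edge[OF polygon] by blast

end

section \<open>Green's theorem\<close>

text \<open>The map is factored into two one-dimensional substitutions with Fubini in between: first
  the horizontal coordinate replaces \<open>u\<close>, then the vertical one replaces
  \<open>v\<close>. The first substitution divides by \<open>fst A\<close>.\<close>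

lemma nn_integral_plane_affine_aux:
  fixes f :: "point \<Rightarrow> ennreal"
  assumes f[measurable]: "f \<in> borel_measurable borel" and A: "fst A \<noteq> 0" and D: "cross A B \<noteq> 0"
  shows "(\<integral>\<^sup>+x. f x \<partial>lborel)
    = ennreal \<bar>cross A B\<bar> * (\<integral>\<^sup>+v. \<integral>\<^sup>+u. f (c + u *\<^sub>R A + v *\<^sub>R B) \<partial>lborel \<partial>lborel)"
proof -
  define A1 A2 B1 B2 c1 c2 where "A1 = fst A" and "A2 = snd A" and "B1 = fst B" and "B2 = snd B"
    and "c1 = fst c" and "c2 = snd c"
  have A1: "A1 \<noteq> 0" using A by (simp add: A1_def)
  \<comment> \<open>The slope left for the second substitution, the determinant divided by
    \<open>fst A\<close>.\<close>
  define \<kappa> where "\<kappa> = B2 - A2 * B1 / A1"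
  have k: "cross A B = A1 * \<kappa>" using A1 by (simp add: cross_def \<kappa>_def A1_def A2_def B1_def B2_def field_simps)
  then have k0: "\<kappa> \<noteq> 0" using D by auto
  have [measurable]: "(\<lambda>x. f (g x, h x)) \<in> borel_measurable M"
    if "g \<in> borel_measurable M" "h \<in> borel_measurable M" for g h and M :: "'z measure"
    using that by (intro measurable_compose[OF _ f]) simp
  have coord: "(\<integral>\<^sup>+v. \<integral>\<^sup>+u. f (c + u *\<^sub>R A + v *\<^sub>R B) \<partial>lborel \<partial>lborel)
      = (\<integral>\<^sup>+v. \<integral>\<^sup>+u. f (c1 + u * A1 + v * B1, c2 + u * A2 + v * B2) \<partial>lborel \<partial>lborel)"
    by (intro nn_integral_cong arg_cong[where f=f])
      (simp add: prod_eq_iff A1_def A2_def B1_def B2_def c1_def c2_def)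
  have "ennreal \<bar>A1\<bar> * (\<integral>\<^sup>+v. \<integral>\<^sup>+u. f (c1 + u * A1 + v * B1, c2 + u * A2 + v * B2) \<partial>lborel \<partial>lborel) = (\<integral>\<^sup>+v. ennreal \<bar>A1\<bar> * (\<integral>\<^sup>+u. f (c1 + u * A1 + v * B1, c2 + u * A2 + v * B2) \<partial>lborel) \<partial>lborel)"
    by (rule nn_integral_cmult[symmetric]) measurable
  also have "\<dots> = (\<integral>\<^sup>+v. \<integral>\<^sup>+X. f (X, (c2 + A2 * (X - c1) / A1) + \<kappa> * v) \<partial>lborel \<partial>lborel)"
  proof (rule nn_integral_cong)
    fix v :: real
    have "(\<integral>\<^sup>+X. f (X, (c2 + A2 * (X - c1) / A1) + \<kappa> * v) \<partial>lborel)
      = ennreal \<bar>A1\<bar> * (\<integral>\<^sup>+u. f ((c1 + v * B1) + A1 * u, (c2 + A2 * ((c1 + v * B1) + A1 * u - c1) / A1) + \<kappa> * v) \<partial>lborel)"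
      by (rule nn_integral_real_affine[OF _ A1]) measurable
    also have "(\<lambda>u. f ((c1 + v * B1) + A1 * u, (c2 + A2 * ((c1 + v * B1) + A1 * u - c1) / A1) + \<kappa> * v))
      = (\<lambda>u. f (c1 + u * A1 + v * B1, c2 + u * A2 + v * B2))"
      using A1 by (intro ext arg_cong[where f=f]) (simp add: \<kappa>_def field_simps)
    finally show "ennreal \<bar>A1\<bar> * (\<integral>\<^sup>+u. f (c1 + u * A1 + v * B1, c2 + u * A2 + v * B2) \<partial>lborel)
      = (\<integral>\<^sup>+X. f (X, (c2 + A2 * (X - c1) / A1) + \<kappa> * v) \<partial>lborel)" by simp
  qed
  also have "\<dots> = (\<integral>\<^sup>+X. \<integral>\<^sup>+v. f (X, (c2 + A2 * (X - c1) / A1) + \<kappa> * v) \<partial>lborel \<partial>lborel)"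
    by (rule lborel_pair.Fubini') measurable
  finally have 1: "ennreal \<bar>A1\<bar> * (\<integral>\<^sup>+v. \<integral>\<^sup>+u. f (c1 + u * A1 + v * B1, c2 + u * A2 + v * B2) \<partial>lborel \<partial>lborel)
    = (\<integral>\<^sup>+X. \<integral>\<^sup>+v. f (X, (c2 + A2 * (X - c1) / A1) + \<kappa> * v) \<partial>lborel \<partial>lborel)" .
  have "ennreal \<bar>\<kappa>\<bar> * (\<integral>\<^sup>+X. \<integral>\<^sup>+v. f (X, (c2 + A2 * (X - c1) / A1) + \<kappa> * v) \<partial>lborel \<partial>lborel) = (\<integral>\<^sup>+X. ennreal \<bar>\<kappa>\<bar> * (\<integral>\<^sup>+v. f (X, (c2 + A2 * (X - c1) / A1) + \<kappa> * v) \<partial>lborel) \<partial>lborel)"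
    by (rule nn_integral_cmult[symmetric]) measurable
  also have "\<dots> = (\<integral>\<^sup>+X. \<integral>\<^sup>+Y. f (X, Y) \<partial>lborel \<partial>lborel)"
    by (intro nn_integral_cong nn_integral_real_affine[OF _ k0, symmetric]) measurable
  also have "\<dots> = (\<integral>\<^sup>+x. f x \<partial>(lborel \<Otimes>\<^sub>M lborel))"
    by (rule lborel.nn_integral_fst) (simp add: lborel_prod)
  finally have "(\<integral>\<^sup>+x. f x \<partial>lborel) = ennreal \<bar>\<kappa>\<bar> * (ennreal \<bar>A1\<bar> *
      (\<integral>\<^sup>+v. \<integral>\<^sup>+u. f (c1 + u * A1 + v * B1, c2 + u * A2 + v * B2) \<partial>lborel \<partial>lborel))"
    by (simp only: lborel_prod 1)
  then show ?thesis
    unfolding coord by (simp add: k abs_mult ennreal_mult mult_ac)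
qed

lemma borel_measurable_plane_affine:
  "(\<lambda>z::point. c + fst z *\<^sub>R A + snd z *\<^sub>R B :: point) \<in> borel_measurable borel"
  by (intro borel_measurable_continuous_onI continuous_intros)

lemma nn_integral_plane_affine:
  fixes f :: "point \<Rightarrow> ennreal"
  assumes f[measurable]: "f \<in> borel_measurable borel" and D: "cross A B \<noteq> 0"
  shows "(\<integral>\<^sup>+x. f x \<partial>lborel) = ennreal \<bar>cross A B\<bar> * (\<integral>\<^sup>+z. f (c + fst z *\<^sub>R A + snd z *\<^sub>R B) \<partial>lborel)"
proof -
  have m: "(\<lambda>z. f (c + fst z *\<^sub>R A + snd z *\<^sub>R B)) \<in> borel_measurable (lborel \<Otimes>\<^sub>M lborel)"
    by (rule measurable_compose[OF _ f]) (simp add: lborel_prod borel_measurable_plane_affine)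
  have fst: "(\<integral>\<^sup>+u. \<integral>\<^sup>+v. f (c + u *\<^sub>R A + v *\<^sub>R B) \<partial>lborel \<partial>lborel) = (\<integral>\<^sup>+z. f (c + fst z *\<^sub>R A + snd z *\<^sub>R B) \<partial>lborel)"
    using lborel.nn_integral_fst[OF m] unfolding lborel_prod by simp
  have snd: "(\<integral>\<^sup>+v. \<integral>\<^sup>+u. f (c + u *\<^sub>R A + v *\<^sub>R B) \<partial>lborel \<partial>lborel) = (\<integral>\<^sup>+z. f (c + fst z *\<^sub>R A + snd z *\<^sub>R B) \<partial>lborel)"
    using lborel_pair.nn_integral_snd[OF m] unfolding lborel_prod by simp
  show ?thesis
  proof (cases "fst A = 0")
    case False
    then show ?thesis using nn_integral_plane_affine_aux[OF f False D, of c] snd by simp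
  next
    case True
    \<comment> \<open>A nonzero determinant leaves \<open>fst B\<close> as the pivot, and exchanging
      the two directions only changes the sign of the determinant.\<close>
    then have "fst B \<noteq> 0" and D': "cross B A \<noteq> 0" "\<bar>cross B A\<bar> = \<bar>cross A B\<bar>" using D by (auto simp: cross_def mult.commute)
    have "(\<integral>\<^sup>+x. f x \<partial>lborel) = ennreal \<bar>cross B A\<bar> * (\<integral>\<^sup>+u. \<integral>\<^sup>+v. f (c + v *\<^sub>R B + u *\<^sub>R A) \<partial>lborel \<partial>lborel)"
      by (rule nn_integral_plane_affine_aux[OF f \<open>fst B \<noteq> 0\<close> D'(1)])
    also have "(\<integral>\<^sup>+u. \<integral>\<^sup>+v. f (c + v *\<^sub>R B + u *\<^sub>R A) \<partial>lborel \<partial>lborel) = (\<integral>\<^sup>+u. \<integral>\<^sup>+v. f (c + u *\<^sub>R A + v *\<^sub>R B) \<partial>lborel \<partial>lborel)"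
      by (intro nn_integral_cong arg_cong[where f=f]) (simp add: algebra_simps)
    finally show ?thesis using fst D' by simp
  qed
qed

text \<open>As an identity of measures, the substitution rule passes from nonnegative integrands to
  real ones.\<close>

lemma lborel_plane_affine:
  fixes A B c :: point
  assumes D: "cross A B \<noteq> 0"
  defines "T \<equiv> \<lambda>z::point. c + fst z *\<^sub>R A + snd z *\<^sub>R B"
  shows "lborel = density (distr lborel borel T) (\<lambda>_. ennreal \<bar>cross A B\<bar>)"
proof (rule measure_eqI)
  have [measurable]: "T \<in> borel_measurable lborel" by (simp add: T_def borel_measurable_plane_affine)
  fix X :: "point set" assume "X \<in> sets lborel"
  then have [measurable]: "X \<in> sets borel" by simp
  have "emeasure lborel X = (\<integral>\<^sup>+x. indicator X x \<partial>lborel)" by simp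
  also have "\<dots> = ennreal \<bar>cross A B\<bar> * (\<integral>\<^sup>+z. indicator X (T z) \<partial>lborel)"
    unfolding T_def by (rule nn_integral_plane_affine[OF _ D]) measurable
  also have "(\<integral>\<^sup>+z. indicator X (T z) \<partial>lborel) = (\<integral>\<^sup>+x. indicator X x \<partial>distr lborel borel T)"
    by (rule nn_integral_distr[symmetric]) auto
  also have "ennreal \<bar>cross A B\<bar> * \<dots> = emeasure (density (distr lborel borel T) (\<lambda>_. ennreal \<bar>cross A B\<bar>)) X"
    by (simp add: emeasure_density nn_integral_cmult)
  finally show "emeasure lborel X = emeasure (density (distr lborel borel T) (\<lambda>_. ennreal \<bar>cross A B\<bar>)) X" .
qed simp

lemma integral_plane_affine:
  fixes A B c :: point and f :: "point \<Rightarrow> real"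
  assumes D: "cross A B \<noteq> 0" and [measurable]: "f \<in> borel_measurable borel"
  shows "(\<integral>x. f x \<partial>lborel) = \<bar>cross A B\<bar> * (\<integral>z. f (c + fst z *\<^sub>R A + snd z *\<^sub>R B) \<partial>lborel)"
proof -
  have [measurable]: "(\<lambda>z::point. c + fst z *\<^sub>R A + snd z *\<^sub>R B) \<in> borel_measurable lborel"
    by (simp add: borel_measurable_plane_affine)
  show ?thesis
    by (subst lborel_plane_affine[OF D, of c]) (simp add: integral_density integral_distr)
qed

text \<open>The inner products use the completed measure, while Fubini, substitution and the
  fundamental theorem are applied for \<open>lborel\<close>.\<close>

lemma lebesgue_on_integral_lborel:
  fixes f :: "'a::euclidean_space \<Rightarrow> real"
  assumes "compact S" "continuous_on UNIV f"
  shows "(LINT x|lebesgue_on S. f x) = (\<integral>x. f x * indicator S x \<partial>lborel)"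
proof -
  have S: "S \<in> sets borel" using assms(1) by (simp add: borel_compact)
  have f: "f \<in> borel_measurable borel" using assms(2) by (rule borel_measurable_continuous_onI)
  have "(LINT x|lebesgue_on S. f x) = (\<integral>x. indicator S x *\<^sub>R f x \<partial>lebesgue)"
    using S by (subst integral_restrict_space) auto
  also have "\<dots> = (\<integral>x. indicator S x *\<^sub>R f x \<partial>lborel)"
    using S f by (intro integral_completion) (auto intro: borel_measurable_scaleR)
  finally show ?thesis by (simp add: mult.commute)
qed

section \<open>Integration over a reference triangle\<close>

text \<open>With \<open>w = s t\<close> in place of the position \<open>t\<close> on the edge, the
  cone coordinates of \<open>fan\<close> become affine.\<close>

definition ref_triangle :: "point set" where
  "ref_triangle = {(s, w). 0 \<le> w \<and> w \<le> s \<and> s \<le> 1}"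

lemma compact_ref_triangle: "compact ref_triangle"
proof -
  have "ref_triangle = {z. 0 \<le> snd z} \<inter> {z. snd z \<le> fst z} \<inter> {z. fst z \<le> 1}"
    by (auto simp: ref_triangle_def)
  moreover have "closed ({z::point. 0 \<le> snd z} \<inter> {z. snd z \<le> fst z} \<inter> {z. fst z \<le> 1})"
    by (intro closed_Int closed_Collect_le continuous_intros)
  ultimately have "closed ref_triangle" by simp
  moreover have "bounded ref_triangle"
    by (rule bounded_subset[OF bounded_cbox[of "(0, 0)" "(1, 1)"]])
      (auto simp: ref_triangle_def mem_box Basis_prod_def)
  ultimately show ?thesis by (simp add: compact_eq_bounded_closed)
qed

lemma ref_triangle_integrable:
  fixes g :: "point \<Rightarrow> real"
  assumes "continuous_on UNIV g"
  shows "integrable lborel (\<lambda>z. g z * indicator ref_triangle z)"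
  using borel_integrable_compact[OF compact_ref_triangle continuous_on_subset[OF assms subset_UNIV]]
  by (simp add: mult.commute)

lemma ref_triangle_integral_snd:
  fixes q :: "real \<Rightarrow> real \<Rightarrow> real" and g :: "point \<Rightarrow> real"
  assumes g: "continuous_on UNIV g" and q: "\<And>s w. ((\<lambda>w. q s w) has_real_derivative g (s, w)) (at w)"
  shows "(\<integral>z. g z * indicator ref_triangle z \<partial>lborel)
    = (\<integral>s. (q s s - q s 0) * indicator {0..1} s \<partial>lborel)"
proof -
  have cont: "isCont (\<lambda>w. g (s, w)) x" for s x
    by (intro continuous_on_interior[of UNIV] continuous_on_compose2[OF g] continuous_intros) auto
  have "(\<integral>z. g z * indicator ref_triangle z \<partial>lborel)
      = (\<integral>s. \<integral>w. g (s, w) * indicator ref_triangle (s, w) \<partial>lborel \<partial>lborel)"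
    using lborel_pair.integral_fst'[of "\<lambda>z. g z * indicator ref_triangle z"] ref_triangle_integrable[OF g]
    by (simp add: lborel_prod)
  also have "\<dots> = (\<integral>s. (q s s - q s 0) * indicator {0..1} s \<partial>lborel)"
  proof (rule Bochner_Integration.integral_cong[OF refl])
    fix s :: real
    show "(\<integral>w. g (s, w) * indicator ref_triangle (s, w) \<partial>lborel) = (q s s - q s 0) * indicator {0..1} s"
    proof (cases "s \<in> {0..1}")
      case True
      then have "(\<lambda>w. g (s, w) * indicator ref_triangle (s, w)) = (\<lambda>w. g (s, w) * indicator {0..s} w)"
        by (auto simp: ref_triangle_def indicator_def)
      then show ?thesis using True integral_FTC_Icc_real[of 0 s "q s" "\<lambda>w. g (s, w)"] q cont by simp
    next
      case False
      then have "indicator ref_triangle (s, w) = (0::real)" for w by (auto simp: ref_triangle_def indicator_def)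
      then show ?thesis using False by simp
    qed
  qed
  finally show ?thesis .
qed

lemma ref_triangle_integral_fst:
  fixes q :: "real \<Rightarrow> real \<Rightarrow> real" and g :: "point \<Rightarrow> real"
  assumes g: "continuous_on UNIV g" and q: "\<And>s w. ((\<lambda>s. q s w) has_real_derivative g (s, w)) (at s)"
  shows "(\<integral>z. g z * indicator ref_triangle z \<partial>lborel)
    = (\<integral>w. (q 1 w - q w w) * indicator {0..1} w \<partial>lborel)"
proof -
  have cont: "isCont (\<lambda>s. g (s, w)) x" for w x
    by (intro continuous_on_interior[of UNIV] continuous_on_compose2[OF g] continuous_intros) auto
  have "(\<integral>z. g z * indicator ref_triangle z \<partial>lborel)
      = (\<integral>w. \<integral>s. g (s, w) * indicator ref_triangle (s, w) \<partial>lborel \<partial>lborel)"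
    using lborel_pair.integral_snd[of "\<lambda>s w. g (s, w) * indicator ref_triangle (s, w)"] ref_triangle_integrable[OF g]
    by (simp add: lborel_prod case_prod_beta')
  also have "\<dots> = (\<integral>w. (q 1 w - q w w) * indicator {0..1} w \<partial>lborel)"
  proof (rule Bochner_Integration.integral_cong[OF refl])
    fix w :: real
    show "(\<integral>s. g (s, w) * indicator ref_triangle (s, w) \<partial>lborel) = (q 1 w - q w w) * indicator {0..1} w"
    proof (cases "w \<in> {0..1}")
      case True
      then have "(\<lambda>s. g (s, w) * indicator ref_triangle (s, w)) = (\<lambda>s. g (s, w) * indicator {w..1} s)"
        by (auto simp: ref_triangle_def indicator_def)
      then show ?thesis using True integral_FTC_Icc_real[of w 1 "\<lambda>s. q s w" "\<lambda>s. g (s, w)"] q cont by simp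
    next
      case False
      then have "indicator ref_triangle (s, w) = (0::real)" for s by (auto simp: ref_triangle_def indicator_def)
      then show ?thesis using False by simp
    qed
  qed
  finally show ?thesis .
qed

lemma real_polynomial_continuous:
  "real_polynomial_function (p :: point \<Rightarrow> real) \<Longrightarrow> continuous_on S p"
  by (simp add: continuous_on_polymonial_function real_polynomial_function_eq)

text \<open>Taken without the edge length, which in \<open>bip\<close> cancels against the
  normalization of \<open>edge_normal\<close>.\<close>

definition edge_mean :: "(point \<Rightarrow> real) \<Rightarrow> point \<Rightarrow> point \<Rightarrow> real" where
  "edge_mean f a b = (LINT t|lebesgue_on {0..1}. f (linepath a b t))"

section \<open>The divergence theorem on a star-shaped polygon\<close>

context star_polygon
begin

lemma fan_image:
  "fan a b = (\<lambda>z. c + fst z *\<^sub>R (a - c) + snd z *\<^sub>R (b - a)) ` ref_triangle"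
proof
  show "fan a b \<subseteq> (\<lambda>z. c + fst z *\<^sub>R (a - c) + snd z *\<^sub>R (b - a)) ` ref_triangle"
  proof
    fix x assume "x \<in> fan a b"
    then obtain s p where s: "0 \<le> s" "s \<le> 1" "x = c + s *\<^sub>R (p - c)" and "p \<in> closed_segment a b"
      unfolding fan_def by blast
    then obtain t where t: "0 \<le> t" "t \<le> 1" "p = (1 - t) *\<^sub>R a + t *\<^sub>R b" by (auto simp: in_segment)
    have "(s, s * t) \<in> ref_triangle" using s t by (auto simp: ref_triangle_def mult_left_le)
    moreover have "x = c + s *\<^sub>R (a - c) + (s * t) *\<^sub>R (b - a)" by (simp add: s t algebra_simps)
    ultimately show "x \<in> (\<lambda>z. c + fst z *\<^sub>R (a - c) + snd z *\<^sub>R (b - a)) ` ref_triangle"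
      by (intro image_eqI[of _ _ "(s, s * t)"]) auto
  qed
  show "(\<lambda>z. c + fst z *\<^sub>R (a - c) + snd z *\<^sub>R (b - a)) ` ref_triangle \<subseteq> fan a b"
  proof
    fix x assume "x \<in> (\<lambda>z. c + fst z *\<^sub>R (a - c) + snd z *\<^sub>R (b - a)) ` ref_triangle"
    then obtain s w where x: "x = c + s *\<^sub>R (a - c) + w *\<^sub>R (b - a)"
      and w: "0 \<le> w" "w \<le> s" "s \<le> 1" by (auto simp: ref_triangle_def)
    \<comment> \<open>At \<open>s = 0\<close> also \<open>w = 0\<close>, and division by zero yields
      \<open>t = 0\<close>, so \<open>s * t = w\<close> persists.\<close>
    define t where "t = w / s"
    have t: "0 \<le> t" "t \<le> 1" "s * t = w" using w by (auto simp: t_def divide_le_eq)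
    have "(1 - t) *\<^sub>R a + t *\<^sub>R b \<in> closed_segment a b" using t by (auto simp: in_segment)
    moreover have "c + s *\<^sub>R (a - c) + w *\<^sub>R (b - a) = c + s *\<^sub>R ((1 - t) *\<^sub>R a + t *\<^sub>R b - c)"
      unfolding t(3)[symmetric] by (simp add: algebra_simps)
    ultimately show "x \<in> fan a b"
      unfolding fan_def x using w by (intro CollectI exI[of _ s] exI[of _ "(1 - t) *\<^sub>R a + t *\<^sub>R b"]) simp
  qed
qed

lemma compact_fan: "compact (fan a b)"
  unfolding fan_image by (intro compact_continuous_image compact_ref_triangle continuous_intros)

text \<open>The terms over the segments from the center telescope when summed around the polygon.\<close>

lemma fan_integral_derivatives:
  assumes f: "real_polynomial_function f" and D: "cross (a - c) (b - c) \<noteq> 0"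
  defines "s \<equiv> sgn (cross (a - c) (b - c))"
  shows "(LINT x|lebesgue_on (fan a b). dx f x) = s * (snd (b - a) * edge_mean f a b
      - (snd (b - c) * edge_mean f c b - snd (a - c) * edge_mean f c a))"
    and "(LINT x|lebesgue_on (fan a b). dy f x) = s * (- fst (b - a) * edge_mean f a b
      + (fst (b - c) * edge_mean f c b - fst (a - c) * edge_mean f c a))"
proof -
  define A E where "A = a - c" and "E = b - a"
  define T where "T = (\<lambda>z::point. c + fst z *\<^sub>R A + snd z *\<^sub>R E)"
  have DE: "cross (a - c) (b - c) = cross A E" by (simp add: cross_def A_def E_def algebra_simps)
  have D0: "cross A E \<noteq> 0" using D DE by simp
  have contT: "continuous_on UNIV T" unfolding T_def by (intro continuous_intros)
  have injT: "inj T"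
  proof (rule injI)
    fix x y assume "T x = T y"
    then have "fst x * fst A + snd x * fst E = fst y * fst A + snd y * fst E"
      "fst x * snd A + snd x * snd E = fst y * snd A + snd y * snd E" by (auto simp: T_def prod_eq_iff)
    then have "(fst x - fst y) * cross A E = 0" "(snd x - snd y) * cross A E = 0"
      unfolding cross_def by (algebra, algebra)
    then show "x = y" using D0 by (simp add: prod_eq_iff)
  qed
  have fanT: "fan a b = T ` ref_triangle" by (simp add: fan_image T_def A_def E_def)
  define J where "J g = (\<integral>z. g (T z) * indicator ref_triangle z \<partial>lborel)" for g :: "point \<Rightarrow> real"
  have int_fan: "(LINT x|lebesgue_on (fan a b). g x) = \<bar>cross A E\<bar> * J g" if g: "continuous_on UNIV g" for g
  proof -
    have [measurable]: "g \<in> borel_measurable borel" using g by (rule borel_measurable_continuous_onI)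
    have [measurable]: "fan a b \<in> sets borel" by (simp add: borel_compact compact_fan)
    have "(LINT x|lebesgue_on (fan a b). g x) = (\<integral>x. g x * indicator (fan a b) x \<partial>lborel)"
      by (rule lebesgue_on_integral_lborel[OF compact_fan g])
    also have "\<dots> = \<bar>cross A E\<bar> * (\<integral>z. g (T z) * indicator (fan a b) (T z) \<partial>lborel)"
      unfolding T_def by (rule integral_plane_affine[OF D0]) measurable
    also have "(\<lambda>z. g (T z) * indicator (fan a b) (T z)) = (\<lambda>z. g (T z) * indicator ref_triangle z)"
      unfolding fanT using injT by (auto simp: indicator_def inj_image_mem_iff)
    finally show ?thesis by (simp add: J_def)
  qed
  have mean: "edge_mean f x y = (\<integral>t. f (linepath x y t) * indicator {0..1} t \<partial>lborel)" for x y
    unfolding edge_mean_def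
    by (intro lebesgue_on_integral_lborel continuous_on_compose2[OF real_polynomial_continuous[OF f, of UNIV]] continuous_on_linepath) auto
  have int1: "integrable lborel (\<lambda>t. f (linepath x y t) * indicator {0..1} t)" for x y
  proof -
    have "continuous_on {0..1::real} (\<lambda>t. f (linepath x y t))"
      by (intro continuous_on_compose2[OF real_polynomial_continuous[OF f, of UNIV]] continuous_on_linepath) auto
    from borel_integrable_compact[OF compact_Icc this] show ?thesis by (simp add: mult.commute)
  qed
  have der: "((\<lambda>u. f (p u)) has_real_derivative dx f (p u) * v1 + dy f (p u) * v2) (at u)"
    if "(p has_vector_derivative (v1, v2)) (at u)" for p u v1 v2
  proof -
    have "(p has_derivative (\<lambda>h. h *\<^sub>R (v1, v2))) (at u)" using that by (simp add: has_vector_derivative_def)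
    from has_derivative_compose[OF this real_polynomial_has_derivative[OF f]]
    show ?thesis unfolding has_field_derivative_def
      by (rule has_derivative_eq_rhs) (simp add: algebra_simps fun_eq_iff)
  qed
  have cdx: "continuous_on UNIV (dx f)" "continuous_on UNIV (dy f)"
    using real_polynomial_dx[OF f] real_polynomial_dy[OF f] by (auto intro: real_polynomial_continuous)
  note cT = continuous_on_compose2[OF cdx(1) contT] continuous_on_compose2[OF cdx(2) contT]
  define X Y where "X = J (dx f)" and "Y = J (dy f)"
  have lin: "(\<integral>z. (dx f (T z) * v1 + dy f (T z) * v2) * indicator ref_triangle z \<partial>lborel) = X * v1 + Y * v2" for v1 v2
  proof -
    have "(\<lambda>z. (dx f (T z) * v1 + dy f (T z) * v2) * indicator ref_triangle z)
      = (\<lambda>z. v1 * (dx f (T z) * indicator ref_triangle z) + v2 * (dy f (T z) * indicator ref_triangle z))"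
      by (simp add: fun_eq_iff algebra_simps)
    then show ?thesis unfolding X_def Y_def J_def
      using ref_triangle_integrable[OF cT(1)] ref_triangle_integrable[OF cT(2)] by simp
  qed
  \<comment> \<open>Integrating the derivative in direction \<open>A\<close> over \<open>s\<close>
    from \<open>w\<close> to 1 leaves the edge at the upper limit and the segment from
    \<open>c\<close> to \<open>b\<close> at the lower one; \<open>W\<close> does the same in
    direction \<open>E\<close>.\<close>
  have S: "X * fst A + Y * snd A = edge_mean f a b - edge_mean f c b"
  proof -
    have "X * fst A + Y * snd A = (\<integral>w. (f (T (1, w)) - f (T (w, w))) * indicator {0..1} w \<partial>lborel)"
      unfolding lin[symmetric]
    proof (rule ref_triangle_integral_fst)
      show "continuous_on UNIV (\<lambda>z. dx f (T z) * fst A + dy f (T z) * snd A)"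
        by (intro continuous_intros cT) auto
      show "((\<lambda>s. f (T (s, w))) has_real_derivative dx f (T (s, w)) * fst A + dy f (T (s, w)) * snd A) (at s)" for s w
        by (rule der) (auto simp: T_def intro!: derivative_eq_intros)
    qed
    also have "(\<lambda>w. (f (T (1, w)) - f (T (w, w))) * indicator {0..1} w)
      = (\<lambda>w. f (linepath a b w) * indicator {0..1} w - f (linepath c b w) * indicator {0..1} w)"
    proof
      fix w
      have "T (1, w) = linepath a b w" "T (w, w) = linepath c b w"
        by (simp_all add: T_def A_def E_def linepath_def algebra_simps)
      then show "(f (T (1, w)) - f (T (w, w))) * indicator {0..1} w
        = f (linepath a b w) * indicator {0..1} w - f (linepath c b w) * indicator {0..1} w"
        by (simp add: algebra_simps)
    qed
    finally show ?thesis using int1 by (simp add: mean)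
  qed
  have W: "X * fst E + Y * snd E = edge_mean f c b - edge_mean f c a"
  proof -
    have "X * fst E + Y * snd E = (\<integral>s. (f (T (s, s)) - f (T (s, 0))) * indicator {0..1} s \<partial>lborel)"
      unfolding lin[symmetric]
    proof (rule ref_triangle_integral_snd)
      show "continuous_on UNIV (\<lambda>z. dx f (T z) * fst E + dy f (T z) * snd E)"
        by (intro continuous_intros cT) auto
      show "((\<lambda>w. f (T (s, w))) has_real_derivative dx f (T (s, w)) * fst E + dy f (T (s, w)) * snd E) (at w)" for s w
        by (rule der) (auto simp: T_def intro!: derivative_eq_intros)
    qed
    also have "(\<lambda>s. (f (T (s, s)) - f (T (s, 0))) * indicator {0..1} s)
      = (\<lambda>s. f (linepath c b s) * indicator {0..1} s - f (linepath c a s) * indicator {0..1} s)"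
    proof
      fix s
      have "T (s, s) = linepath c b s" "T (s, 0) = linepath c a s"
        by (simp_all add: T_def A_def E_def linepath_def algebra_simps)
      then show "(f (T (s, s)) - f (T (s, 0))) * indicator {0..1} s
        = f (linepath c b s) * indicator {0..1} s - f (linepath c a s) * indicator {0..1} s"
        by (simp add: algebra_simps)
    qed
    finally show ?thesis using int1 by (simp add: mean)
  qed
  have BA: "fst (b - c) = fst A + fst E" "snd (b - c) = snd A + snd E" by (simp_all add: A_def E_def)
  have abs: "\<bar>cross A E\<bar> = s * cross A E" unfolding s_def DE abs_sgn[of "cross A E"] by (rule mult.commute)
  \<comment> \<open>Cramer's rule for the two directional identities \<open>S\<close> and
    \<open>W\<close>. The determinant is also the Jacobian up to the sign \<open>s\<close>, so
    nothing is divided.\<close>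
  have "cross A E * X = snd E * edge_mean f a b - (snd (b - c) * edge_mean f c b - snd A * edge_mean f c a)"
    unfolding BA cross_def using S W by algebra
  then show "(LINT x|lebesgue_on (fan a b). dx f x) = s * (snd (b - a) * edge_mean f a b
      - (snd (b - c) * edge_mean f c b - snd (a - c) * edge_mean f c a))"
    unfolding int_fan[OF cdx(1)] abs X_def[symmetric] by (simp add: A_def E_def mult.assoc)
  have "cross A E * Y = - fst E * edge_mean f a b + (fst (b - c) * edge_mean f c b - fst A * edge_mean f c a)"
    unfolding BA cross_def using S W by algebra
  then show "(LINT x|lebesgue_on (fan a b). dy f x) = s * (- fst (b - a) * edge_mean f a b
      + (fst (b - c) * edge_mean f c b - fst (a - c) * edge_mean f c a))"
    unfolding int_fan[OF cdx(2)] abs Y_def[symmetric] by (simp add: A_def E_def mult.assoc)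
qed

text \<open>Passing through the gauge integral allows a finite union with negligible
  overlaps.\<close>

lemma cell_integral_fans:
  assumes f: "continuous_on UNIV (f :: point \<Rightarrow> real)"
  shows "(LINT x|lebesgue_on (cell K). f x) = (\<Sum>(a, b)\<in>edge_ends K. LINT x|lebesgue_on (fan a b). f x)"
proof -
  have hi: "(f has_integral (LINT x|lebesgue_on S. f x)) S" if "compact S" for S
    using that integrable_lebesgue_on_compact[OF that continuous_on_subset[OF f subset_UNIV]]
    by (intro has_integral_integral_lebesgue_on) (auto simp: lmeasurable_compact fmeasurableD)
  have "(f has_integral (\<Sum>e\<in>edge_ends K. LINT x|lebesgue_on (fan (fst e) (snd e)). f x))
      (\<Union>e\<in>edge_ends K. fan (fst e) (snd e))"
  proof (rule has_integral_UN)
    show "pairwise (\<lambda>i i'. negligible (fan (fst i) (snd i) \<inter> fan (fst i') (snd i'))) (edge_ends K)"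
      unfolding pairwise_def using fan_Int_negligible by (metis prod.collapse)
  qed (auto intro: hi compact_fan)
  moreover have "(\<Union>e\<in>edge_ends K. fan (fst e) (snd e)) = cell K"
    unfolding cell_fans by (simp add: case_prod_beta')
  ultimately show ?thesis
    using has_integral_unique[OF _ hi[OF cell_compact]] by (simp add: case_prod_beta')
qed

text \<open>A segment from the center to a vertex occurs in the two adjacent triangles with opposite
  signs, provided that all triangles carry the same sign \<open>s\<close>; this is where the
  constant orientation enters. What remains are the edge terms with the normal.\<close>

lemma
  assumes f: "real_polynomial_function f"
  shows green_dx: "(LINT x|lebesgue_on (cell K). dx f x) = bip K f (\<lambda>x. fst (outward_normal K x))"
    and green_dy: "(LINT x|lebesgue_on (cell K). dy f x) = bip K f (\<lambda>x. snd (outward_normal K x))"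
proof -
  obtain s where "\<forall>a b. (a, b) \<in> edge_ends K \<longrightarrow> sgn (cross (a - c) (b - c)) = s"
    using orientation_constant by (rule exE)
  then have s: "sgn (cross (a - c) (b - c)) = s" if "(a, b) \<in> edge_ends K" for a b
    using that by (simp del: split_paired_All)
  have cdx: "continuous_on UNIV (dx f)" "continuous_on UNIV (dy f)"
    using real_polynomial_dx[OF f] real_polynomial_dy[OF f] by (auto intro: real_polynomial_continuous)
  have bip: "bip K f (\<lambda>x. l (outward_normal K x)) = (\<Sum>(a, b)\<in>edge_ends K. s * l (perp (b - a)) * edge_mean f a b)"
    if l: "\<And>c x. l (c *\<^sub>R x) = c * l x" for l :: "point \<Rightarrow> real"
  proof -
    have "norm (b - a) * (LINT t|lebesgue_on {0..1}. f (linepath a b t) * l (outward_normal K (linepath a b t)))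
        = s * l (perp (b - a)) * edge_mean f a b" if e: "(a, b) \<in> edge_ends K" for a b
    proof -
      have "(LINT t|lebesgue_on {0..1}. f (linepath a b t) * l (outward_normal K (linepath a b t)))
        = (LINT t|lebesgue_on {0..1}. f (linepath a b t) * l (edge_normal a b))"
        by (rule integral_lebesgue_on_null_cong[OF _ null_endpoints]) (auto simp: outward_normal_linepath[OF e])
      also have "\<dots> = l (edge_normal a b) * edge_mean f a b"
        by (simp add: edge_mean_def mult.commute)
      finally show ?thesis using edge_distinct[OF e] s[OF e] by (simp add: edge_normal_def l)
    qed
    then show ?thesis unfolding bip_def by (intro sum.cong) auto
  qed
  have "(LINT x|lebesgue_on (cell K). dx f x) = (\<Sum>(a, b)\<in>edge_ends K. s * (snd (b - a) * edge_mean f a b)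
      - s * (snd (b - c) * edge_mean f c b - snd (a - c) * edge_mean f c a))"
    unfolding cell_integral_fans[OF cdx(1)]
    by (intro sum.cong refl)
      (auto simp: fan_integral_derivatives[OF f cross_edge_nonzero] s right_diff_distrib)
  also have "\<dots> = (\<Sum>(a, b)\<in>edge_ends K. s * (snd (b - a) * edge_mean f a b))
      - s * (\<Sum>(a, b)\<in>edge_ends K. snd (b - c) * edge_mean f c b - snd (a - c) * edge_mean f c a)"
    by (simp only: case_prod_beta' sum_subtractf flip: sum_distrib_left)
  finally show "(LINT x|lebesgue_on (cell K). dx f x) = bip K f (\<lambda>x. fst (outward_normal K x))"
    using sum_edge_ends[OF polygon, of "\<lambda>v. snd (v - c) * edge_mean f c v"]
    by (subst bip) (auto simp: perp_def mult.assoc)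
  have "(LINT x|lebesgue_on (cell K). dy f x) = (\<Sum>(a, b)\<in>edge_ends K. s * (- fst (b - a) * edge_mean f a b)
      + s * (fst (b - c) * edge_mean f c b - fst (a - c) * edge_mean f c a))"
    unfolding cell_integral_fans[OF cdx(2)]
    by (intro sum.cong refl)
      (auto simp: fan_integral_derivatives[OF f cross_edge_nonzero] s distrib_left)
  also have "\<dots> = (\<Sum>(a, b)\<in>edge_ends K. s * (- fst (b - a) * edge_mean f a b))
      + s * (\<Sum>(a, b)\<in>edge_ends K. fst (b - c) * edge_mean f c b - fst (a - c) * edge_mean f c a)"
    by (simp only: case_prod_beta' sum.distrib sum_distrib_left)
  finally show "(LINT x|lebesgue_on (cell K). dy f x) = bip K f (\<lambda>x. snd (outward_normal K x))"
    using sum_edge_ends[OF polygon, of "\<lambda>v. fst (v - c) * edge_mean f c v"]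
    by (subst bip) (auto simp: perp_def mult.assoc)
qed

end

section \<open>The local problems\<close>

text \<open>Makes the mixed terms cancel when a gradient and a curl built from one potential are
  added.\<close>

lemma real_polynomial_mixed:
  fixes u :: "point \<Rightarrow> real"
  assumes "real_polynomial_function u"
  shows "dy (dx u) x = dx (dy u) x"
  using assms
proof (induction arbitrary: x rule: real_polynomial_function.induct)
  case (linear f)
  have "(f has_derivative (\<lambda>h. f (1, 0) * fst h + f (0, 1) * snd h)) (at x)" for x
    by (rule has_derivative_eq_rhs[OF bounded_linear_imp_has_derivative[OF linear] bounded_linear_plane[OF linear]])
  then have "dx f = (\<lambda>_. f (1, 0))" "dy f = (\<lambda>_. f (0, 1))" using dx_eq by blast+
  then show ?case by (simp add: dx_def dy_def)
next
  case (const c)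
  have "dx (\<lambda>_. c) = (\<lambda>_. 0)" "dy (\<lambda>_. c) = (\<lambda>_. 0)" by (simp_all add: dx_def dy_def fun_eq_iff)
  then show ?case by (simp add: dx_def dy_def)
next
  case (add f g)
  have "dx (\<lambda>x. f x + g x) = (\<lambda>x. dx f x + dx g x)" "dy (\<lambda>x. f x + g x) = (\<lambda>x. dy f x + dy g x)"
    by (auto simp only: fun_eq_iff dx_add[OF add.hyps] dy_add[OF add.hyps])
  then show ?case using add by (simp add: dx_add dy_add real_polynomial_dx real_polynomial_dy)
next
  case (mult f g)
  have 1: "dx (\<lambda>x. f x * g x) = (\<lambda>x. dx f x * g x + f x * dx g x)"
    "dy (\<lambda>x. f x * g x) = (\<lambda>x. dy f x * g x + f x * dy g x)"
    by (auto simp only: fun_eq_iff dx_mult[OF mult.hyps] dy_mult[OF mult.hyps])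
  note P = mult.hyps real_polynomial_dx[OF mult.hyps(1)] real_polynomial_dx[OF mult.hyps(2)]
    real_polynomial_dy[OF mult.hyps(1)] real_polynomial_dy[OF mult.hyps(2)]
  note M = real_polynomial_function.intros(4)
  show ?case unfolding 1
    by (simp add: dx_add dy_add dx_mult dy_mult P M mult.IH algebra_simps)
qed

text \<open>With \<open>\<Delta>u = m\<close>, take the first potentials \<open>(u\<^sub>x, u\<^sub>y)\<close> and the second ones \<open>(u\<^sub>y, - u\<^sub>x)\<close>.\<close>

lemma polynomial_helmholtz:
  fixes m :: "point \<Rightarrow> real"
  assumes "real_polynomial_function m"
  shows "\<exists>\<phi> \<psi>. real_polynomial_function \<phi> \<and> real_polynomial_function \<psi> \<and> (\<forall>x. (m x, 0) = grad \<phi> x + curl \<psi> x)"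
    and "\<exists>\<phi> \<psi>. real_polynomial_function \<phi> \<and> real_polynomial_function \<psi> \<and> (\<forall>x. (0, m x) = grad \<phi> x + curl \<psi> x)"
proof -
  obtain u where u: "real_polynomial_function u" "\<And>z. dx (dx u) z + dy (dy u) z = m z"
    using real_polynomial_laplacian_ex[OF assms] by blast
  note P = real_polynomial_dx[OF u(1)] real_polynomial_dy[OF u(1)]
  define v where "v = (\<lambda>x. (-1) * dx u x)"
  have v: "real_polynomial_function v" unfolding v_def by (intro real_polynomial_function.intros(2-4) P)
  have "dx v x = - dx (dx u) x" "dy v x = - dy (dx u) x" for x
    unfolding v_def by (simp_all only: dx_cmult[OF P(1)] dy_cmult[OF P(1)])
  then have "(m x, 0) = grad (dx u) x + curl (dy u) x" "(0, m x) = grad (dy u) x + curl v x" for x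
    using u(2)[of x] real_polynomial_mixed[OF u(1), of x] by (simp_all add: grad_def curl_def)
  then show "\<exists>\<phi> \<psi>. real_polynomial_function \<phi> \<and> real_polynomial_function \<psi> \<and> (\<forall>x. (m x, 0) = grad \<phi> x + curl \<psi> x)"
    "\<exists>\<phi> \<psi>. real_polynomial_function \<phi> \<and> real_polynomial_function \<psi> \<and> (\<forall>x. (0, m x) = grad \<phi> x + curl \<psi> x)"
    using P v by blast+
qed

lemma L2_inner_const:
  fixes f :: "'a::euclidean_space \<Rightarrow> 'b::euclidean_space"
  assumes "f \<in> L2 A"
  shows "(\<lambda>x. f x \<bullet> v) \<in> L2 A"
proof -
  have m[measurable]: "f \<in> borel_measurable (lebesgue_on A)"
    and i: "integrable (lebesgue_on A) (\<lambda>x. (norm (f x))\<^sup>2)"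
    using assms by (auto simp: L2_def)
  have "integrable (lebesgue_on A) (\<lambda>x. (norm (f x \<bullet> v))\<^sup>2)"
  proof (rule Bochner_Integration.integrable_bound)
    show "integrable (lebesgue_on A) (\<lambda>x. (norm v)\<^sup>2 * (norm (f x))\<^sup>2)" using i by simp
    show "AE x in lebesgue_on A. norm ((norm (f x \<bullet> v))\<^sup>2) \<le> norm ((norm v)\<^sup>2 * (norm (f x))\<^sup>2)"
    proof (rule AE_I2)
      fix x
      have "(norm (f x \<bullet> v))\<^sup>2 \<le> (norm (f x) * norm v)\<^sup>2"
        using Cauchy_Schwarz_ineq2[of "f x" v] by (intro power_mono) auto
      then show "norm ((norm (f x \<bullet> v))\<^sup>2) \<le> norm ((norm v)\<^sup>2 * (norm (f x))\<^sup>2)"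
        by (simp add: power_mult_distrib mult.commute)
    qed
  qed measurable
  then show ?thesis by (simp add: L2_def)
qed

text \<open>The outward normal is constant only on relative interiors of edges; \<open>h\<close> is
  a representative on each closed edge, which may differ from edge to edge.\<close>

lemma L2_bdry_edgewise:
  fixes g :: "point \<Rightarrow> 'b::euclidean_space"
  assumes "\<And>a b. (a, b) \<in> edge_ends K \<Longrightarrow> h a b \<in> L2 {0..1}"
    and "\<And>a b t. (a, b) \<in> edge_ends K \<Longrightarrow> 0 < t \<Longrightarrow> t < 1 \<Longrightarrow> g (linepath a b t) = h a b t"
  shows "g \<in> L2_bdry K"
  unfolding L2_bdry_def
proof (clarify)
  fix a b assume e: "(a, b) \<in> edge_ends K"
  show "(\<lambda>t. g (linepath a b t)) \<in> L2 {0..1}"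
    by (rule L2_null_cong[OF _ null_endpoints _ assms(1)[OF e]]) (use assms(2)[OF e] in auto)
qed

lemma vpolys_real_polynomial:
  assumes "U \<in> vpolys k"
  shows "real_polynomial_function (\<lambda>x. fst (U x))" "real_polynomial_function (\<lambda>x. snd (U x))"
  using assms by (auto simp: vpolys_def polys_real_polynomial)

lemma vpolys_continuous:
  assumes "U \<in> vpolys k"
  shows "continuous_on S U"
proof -
  have "continuous_on S (\<lambda>x. (fst (U x), snd (U x)))"
    by (intro continuous_on_Pair real_polynomial_continuous vpolys_real_polynomial[OF assms])
  then show ?thesis by simp
qed

lemma polys_continuous: "p \<in> polys k \<Longrightarrow> continuous_on S p"
  by (rule real_polynomial_continuous[OF polys_real_polynomial])

lemma curl_comb:
  assumes "real_polynomial_function p" "real_polynomial_function q"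
  shows "curl (\<lambda>x. p x + c * q x) = (\<lambda>x. curl p x + c *\<^sub>R curl q x)"
    and "grad (\<lambda>x. p x + c * q x) = (\<lambda>x. grad p x + c *\<^sub>R grad q x)"
proof -
  have "real_polynomial_function (\<lambda>x. c * q x)" by (intro real_polynomial_function.intros(2-4) assms)
  then show "curl (\<lambda>x. p x + c * q x) = (\<lambda>x. curl p x + c *\<^sub>R curl q x)"
    "grad (\<lambda>x. p x + c * q x) = (\<lambda>x. grad p x + c *\<^sub>R grad q x)"
    by (simp_all only: curl_def grad_def fun_eq_iff dx_add[OF assms(1)] dy_add[OF assms(1)] dx_cmult[OF assms(2)] dy_cmult[OF assms(2)]) simp_all
qed

lemma curl_continuous:
  assumes "real_polynomial_function p"
  shows "continuous_on S (curl p)" "continuous_on S (grad p)"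
proof -
  have c: "continuous_on S (dx p)" "continuous_on S (dy p)"
    using real_polynomial_dx[OF assms] real_polynomial_dy[OF assms] by (auto intro: real_polynomial_continuous)
  have "continuous_on S (\<lambda>x. (dy p x, - dx p x))" "continuous_on S (\<lambda>x. (dx p x, dy p x))"
    by (intro continuous_intros c)+
  then show "continuous_on S (curl p)" "continuous_on S (grad p)"
    by (simp_all add: curl_def[abs_def] grad_def[abs_def])
qed

lemma rot_vpolys: "U \<in> vpolys k \<Longrightarrow> rot U \<in> polys k" and divg_vpolys: "U \<in> vpolys k \<Longrightarrow> divg U \<in> polys k"
proof -
  assume "U \<in> vpolys k"
  then have "(\<lambda>x. dx (\<lambda>q. snd (U q)) x + (-1) * dy (\<lambda>q. fst (U q)) x) \<in> polys k"
    "(\<lambda>x. dx (\<lambda>q. fst (U q)) x + 1 * dy (\<lambda>q. snd (U q)) x) \<in> polys k"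
    by (intro polys_comb dx_polys dy_polys; simp add: vpolys_def)+
  then show "rot U \<in> polys k" "divg U \<in> polys k" by (simp_all add: rot_def[abs_def] divg_def[abs_def])
qed

text \<open>Covers both local problems: the first has \<open>g = 0\<close>, the second \<open>\<eta>t = \<eta>n = 0\<close>.\<close>

definition local_problem ::
  "nat \<Rightarrow> real \<Rightarrow> real \<Rightarrow> element \<Rightarrow> (point \<Rightarrow> point) \<Rightarrow> (point \<Rightarrow> point) \<Rightarrow> (point \<Rightarrow> point) \<Rightarrow>
   (point \<Rightarrow> real) \<times> (point \<Rightarrow> real) \<times> (point \<Rightarrow> point) \<Rightarrow> bool" where
  "local_problem k \<alpha> \<tau> K \<eta>t \<eta>n g = (\<lambda>(S, P, U).
    S \<in> polys k \<and> P \<in> polys k \<and> U \<in> vpolys k \<and>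
    (\<forall>\<xi>\<in>polys k.
       ip K S \<xi> - ip K U (curl \<xi>) + bip K (tangential K \<eta>t) \<xi> = 0) \<and>
    (\<forall>\<psi>\<in>polys k.
       ip K P \<psi> - ip K U (grad \<psi>) + bip K (normal_comp K \<eta>n) \<psi> = 0) \<and>
    (\<forall>z\<in>vpolys k.
       ip K S (rot z) + bip K (check_trace \<alpha> K S U \<eta>t) (tangential K z)
       - ip K P (divg z) + bip K (hat_trace \<tau> K P U \<eta>n) (normal_comp K z) = ip K g z))"

lemma local_problem_trace_eq:
  "local_problem_trace k \<alpha> \<tau> K \<eta>t \<eta>n = local_problem k \<alpha> \<tau> K \<eta>t \<eta>n (\<lambda>_. 0)"
  by (simp add: local_problem_trace_def local_problem_def ip_zero_left)

lemma local_problem_source_eq: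
  "local_problem_source k \<alpha> \<tau> K g = local_problem k \<alpha> \<tau> K (\<lambda>_. 0) (\<lambda>_. 0) g"
  by (simp add: local_problem_source_def local_problem_def bip_zero_left)

section \<open>Integration by parts and vanishing fields\<close>

context star_polygon
begin

lemma polys_L2: "p \<in> polys k \<Longrightarrow> p \<in> L2 (cell K)"
  by (intro L2_continuous cell_compact polys_continuous)

lemma vpolys_L2: "U \<in> vpolys k \<Longrightarrow> U \<in> L2 (cell K)"
  by (intro L2_continuous cell_compact vpolys_continuous)

lemma curl_L2: "real_polynomial_function p \<Longrightarrow> curl p \<in> L2 (cell K)"
  and grad_L2: "real_polynomial_function p \<Longrightarrow> grad p \<in> L2 (cell K)"
  by (auto intro: L2_continuous cell_compact curl_continuous)

lemma polys_L2_bdry: "p \<in> polys k \<Longrightarrow> p \<in> L2_bdry K"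
  by (intro L2_bdry_continuous polys_continuous)

lemma vpolys_L2_bdry: "U \<in> vpolys k \<Longrightarrow> U \<in> L2_bdry K"
  by (intro L2_bdry_continuous vpolys_continuous)

lemma tangential_L2_bdry:
  assumes "z \<in> L2_bdry K"
  shows "tangential K z \<in> L2_bdry K" "normal_comp K z \<in> L2_bdry K"
proof -
  have z: "(\<lambda>t. z (linepath a b t)) \<in> L2 {0..1}" if "(a, b) \<in> edge_ends K" for a b
    using assms that by (auto simp: L2_bdry_def)
  show "tangential K z \<in> L2_bdry K"
    by (rule L2_bdry_edgewise[where h = "\<lambda>a b t. z (linepath a b t) \<bullet> perp (edge_normal a b)"])
      (auto intro: L2_inner_const z simp: outward_normal_linepath)
  show "normal_comp K z \<in> L2_bdry K"
    by (rule L2_bdry_edgewise[where h = "\<lambda>a b t. z (linepath a b t) \<bullet> edge_normal a b"])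
      (auto intro: L2_inner_const z simp: outward_normal_linepath)
qed

lemma normal_mult_L2_bdry:
  assumes "continuous_on UNIV g"
  shows "(\<lambda>x. g x * fst (outward_normal K x)) \<in> L2_bdry K" "(\<lambda>x. g x * snd (outward_normal K x)) \<in> L2_bdry K"
proof -
  have g: "continuous_on {0..1} (\<lambda>t. g (linepath a b t))" for a b
    by (intro continuous_on_compose2[OF assms] continuous_on_linepath) auto
  show "(\<lambda>x. g x * fst (outward_normal K x)) \<in> L2_bdry K"
    by (rule L2_bdry_edgewise[where h = "\<lambda>a b t. g (linepath a b t) * fst (edge_normal a b)"])
      (auto intro!: L2_continuous continuous_intros g simp: outward_normal_linepath)
  show "(\<lambda>x. g x * snd (outward_normal K x)) \<in> L2_bdry K"
    by (rule L2_bdry_edgewise[where h = "\<lambda>a b t. g (linepath a b t) * snd (edge_normal a b)"])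
      (auto intro!: L2_continuous continuous_intros g simp: outward_normal_linepath)
qed

lemma ibp_aux:
  assumes S: "real_polynomial_function S" and V: "real_polynomial_function V"
  shows "(LINT x|lebesgue_on (cell K). dx S x * V x + S x * dx V x) = bip K S (\<lambda>x. V x * fst (outward_normal K x))"
    and "(LINT x|lebesgue_on (cell K). dy S x * V x + S x * dy V x) = bip K S (\<lambda>x. V x * snd (outward_normal K x))"
proof -
  have SV: "real_polynomial_function (\<lambda>x. S x * V x)" by (intro real_polynomial_function.intros(4) S V)
  have "dx (\<lambda>x. S x * V x) = (\<lambda>x. dx S x * V x + S x * dx V x)" "dy (\<lambda>x. S x * V x) = (\<lambda>x. dy S x * V x + S x * dy V x)"
    by (auto simp only: fun_eq_iff dx_mult[OF S V] dy_mult[OF S V])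
  then show "(LINT x|lebesgue_on (cell K). dx S x * V x + S x * dx V x) = bip K S (\<lambda>x. V x * fst (outward_normal K x))"
    "(LINT x|lebesgue_on (cell K). dy S x * V x + S x * dy V x) = bip K S (\<lambda>x. V x * snd (outward_normal K x))"
    using green_dx[OF SV] green_dy[OF SV] by (auto simp: bip_def mult.assoc)
qed

text \<open>The divergence theorem for the products of \<open>S\<close> with the components of
  \<open>U\<close>. The degree of \<open>S\<close> is unrestricted, as required for the Helmholtz
  potentials.\<close>

lemma
  assumes S: "real_polynomial_function S" and U: "U \<in> vpolys k"
  shows ibp_curl: "ip K U (curl S) = ip K S (rot U) + bip K S (tangential K U)"
    and ibp_grad: "ip K U (grad S) = - ip K S (divg U) + bip K S (normal_comp K U)"
proof -
  define U1 U2 where "U1 = (\<lambda>x. fst (U x))" and "U2 = (\<lambda>x. snd (U x))"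
  have U12: "real_polynomial_function U1" "real_polynomial_function U2"
    using vpolys_real_polynomial[OF U] by (auto simp: U1_def U2_def)
  have SL: "S \<in> L2_bdry K" by (intro L2_bdry_continuous real_polynomial_continuous S)
  have cU: "continuous_on UNIV U1" "continuous_on UNIV U2" using U12 by (auto intro: real_polynomial_continuous)
  have int: "integrable (lebesgue_on (cell K)) p" if "real_polynomial_function p" for p
    using that by (intro integrable_lebesgue_on_compact cell_compact real_polynomial_continuous)
  note P = S U12 real_polynomial_dx[OF S] real_polynomial_dy[OF S]
    real_polynomial_dx[OF U12(1)] real_polynomial_dx[OF U12(2)] real_polynomial_dy[OF U12(1)] real_polynomial_dy[OF U12(2)]
  note I = real_polynomial_function.intros(3,4)
  have i: "integrable (lebesgue_on (cell K)) (\<lambda>x. dx S x * V x + S x * dx V x)"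
      "integrable (lebesgue_on (cell K)) (\<lambda>x. dy S x * V x + S x * dy V x)"
    if "real_polynomial_function V" for V
    by (intro int I real_polynomial_dx real_polynomial_dy S that)+
  have ip1: "integrable (lebesgue_on (cell K)) (\<lambda>x. S x * rot U x)"
    "integrable (lebesgue_on (cell K)) (\<lambda>x. S x * divg U x)"
    by (intro int I S polys_real_polynomial[OF rot_vpolys[OF U]] polys_real_polynomial[OF divg_vpolys[OF U]])+
  have "ip K U (curl S) = (LINT x|lebesgue_on (cell K). S x * rot U x
      + ((dy S x * U1 x + S x * dy U1 x) - (dx S x * U2 x + S x * dx U2 x)))"
    unfolding ip_def
    by (intro Bochner_Integration.integral_cong)
      (auto simp: curl_def rot_def inner_prod_def U1_def U2_def algebra_simps)
  also have "\<dots> = ip K S (rot U) + (bip K S (\<lambda>x. U1 x * snd (outward_normal K x)) - bip K S (\<lambda>x. U2 x * fst (outward_normal K x)))"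
    using ip1 i[OF U12(1)] i[OF U12(2)] by (simp add: ip_def ibp_aux[OF S U12(1)] ibp_aux[OF S U12(2)])
  also have "bip K S (\<lambda>x. U1 x * snd (outward_normal K x)) - bip K S (\<lambda>x. U2 x * fst (outward_normal K x))
    = bip K S (tangential K U)"
    using bip_comb_right[OF normal_mult_L2_bdry(2)[OF cU(1)] normal_mult_L2_bdry(1)[OF cU(2)] SL, of "-1"]
    by (simp add: U1_def U2_def perp_def inner_prod_def)
  finally show "ip K U (curl S) = ip K S (rot U) + bip K S (tangential K U)" .
  have "ip K U (grad S) = (LINT x|lebesgue_on (cell K). 
      ((dx S x * U1 x + S x * dx U1 x) + (dy S x * U2 x + S x * dy U2 x)) - S x * divg U x)"
    unfolding ip_def
    by (intro Bochner_Integration.integral_cong)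
      (auto simp: grad_def divg_def inner_prod_def U1_def U2_def algebra_simps)
  also have "\<dots> = - ip K S (divg U) + (bip K S (\<lambda>x. U1 x * fst (outward_normal K x)) + bip K S (\<lambda>x. U2 x * snd (outward_normal K x)))"
    using ip1 i[OF U12(1)] i[OF U12(2)] by (simp add: ip_def ibp_aux[OF S U12(1)] ibp_aux[OF S U12(2)])
  also have "bip K S (\<lambda>x. U1 x * fst (outward_normal K x)) + bip K S (\<lambda>x. U2 x * snd (outward_normal K x))
    = bip K S (normal_comp K U)"
    using bip_comb_right[OF normal_mult_L2_bdry(1)[OF cU(1)] normal_mult_L2_bdry(2)[OF cU(2)] SL, of "1"]
    by (simp add: U1_def U2_def inner_prod_def)
  finally show "ip K U (grad S) = - ip K S (divg U) + bip K S (normal_comp K U)" .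
qed

lemma polys_ip_definite:
  assumes p: "p \<in> polys k" and z: "ip K p p = 0"
  shows "p = (\<lambda>_. 0)"
proof -
  obtain x where x: "x \<in> interior (cell K)" using interior_ne by blast
  have "p y * p y = 0" if y: "y \<in> interior (cell K)" for y
    by (rule continuous_integral_zero[OF cell_compact _ _ _ y])
      (use z in \<open>auto simp: ip_def intro!: continuous_intros polys_continuous[OF p]\<close>)
  then show ?thesis using polys_vanish_open[OF p open_interior x] by simp
qed

lemma polys_riesz:
  assumes L: "\<And>p q c. p \<in> polys k \<Longrightarrow> q \<in> polys k \<Longrightarrow> L (\<lambda>x. p x + c * q x) = L p + c * L q"
  shows "\<exists>v\<in>polys k. \<forall>w\<in>polys k. ip K v w = L w"
proof (rule finite_riesz[where D = "{..k} \<times> {..k}" and z = "\<lambda>_. 0" and cb = "\<lambda>p c q x. p x + c * q x"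
      and ev = "\<lambda>(i, j) p. p (real i, real j)"])
  show "ip K (\<lambda>x. p x + c * q x) z = ip K p z + c * ip K q z" if "p \<in> polys k" "q \<in> polys k" "z \<in> polys k" for p q z c
    using ip_comb_left[OF polys_L2[OF that(1)] polys_L2[OF that(2)] polys_L2[OF that(3)], of c] by simp
  show "w = (\<lambda>_. 0)" if "w \<in> polys k" "\<forall>d\<in>{..k} \<times> {..k}. (case d of (i, j) \<Rightarrow> \<lambda>p. p (real i, real j)) w = 0" for w
    using that by (intro polys_vanish_grid) auto
qed (auto intro: polys_zero polys_comb L polys_ip_definite ip_commute)

lemma polys_ip_unique:
  assumes "p \<in> polys k" "q \<in> polys k" "\<And>w. w \<in> polys k \<Longrightarrow> ip K p w = ip K q w"
  shows "p = q"
proof -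
  have pq: "(\<lambda>x. p x + (-1) * q x) \<in> polys k" by (intro polys_comb assms)
  have "ip K (\<lambda>x. p x + (-1) *\<^sub>R q x) (\<lambda>x. p x + (-1) * q x) = 0"
    using ip_comb_left[OF polys_L2[OF assms(1)] polys_L2[OF assms(2)] polys_L2[OF pq], of "-1"] assms(3)[OF pq] by simp
  then have "(\<lambda>x. p x + (-1) * q x) = (\<lambda>_. 0)" by (intro polys_ip_definite[OF pq]) simp
  then show ?thesis by (simp add: fun_eq_iff)
qed

text \<open>The test fields \<open>(m, 0)\<close> and \<open>(0, m)\<close> are sums of a gradient
  and a curl.\<close>

lemma zero_moments:
  assumes U: "U \<in> vpolys k" and m: "real_polynomial_function m"
    and c: "\<And>\<phi>. real_polynomial_function \<phi> \<Longrightarrow> ip K U (curl \<phi>) = 0"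
    and g: "\<And>\<phi>. real_polynomial_function \<phi> \<Longrightarrow> ip K U (grad \<phi>) = 0"
  shows "ip K (\<lambda>x. fst (U x)) m = 0" "ip K (\<lambda>x. snd (U x)) m = 0"
proof -
  obtain \<phi> \<psi> where p: "real_polynomial_function \<phi>" "real_polynomial_function \<psi>"
    and eq: "\<forall>x. (m x, 0) = grad \<phi> x + curl \<psi> x"
    using polynomial_helmholtz(1)[OF m] by blast
  obtain \<phi>' \<psi>' where p': "real_polynomial_function \<phi>'" "real_polynomial_function \<psi>'"
    and eq': "\<forall>x. (0, m x) = grad \<phi>' x + curl \<psi>' x"
    using polynomial_helmholtz(2)[OF m] by blast
  have "ip K (\<lambda>x. fst (U x)) m = ip K U (\<lambda>x. (m x, 0))" "ip K (\<lambda>x. snd (U x)) m = ip K U (\<lambda>x. (0, m x))"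
    by (simp_all add: ip_def inner_prod_def)
  then show "ip K (\<lambda>x. fst (U x)) m = 0" "ip K (\<lambda>x. snd (U x)) m = 0"
    using ip_comb_right[OF grad_L2[OF p(1)] curl_L2[OF p(2)] vpolys_L2[OF U], of 1]
      ip_comb_right[OF grad_L2[OF p'(1)] curl_L2[OF p'(2)] vpolys_L2[OF U], of 1]
    by (simp_all add: eq eq' c g p p' del: split_paired_All)
qed

text \<open>\<open>rot U\<close> and \<open>divg U\<close> are of degree at most \<open>k\<close>
  and thus admissible tests. In integration by parts against them the boundary terms match the
  assumed ones, leaving their squared norms equal to zero.\<close>

lemma div_rot_zero:
  assumes U: "U \<in> vpolys k"
    and c: "\<And>\<xi>. \<xi> \<in> polys k \<Longrightarrow> ip K U (curl \<xi>) = bip K (tangential K U) \<xi>"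
    and g: "\<And>\<xi>. \<xi> \<in> polys k \<Longrightarrow> ip K U (grad \<xi>) = bip K (normal_comp K U) \<xi>"
  shows "rot U = (\<lambda>_. 0)" "divg U = (\<lambda>_. 0)"
proof -
  note R = rot_vpolys[OF U] divg_vpolys[OF U]
  have "ip K (rot U) (rot U) = 0"
    using ibp_curl[OF polys_real_polynomial[OF R(1)] U] c[OF R(1)] by (simp add: bip_commute)
  then show "rot U = (\<lambda>_. 0)" by (rule polys_ip_definite[OF R(1)])
  have "ip K (divg U) (divg U) = 0"
    using ibp_grad[OF polys_real_polynomial[OF R(2)] U] g[OF R(2)] by (simp add: bip_commute)
  then show "divg U = (\<lambda>_. 0)" by (rule polys_ip_definite[OF R(2)])
qed

lemma bip_zero_edge:
  assumes "g \<in> vpolys k" "bip K (tangential K g) (tangential K g) = 0" "(a, b) \<in> edge_ends K" "0 < t" "t < 1"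
  shows "tangential K g (linepath a b t) = 0"
proof (rule bip_eq_zeroD[OF assms(2,3) _ _ _ assms(4,5)])
  show "a \<noteq> b" using edge_distinct[OF assms(3)] by simp
  show "continuous_on {0..1} (\<lambda>t. g (linepath a b t) \<bullet> perp (edge_normal a b))"
    by (intro continuous_intros continuous_on_compose2[OF vpolys_continuous[OF assms(1), of UNIV]] continuous_on_linepath) auto
qed (simp add: outward_normal_linepath[OF assms(3)])

lemma bip_zero_edge_normal:
  assumes "g \<in> vpolys k" "bip K (normal_comp K g) (normal_comp K g) = 0" "(a, b) \<in> edge_ends K" "0 < t" "t < 1"
  shows "normal_comp K g (linepath a b t) = 0"
proof (rule bip_eq_zeroD[OF assms(2,3) _ _ _ assms(4,5)])
  show "a \<noteq> b" using edge_distinct[OF assms(3)] by simp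
  show "continuous_on {0..1} (\<lambda>t. g (linepath a b t) \<bullet> edge_normal a b)"
    by (intro continuous_intros continuous_on_compose2[OF vpolys_continuous[OF assms(1), of UNIV]] continuous_on_linepath) auto
qed (simp add: outward_normal_linepath[OF assms(3)])

text \<open>Vanishing boundary components remove the boundary pairings, hence rotation and
  divergence vanish. Integration by parts then extends the orthogonality from potentials of degree
  \<open>k\<close> to all degrees, and \<open>U\<close> is orthogonal to its own components.\<close>

lemma field_zero:
  assumes U: "U \<in> vpolys k"
    and c: "\<And>\<xi>. \<xi> \<in> polys k \<Longrightarrow> ip K U (curl \<xi>) = 0"
    and g: "\<And>\<xi>. \<xi> \<in> polys k \<Longrightarrow> ip K U (grad \<xi>) = 0"
    and t: "bip K (tangential K U) (tangential K U) = 0" and n: "bip K (normal_comp K U) (normal_comp K U) = 0"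
  shows "U = (\<lambda>_. 0)"
proof -
  have bt: "bip K (tangential K U) \<phi> = 0" for \<phi>
    using bip_cong[of K "tangential K U" \<phi> "\<lambda>_. 0" \<phi>] bip_zero_edge[OF U t] by (simp add: bip_zero_left)
  have bn: "bip K (normal_comp K U) \<phi> = 0" for \<phi>
    using bip_cong[of K "normal_comp K U" \<phi> "\<lambda>_. 0" \<phi>] bip_zero_edge_normal[OF U n] by (simp add: bip_zero_left)
  have rd: "rot U = (\<lambda>_. 0)" "divg U = (\<lambda>_. 0)"
    using div_rot_zero[OF U] c g bt bn by auto
  have "ip K U (curl \<phi>) = 0" "ip K U (grad \<phi>) = 0" if "real_polynomial_function \<phi>" for \<phi>
    using ibp_curl[OF that U] ibp_grad[OF that U] bt bn
    by (simp_all add: rd ip_zero_right bip_commute[of K \<phi>])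
  note z = zero_moments[OF U _ this]
  have U12: "(\<lambda>x. fst (U x)) \<in> polys k" "(\<lambda>x. snd (U x)) \<in> polys k" using U by (auto simp: vpolys_def)
  have "(\<lambda>x. fst (U x)) = (\<lambda>_. 0)" "(\<lambda>x. snd (U x)) = (\<lambda>_. 0)"
    using z vpolys_real_polynomial[OF U] U12 by (auto intro: polys_ip_definite)
  then show ?thesis by (simp add: fun_eq_iff prod_eq_iff)
qed

lemma tangential_diff: "tangential K (\<lambda>y. U y - V y) = (\<lambda>x. tangential K U x + (-1) * tangential K V x)"
  and normal_comp_diff: "normal_comp K (\<lambda>y. U y - V y) = (\<lambda>x. normal_comp K U x + (-1) * normal_comp K V x)"
  by (simp_all add: inner_diff_left)

lemma tangential_comb: "tangential K (\<lambda>y. U y + d *\<^sub>R V y) = (\<lambda>x. tangential K U x + d * tangential K V x)"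
  and normal_comp_comb: "normal_comp K (\<lambda>y. U y + d *\<^sub>R V y) = (\<lambda>x. normal_comp K U x + d * normal_comp K V x)"
  by (simp_all add: inner_add_left)

lemma
  assumes S: "S \<in> polys k" and U: "U \<in> L2_bdry K" and \<eta>: "\<eta> \<in> L2_bdry K" and h: "h \<in> L2_bdry K"
  shows bip_check: "bip K (check_trace \<alpha> K S U \<eta>) h
      = bip K S h + inverse \<alpha> * bip K (tangential K (\<lambda>y. U y - \<eta> y)) h"
    and bip_hat: "bip K (hat_trace \<tau> K S U \<eta>) h
      = bip K S h + inverse \<tau> * bip K (normal_comp K (\<lambda>y. U y - \<eta> y)) h"
proof -
  have "(\<lambda>y. U y - \<eta> y) \<in> L2_bdry K" using L2_bdry_comb[OF U \<eta>, of "-1"] by simp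
  note T = tangential_L2_bdry[OF this]
  show "bip K (check_trace \<alpha> K S U \<eta>) h = bip K S h + inverse \<alpha> * bip K (tangential K (\<lambda>y. U y - \<eta> y)) h"
    unfolding check_trace_def by (rule bip_comb_left[OF polys_L2_bdry[OF S] T(1) h])
  show "bip K (hat_trace \<tau> K S U \<eta>) h = bip K S h + inverse \<tau> * bip K (normal_comp K (\<lambda>y. U y - \<eta> y)) h"
    unfolding hat_trace_def by (rule bip_comb_left[OF polys_L2_bdry[OF S] T(2) h])
qed

section \<open>Reciprocity and unique solvability of the local problems\<close>

text \<open>After integration by parts the coupling terms are those of the first two equations with
  the roles of test and trial function exchanged; this is the hidden symmetry of the system.\<close>

lemma third_form:
  assumes "S \<in> polys k" "P \<in> polys k" "U \<in> vpolys k" "z \<in> vpolys k" "\<eta>t \<in> L2_bdry K" "\<eta>n \<in> L2_bdry K"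
  shows "ip K S (rot z) + bip K (check_trace \<alpha> K S U \<eta>t) (tangential K z)
       - ip K P (divg z) + bip K (hat_trace \<tau> K P U \<eta>n) (normal_comp K z)
    = ip K z (curl S) + ip K z (grad P)
      + inverse \<alpha> * bip K (tangential K (\<lambda>y. U y - \<eta>t y)) (tangential K z)
      + inverse \<tau> * bip K (normal_comp K (\<lambda>y. U y - \<eta>n y)) (normal_comp K z)"
  using bip_check[OF assms(1) vpolys_L2_bdry[OF assms(3)] assms(5) tangential_L2_bdry(1)[OF vpolys_L2_bdry[OF assms(4)]], of \<alpha>]
    bip_hat[OF assms(2) vpolys_L2_bdry[OF assms(3)] assms(6) tangential_L2_bdry(2)[OF vpolys_L2_bdry[OF assms(4)]], of \<tau>]
    ibp_curl[OF polys_real_polynomial[OF assms(1)] assms(4)] ibp_grad[OF polys_real_polynomial[OF assms(2)] assms(4)]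
  by simp

text \<open>The first two equations of the primed solution are tested with \<open>S\<close> and
  \<open>P\<close>, the third of the unprimed one with \<open>U'\<close>. The volume couplings
  cancel and the terms without jumps assemble to the numerical traces.\<close>

lemma reciprocity:
  assumes s: "local_problem k \<alpha> \<tau> K \<eta>t \<eta>n g (S, P, U)" and s': "local_problem k \<alpha> \<tau> K \<mu>t \<mu>n g' (S', P', U')"
    and \<eta>: "\<eta>t \<in> L2_bdry K" "\<eta>n \<in> L2_bdry K" and \<mu>: "\<mu>t \<in> L2_bdry K" "\<mu>n \<in> L2_bdry K"
  shows "ip K S S' + ip K P P'
      + inverse \<alpha> * bip K (tangential K (\<lambda>y. U y - \<eta>t y)) (tangential K (\<lambda>y. U' y - \<mu>t y))
      + inverse \<tau> * bip K (normal_comp K (\<lambda>y. U y - \<eta>n y)) (normal_comp K (\<lambda>y. U' y - \<mu>n y))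
    = ip K g U' - bip K (check_trace \<alpha> K S U \<eta>t) (tangential K \<mu>t) - bip K (hat_trace \<tau> K P U \<eta>n) (normal_comp K \<mu>n)"
proof -
  have P: "S \<in> polys k" "P \<in> polys k" "U \<in> vpolys k" "S' \<in> polys k" "P' \<in> polys k" "U' \<in> vpolys k"
    using s s' by (auto simp: local_problem_def)
  have 1: "ip K S' S - ip K U' (curl S) + bip K (tangential K \<mu>t) S = 0"
    and 2: "ip K P' P - ip K U' (grad P) + bip K (normal_comp K \<mu>n) P = 0"
    using s' P by (auto simp: local_problem_def)
  have 3: "ip K U' (curl S) + ip K U' (grad P)
      + inverse \<alpha> * bip K (tangential K (\<lambda>y. U y - \<eta>t y)) (tangential K U')
      + inverse \<tau> * bip K (normal_comp K (\<lambda>y. U y - \<eta>n y)) (normal_comp K U') = ip K g U'"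
    using s P third_form[OF P(1-3) P(6) \<eta>, of \<alpha> \<tau>] by (auto simp: local_problem_def)
  note U = vpolys_L2_bdry[OF P(3)] and U' = vpolys_L2_bdry[OF P(6)]
  have d: "(\<lambda>y. U y - \<eta>t y) \<in> L2_bdry K" "(\<lambda>y. U y - \<eta>n y) \<in> L2_bdry K"
    using L2_bdry_comb[OF U \<eta>(1), of "-1"] L2_bdry_comb[OF U \<eta>(2), of "-1"] by simp_all
  have 4: "bip K (tangential K (\<lambda>y. U y - \<eta>t y)) (tangential K (\<lambda>y. U' y - \<mu>t y))
    = bip K (tangential K (\<lambda>y. U y - \<eta>t y)) (tangential K U') - bip K (tangential K (\<lambda>y. U y - \<eta>t y)) (tangential K \<mu>t)"
    using bip_comb_right[OF tangential_L2_bdry(1)[OF U'] tangential_L2_bdry(1)[OF \<mu>(1)] tangential_L2_bdry(1)[OF d(1)], of "-1"]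
    unfolding tangential_diff[of U' \<mu>t] by simp
  have 5: "bip K (normal_comp K (\<lambda>y. U y - \<eta>n y)) (normal_comp K (\<lambda>y. U' y - \<mu>n y))
    = bip K (normal_comp K (\<lambda>y. U y - \<eta>n y)) (normal_comp K U') - bip K (normal_comp K (\<lambda>y. U y - \<eta>n y)) (normal_comp K \<mu>n)"
    using bip_comb_right[OF tangential_L2_bdry(2)[OF U'] tangential_L2_bdry(2)[OF \<mu>(2)] tangential_L2_bdry(2)[OF d(2)], of "-1"]
    unfolding normal_comp_diff[of U' \<mu>n] by simp
  show ?thesis
    using 1 2 3 bip_check[OF P(1) U \<eta>(1) tangential_L2_bdry(1)[OF \<mu>(1)], of \<alpha>]
      bip_hat[OF P(2) U \<eta>(2) tangential_L2_bdry(2)[OF \<mu>(2)], of \<tau>]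
    unfolding 4 5 by (simp add: right_diff_distrib ip_commute[of K S'] ip_commute[of K P'] bip_commute[of K _ S] bip_commute[of K _ P])
qed

lemma zero_L2_bdry: "(\<lambda>_. 0) \<in> L2_bdry K"
  by (intro L2_bdry_continuous continuous_on_const)

lemma L2_zero: "(\<lambda>_. 0) \<in> L2 (cell K)"
  by (intro L2_continuous cell_compact continuous_on_const)

text \<open>Joint linearity in traces and source. It serves three purposes: differences for
  uniqueness, superposition of trace and source solutions, and linearity of the trace
  solution.\<close>

lemma local_problem_comb:
  assumes s: "local_problem k \<alpha> \<tau> K \<eta>t \<eta>n g (S, P, U)" and s': "local_problem k \<alpha> \<tau> K \<mu>t \<mu>n g' (S', P', U')"
    and \<eta>: "\<eta>t \<in> L2_bdry K" "\<eta>n \<in> L2_bdry K" and \<mu>: "\<mu>t \<in> L2_bdry K" "\<mu>n \<in> L2_bdry K"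
    and g: "g \<in> L2 (cell K)" "g' \<in> L2 (cell K)"
  shows "local_problem k \<alpha> \<tau> K (\<lambda>x. \<eta>t x + d *\<^sub>R \<mu>t x) (\<lambda>x. \<eta>n x + d *\<^sub>R \<mu>n x) (\<lambda>x. g x + d *\<^sub>R g' x)
    (\<lambda>x. S x + d * S' x, \<lambda>x. P x + d * P' x, \<lambda>x. U x + d *\<^sub>R U' x)"
proof -
  have P: "S \<in> polys k" "P \<in> polys k" "U \<in> vpolys k" "S' \<in> polys k" "P' \<in> polys k" "U' \<in> vpolys k"
    using s s' by (auto simp: local_problem_def)
  have ipc: "ip K (\<lambda>x. p x + d * q x) w = ip K p w + d * ip K q w" if "p \<in> polys k" "q \<in> polys k" "w \<in> polys k" for p q w
    using ip_comb_left[OF polys_L2[OF that(1)] polys_L2[OF that(2)] polys_L2[OF that(3)], of d] by simp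
  note ipU = ip_comb_left[OF vpolys_L2[OF P(3)] vpolys_L2[OF P(6)], of _ d]
  note T\<eta> = tangential_L2_bdry(1)[OF \<eta>(1)] tangential_L2_bdry(2)[OF \<eta>(2)]
  note T\<mu> = tangential_L2_bdry(1)[OF \<mu>(1)] tangential_L2_bdry(2)[OF \<mu>(2)]
  note U = vpolys_L2_bdry[OF P(3)] and U' = vpolys_L2_bdry[OF P(6)]
  have df: "(\<lambda>y. U y - \<eta>t y) \<in> L2_bdry K" "(\<lambda>y. U y - \<eta>n y) \<in> L2_bdry K"
    "(\<lambda>y. U' y - \<mu>t y) \<in> L2_bdry K" "(\<lambda>y. U' y - \<mu>n y) \<in> L2_bdry K"
    using L2_bdry_comb[OF U \<eta>(1), of "-1"] L2_bdry_comb[OF U \<eta>(2), of "-1"]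
      L2_bdry_comb[OF U' \<mu>(1), of "-1"] L2_bdry_comb[OF U' \<mu>(2), of "-1"] by simp_all
  have C: "check_trace \<alpha> K (\<lambda>x. S x + d * S' x) (\<lambda>x. U x + d *\<^sub>R U' x) (\<lambda>x. \<eta>t x + d *\<^sub>R \<mu>t x)
      = (\<lambda>x. check_trace \<alpha> K S U \<eta>t x + d * check_trace \<alpha> K S' U' \<mu>t x)"
    and H: "hat_trace \<tau> K (\<lambda>x. P x + d * P' x) (\<lambda>x. U x + d *\<^sub>R U' x) (\<lambda>x. \<eta>n x + d *\<^sub>R \<mu>n x)
      = (\<lambda>x. hat_trace \<tau> K P U \<eta>n x + d * hat_trace \<tau> K P' U' \<mu>n x)"
    by (simp_all add: check_trace_def hat_trace_def fun_eq_iff inner_diff_left inner_add_left algebra_simps)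
  have CL: "check_trace \<alpha> K S U \<eta>t \<in> L2_bdry K" "check_trace \<alpha> K S' U' \<mu>t \<in> L2_bdry K"
    "hat_trace \<tau> K P U \<eta>n \<in> L2_bdry K" "hat_trace \<tau> K P' U' \<mu>n \<in> L2_bdry K"
    using L2_bdry_comb[OF polys_L2_bdry[OF P(1)] tangential_L2_bdry(1)[OF df(1)], of "inverse \<alpha>"]
      L2_bdry_comb[OF polys_L2_bdry[OF P(4)] tangential_L2_bdry(1)[OF df(3)], of "inverse \<alpha>"]
      L2_bdry_comb[OF polys_L2_bdry[OF P(2)] tangential_L2_bdry(2)[OF df(2)], of "inverse \<tau>"]
      L2_bdry_comb[OF polys_L2_bdry[OF P(5)] tangential_L2_bdry(2)[OF df(4)], of "inverse \<tau>"]
    by (simp_all add: check_trace_def hat_trace_def)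
  show ?thesis unfolding local_problem_def prod.case
  proof (intro conjI ballI)
    fix \<xi> assume x: "\<xi> \<in> polys k"
    have e1: "ip K S \<xi> - ip K U (curl \<xi>) + bip K (tangential K \<eta>t) \<xi> = 0"
      "ip K S' \<xi> - ip K U' (curl \<xi>) + bip K (tangential K \<mu>t) \<xi> = 0"
      and e2: "ip K P \<xi> - ip K U (grad \<xi>) + bip K (normal_comp K \<eta>n) \<xi> = 0"
      "ip K P' \<xi> - ip K U' (grad \<xi>) + bip K (normal_comp K \<mu>n) \<xi> = 0"
      using s s' x by (auto simp: local_problem_def)
    have "ip K (\<lambda>x. S x + d * S' x) \<xi> - ip K (\<lambda>x. U x + d *\<^sub>R U' x) (curl \<xi>) + bip K (tangential K (\<lambda>x. \<eta>t x + d *\<^sub>R \<mu>t x)) \<xi>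
      = (ip K S \<xi> - ip K U (curl \<xi>) + bip K (tangential K \<eta>t) \<xi>)
        + d * (ip K S' \<xi> - ip K U' (curl \<xi>) + bip K (tangential K \<mu>t) \<xi>)"
      unfolding tangential_comb ipc[OF P(1,4) x] ipU[OF curl_L2[OF polys_real_polynomial[OF x]]]
        bip_comb_left[OF T\<eta>(1) T\<mu>(1) polys_L2_bdry[OF x]]
      by (simp add: algebra_simps)
    then show "ip K (\<lambda>x. S x + d * S' x) \<xi> - ip K (\<lambda>x. U x + d *\<^sub>R U' x) (curl \<xi>)
        + bip K (tangential K (\<lambda>x. \<eta>t x + d *\<^sub>R \<mu>t x)) \<xi> = 0"
      unfolding e1 by simp
    have "ip K (\<lambda>x. P x + d * P' x) \<xi> - ip K (\<lambda>x. U x + d *\<^sub>R U' x) (grad \<xi>) + bip K (normal_comp K (\<lambda>x. \<eta>n x + d *\<^sub>R \<mu>n x)) \<xi>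
      = (ip K P \<xi> - ip K U (grad \<xi>) + bip K (normal_comp K \<eta>n) \<xi>)
        + d * (ip K P' \<xi> - ip K U' (grad \<xi>) + bip K (normal_comp K \<mu>n) \<xi>)"
      unfolding normal_comp_comb ipc[OF P(2,5) x] ipU[OF grad_L2[OF polys_real_polynomial[OF x]]]
        bip_comb_left[OF T\<eta>(2) T\<mu>(2) polys_L2_bdry[OF x]]
      by (simp add: algebra_simps)
    then show "ip K (\<lambda>x. P x + d * P' x) \<xi> - ip K (\<lambda>x. U x + d *\<^sub>R U' x) (grad \<xi>)
        + bip K (normal_comp K (\<lambda>x. \<eta>n x + d *\<^sub>R \<mu>n x)) \<xi> = 0"
      unfolding e2 by simp
  next
    fix z assume z: "z \<in> vpolys k"
    note Tz = tangential_L2_bdry[OF vpolys_L2_bdry[OF z]]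
    have e3: "ip K S (rot z) + bip K (check_trace \<alpha> K S U \<eta>t) (tangential K z)
       - ip K P (divg z) + bip K (hat_trace \<tau> K P U \<eta>n) (normal_comp K z) = ip K g z"
      "ip K S' (rot z) + bip K (check_trace \<alpha> K S' U' \<mu>t) (tangential K z)
       - ip K P' (divg z) + bip K (hat_trace \<tau> K P' U' \<mu>n) (normal_comp K z) = ip K g' z"
      using s s' z by (auto simp: local_problem_def)
    show "ip K (\<lambda>x. S x + d * S' x) (rot z)
      + bip K (check_trace \<alpha> K (\<lambda>x. S x + d * S' x) (\<lambda>x. U x + d *\<^sub>R U' x) (\<lambda>x. \<eta>t x + d *\<^sub>R \<mu>t x)) (tangential K z)
      - ip K (\<lambda>x. P x + d * P' x) (divg z)
      + bip K (hat_trace \<tau> K (\<lambda>x. P x + d * P' x) (\<lambda>x. U x + d *\<^sub>R U' x) (\<lambda>x. \<eta>n x + d *\<^sub>R \<mu>n x)) (normal_comp K z)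
      = ip K (\<lambda>x. g x + d *\<^sub>R g' x) z"
      unfolding C H ipc[OF P(1,4) rot_vpolys[OF z]] ipc[OF P(2,5) divg_vpolys[OF z]]
        bip_comb_left[OF CL(1,2) Tz(1)] bip_comb_left[OF CL(3,4) Tz(2)] ip_comb_left[OF g vpolys_L2[OF z]]
      by (simp add: e3[symmetric] algebra_simps)
  qed (intro polys_comb vpolys_comb P)+
qed

text \<open>Reciprocity of a solution with itself is an energy identity, here with right-hand side
  zero; all four terms are nonnegative.\<close>

lemma local_problem_zero:
  assumes s: "local_problem k \<alpha> \<tau> K (\<lambda>_. 0) (\<lambda>_. 0) (\<lambda>_. 0) (S, P, U)" and "\<alpha> > 0" "\<tau> > 0"
  shows "S = (\<lambda>_. 0)" "P = (\<lambda>_. 0)" "U = (\<lambda>_. 0)"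
proof -
  have P: "S \<in> polys k" "P \<in> polys k" "U \<in> vpolys k" using s by (auto simp: local_problem_def)
  have "ip K S S + ip K P P + inverse \<alpha> * bip K (tangential K U) (tangential K U)
    + inverse \<tau> * bip K (normal_comp K U) (normal_comp K U) = 0"
    using reciprocity[OF s s zero_L2_bdry zero_L2_bdry zero_L2_bdry zero_L2_bdry]
    by (simp add: ip_zero_left bip_zero_right)
  moreover have "0 \<le> inverse \<alpha> * bip K (tangential K U) (tangential K U)"
    "0 \<le> inverse \<tau> * bip K (normal_comp K U) (normal_comp K U)"
    using assms(2,3) bip_nonneg by (auto intro!: mult_nonneg_nonneg)
  ultimately have z: "ip K S S = 0" "ip K P P = 0" "inverse \<alpha> * bip K (tangential K U) (tangential K U) = 0"
    "inverse \<tau> * bip K (normal_comp K U) (normal_comp K U) = 0"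
    using ip_nonneg[of K S] ip_nonneg[of K P] by linarith+
  show S: "S = (\<lambda>_. 0)" and Pz: "P = (\<lambda>_. 0)" using polys_ip_definite P z by blast+
  show "U = (\<lambda>_. 0)"
  proof (rule field_zero[OF P(3)])
    show "ip K U (curl \<xi>) = 0" "ip K U (grad \<xi>) = 0" if "\<xi> \<in> polys k" for \<xi>
      using s that unfolding S Pz by (auto simp: local_problem_def ip_zero_left bip_zero_left)
  qed (use z assms in auto)
qed

lemma local_problem_unique:
  assumes s: "local_problem k \<alpha> \<tau> K \<eta>t \<eta>n g (S, P, U)" "local_problem k \<alpha> \<tau> K \<eta>t \<eta>n g (S', P', U')"
    and \<eta>: "\<eta>t \<in> L2_bdry K" "\<eta>n \<in> L2_bdry K" and g: "g \<in> L2 (cell K)" and "\<alpha> > 0" "\<tau> > 0"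
  shows "S = S'" "P = P'" "U = U'"
proof -
  have "local_problem k \<alpha> \<tau> K (\<lambda>_. 0) (\<lambda>_. 0) (\<lambda>_. 0) (\<lambda>x. S x - S' x, \<lambda>x. P x - P' x, \<lambda>x. U x - U' x)"
    using local_problem_comb[OF s \<eta> \<eta> g g, of "-1"] by simp
  from local_problem_zero[OF this assms(6,7)] show "S = S'" "P = P'" "U = U'"
    by (simp_all add: fun_eq_iff del: split_paired_All)
qed

text \<open>Schur complement: \<open>RS U\<close> and \<open>RP U\<close> solve the first two equations for given \<open>U\<close> with zero data, which
  leaves a symmetric positive definite problem for \<open>U\<close>.\<close>

lemma local_problem_ex:
  assumes \<eta>: "\<eta>t \<in> L2_bdry K" "\<eta>n \<in> L2_bdry K" and g: "g \<in> L2 (cell K)" and pos: "\<alpha> > 0" "\<tau> > 0"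
  shows "\<exists>s. local_problem k \<alpha> \<tau> K \<eta>t \<eta>n g s"
proof -
  have lin: "ip K U (curl (\<lambda>x. p x + d * q x)) = ip K U (curl p) + d * ip K U (curl q)"
    "ip K U (grad (\<lambda>x. p x + d * q x)) = ip K U (grad p) + d * ip K U (grad q)"
    if "U \<in> vpolys k" "p \<in> polys k" "q \<in> polys k" for U p q d
    using that polys_real_polynomial
    by (auto simp: curl_comb ip_comb_right curl_L2 grad_L2 vpolys_L2)
  have "\<exists>v\<in>polys k. \<forall>w\<in>polys k. ip K v w = ip K U (curl w)"
    "\<exists>v\<in>polys k. \<forall>w\<in>polys k. ip K v w = ip K U (grad w)" if "U \<in> vpolys k" for U
    using that lin by (auto intro!: polys_riesz)
  then obtain RS RP where RS: "\<And>U. U \<in> vpolys k \<Longrightarrow> RS U \<in> polys k"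
      "\<And>U w. U \<in> vpolys k \<Longrightarrow> w \<in> polys k \<Longrightarrow> ip K (RS U) w = ip K U (curl w)"
    and RP: "\<And>U. U \<in> vpolys k \<Longrightarrow> RP U \<in> polys k"
      "\<And>U w. U \<in> vpolys k \<Longrightarrow> w \<in> polys k \<Longrightarrow> ip K (RP U) w = ip K U (grad w)"
    by metis
  have bl: "bip K h (\<lambda>x. p x + d * q x) = bip K h p + d * bip K h q"
    if "h \<in> L2_bdry K" "p \<in> polys k" "q \<in> polys k" for h p q d
    by (rule bip_comb_right[OF polys_L2_bdry[OF that(2)] polys_L2_bdry[OF that(3)] that(1)])
  note T\<eta> = tangential_L2_bdry(1)[OF \<eta>(1)] tangential_L2_bdry(2)[OF \<eta>(2)]
  \<comment> \<open>\<open>S0\<close> and \<open>P0\<close> are the responses of the first two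
    equations to the trace data alone; the solution is \<open>RS U + S0\<close> and
    \<open>RP U + P0\<close>.\<close>
  obtain S0 where S0: "S0 \<in> polys k" "\<And>w. w \<in> polys k \<Longrightarrow> ip K S0 w = - bip K (tangential K \<eta>t) w"
    using polys_riesz[of k "\<lambda>w. - bip K (tangential K \<eta>t) w"] bl[OF T\<eta>(1)] by auto
  obtain P0 where P0: "P0 \<in> polys k" "\<And>w. w \<in> polys k \<Longrightarrow> ip K P0 w = - bip K (normal_comp K \<eta>n) w"
    using polys_riesz[of k "\<lambda>w. - bip K (normal_comp K \<eta>n) w"] bl[OF T\<eta>(2)] by auto
  have ipc: "ip K (\<lambda>x. p x + d * q x) w = ip K p w + d * ip K q w"
    "ip K w (\<lambda>x. p x + d * q x) = ip K w p + d * ip K w q"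
    if "p \<in> polys k" "q \<in> polys k" "w \<in> polys k" for p q w d
    using ip_comb_left[OF polys_L2[OF that(1)] polys_L2[OF that(2)] polys_L2[OF that(3)], of d]
      ip_comb_right[OF polys_L2[OF that(1)] polys_L2[OF that(2)] polys_L2[OF that(3)], of d] by simp_all
  \<comment> \<open>The representers were merely chosen for each \<open>U\<close>; they are linear
    in it because they are unique.\<close>
  have Rlin: "RS (\<lambda>x. U x + d *\<^sub>R V x) = (\<lambda>x. RS U x + d * RS V x)"
    "RP (\<lambda>x. U x + d *\<^sub>R V x) = (\<lambda>x. RP U x + d * RP V x)" if "U \<in> vpolys k" "V \<in> vpolys k" for U V d
    using that
    by (auto intro!: polys_ip_unique[of _ k] polys_comb vpolys_comb RS RP simp: ipc RS RP vpolys_comb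
        ip_comb_left vpolys_L2 curl_L2 grad_L2 polys_real_polynomial)
  \<comment> \<open>Since \<open>ip K z (curl (RS U)) = ip K (RS z) (RS U)\<close>, elimination
    turns the couplings into Gram products, which are symmetric.\<close>
  define B where "B U z = ip K (RS U) (RS z) + ip K (RP U) (RP z)
    + inverse \<alpha> * bip K (tangential K U) (tangential K z) + inverse \<tau> * bip K (normal_comp K U) (normal_comp K z)" for U z
  define L where "L z = ip K g z - ip K S0 (RS z) - ip K P0 (RP z)
    + inverse \<alpha> * bip K (tangential K \<eta>t) (tangential K z) + inverse \<tau> * bip K (normal_comp K \<eta>n) (normal_comp K z)" for z
  have T: "tangential K z \<in> L2_bdry K" "normal_comp K z \<in> L2_bdry K" if "z \<in> vpolys k" for z
    using that vpolys_L2_bdry tangential_L2_bdry by blast+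
  have "\<exists>U\<in>vpolys k. \<forall>z\<in>vpolys k. B U z = L z"
  \<comment> \<open>Vector fields are separated by the grid values of both components; the Boolean
    selects the component.\<close>
  proof (rule finite_riesz[where D = "{..k} \<times> {..k} \<times> UNIV" and z = "\<lambda>_. 0" and cb = "\<lambda>p c q x. p x + c *\<^sub>R q x"
      and ev = "\<lambda>(i, j, e) p. if e then fst (p (real i, real j)) else snd (p (real i, real j))"])
    show "B (\<lambda>x. U x + d *\<^sub>R V x) z = B U z + d * B V z" if "U \<in> vpolys k" "V \<in> vpolys k" "z \<in> vpolys k" for U V z d
      unfolding B_def Rlin[OF that(1,2)] tangential_comb normal_comp_comb
      by (simp add: ipc RS RP that bip_comb_left T algebra_simps)
    show "L (\<lambda>x. U x + d *\<^sub>R V x) = L U + d * L V" if "U \<in> vpolys k" "V \<in> vpolys k" for U V d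
      unfolding L_def Rlin[OF that(1,2)] tangential_comb normal_comp_comb
      by (simp add: ipc RS RP S0 P0 that bip_comb_right T T\<eta>
          ip_comb_right[OF vpolys_L2[OF that(1)] vpolys_L2[OF that(2)] g] algebra_simps)
    show "B U V = B V U" for U V by (simp add: B_def ip_commute bip_commute)
    show "U = (\<lambda>_. 0)" if U: "U \<in> vpolys k" "B U U = 0" for U
    proof -
      have "0 \<le> inverse \<alpha> * bip K (tangential K U) (tangential K U)"
        "0 \<le> inverse \<tau> * bip K (normal_comp K U) (normal_comp K U)"
        using pos bip_nonneg by (auto intro!: mult_nonneg_nonneg)
      then have z: "ip K (RS U) (RS U) = 0" "ip K (RP U) (RP U) = 0" "inverse \<alpha> * bip K (tangential K U) (tangential K U) = 0"
        "inverse \<tau> * bip K (normal_comp K U) (normal_comp K U) = 0"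
        using U(2) ip_nonneg[of K "RS U"] ip_nonneg[of K "RP U"] unfolding B_def by linarith+
      have "RS U = (\<lambda>_. 0)" "RP U = (\<lambda>_. 0)" using z polys_ip_definite RS RP U by blast+
      then have "ip K U (curl w) = 0" "ip K U (grad w) = 0" if "w \<in> polys k" for w
        using RS(2)[OF U(1) that] RP(2)[OF U(1) that] by (simp_all add: ip_zero_left)
      then show ?thesis using field_zero[OF U(1)] z pos by auto
    qed
    show "w = (\<lambda>_. 0)" if w: "w \<in> vpolys k" "\<forall>d\<in>{..k} \<times> {..k} \<times> UNIV.
      (case d of (i, j, e) \<Rightarrow> \<lambda>p. if e then fst (p (real i, real j)) else snd (p (real i, real j))) w = 0" for w
    proof -
      have v: "fst (w (real i, real j)) = 0" "snd (w (real i, real j)) = 0" if "i \<le> k" "j \<le> k" for i j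
        using bspec[OF w(2), of "(i, j, True)"] bspec[OF w(2), of "(i, j, False)"] that by auto
      have "(\<lambda>x. fst (w x)) = (\<lambda>_. 0)" "(\<lambda>x. snd (w x)) = (\<lambda>_. 0)"
        using w(1) v by (auto intro!: polys_vanish_grid simp: vpolys_def)
      then show ?thesis by (simp add: fun_eq_iff prod_eq_iff)
    qed
  qed (auto intro: vpolys_zero vpolys_comb)
  then obtain U where U: "U \<in> vpolys k" "\<And>z. z \<in> vpolys k \<Longrightarrow> B U z = L z" by blast
  define S P where "S = (\<lambda>x. RS U x + 1 * S0 x)" and "P = (\<lambda>x. RP U x + 1 * P0 x)"
  have SP: "S \<in> polys k" "P \<in> polys k" unfolding S_def P_def by (intro polys_comb RS RP S0 P0 U)+
  have "local_problem k \<alpha> \<tau> K \<eta>t \<eta>n g (S, P, U)"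
    unfolding local_problem_def prod.case
  proof (intro conjI ballI)
    show "ip K S \<xi> - ip K U (curl \<xi>) + bip K (tangential K \<eta>t) \<xi> = 0" if "\<xi> \<in> polys k" for \<xi>
      unfolding S_def by (simp only: ipc RS S0 U that)
    show "ip K P \<xi> - ip K U (grad \<xi>) + bip K (normal_comp K \<eta>n) \<xi> = 0" if "\<xi> \<in> polys k" for \<xi>
      unfolding P_def by (simp only: ipc RP P0 U that)
    show "ip K S (rot z) + bip K (check_trace \<alpha> K S U \<eta>t) (tangential K z)
       - ip K P (divg z) + bip K (hat_trace \<tau> K P U \<eta>n) (normal_comp K z) = ip K g z" if z: "z \<in> vpolys k" for z
    proof -
      have e1: "ip K z (curl S) = ip K (RS z) S" "ip K z (grad P) = ip K (RP z) P" using RS RP SP z by simp_all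
      have e2: "ip K (RS z) S = ip K (RS U) (RS z) + ip K S0 (RS z)" "ip K (RP z) P = ip K (RP U) (RP z) + ip K P0 (RP z)"
        using ipc(2)[OF RS(1)[OF U(1)] S0(1) RS(1)[OF z], of 1] ipc(2)[OF RP(1)[OF U(1)] P0(1) RP(1)[OF z], of 1]
        unfolding S_def P_def by (simp_all only: ip_commute[of K "RS z"] ip_commute[of K "RP z"] mult_1)
      have e3: "bip K (tangential K (\<lambda>y. U y - \<eta>t y)) (tangential K z) = bip K (tangential K U) (tangential K z) - bip K (tangential K \<eta>t) (tangential K z)"
        unfolding tangential_diff using bip_comb_left[OF T(1)[OF U(1)] T\<eta>(1) T(1)[OF z], of "-1"] by simp
      have e4: "bip K (normal_comp K (\<lambda>y. U y - \<eta>n y)) (normal_comp K z) = bip K (normal_comp K U) (normal_comp K z) - bip K (normal_comp K \<eta>n) (normal_comp K z)"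
        unfolding normal_comp_diff using bip_comb_left[OF T(2)[OF U(1)] T\<eta>(2) T(2)[OF z], of "-1"] by simp
      show ?thesis
        using U(2)[OF z] unfolding third_form[OF SP U(1) z \<eta>] B_def L_def e1 e2 e3 e4 right_diff_distrib by linarith
    qed
  qed (fact SP U)+
  then show ?thesis by blast
qed

lemma local_problem_ex1:
  assumes "\<eta>t \<in> L2_bdry K" "\<eta>n \<in> L2_bdry K" "g \<in> L2 (cell K)" "\<alpha> > 0" "\<tau> > 0"
  shows "\<exists>!s. local_problem k \<alpha> \<tau> K \<eta>t \<eta>n g s"
proof -
  obtain S P U where s: "local_problem k \<alpha> \<tau> K \<eta>t \<eta>n g (S, P, U)"
    using local_problem_ex[OF assms] by (metis prod_cases3)
  show ?thesis
  proof (rule ex1I[of _ "(S, P, U)"])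
    fix s' assume "local_problem k \<alpha> \<tau> K \<eta>t \<eta>n g s'"
    then show "s' = (S, P, U)"
      using local_problem_unique[OF s _ assms] by (cases s') auto
  qed (rule s)
qed

end

lemma bip_scale_left: "bip K (\<lambda>x. d * f x) g = d * bip K f g"
  by (simp add: bip_def sum_distrib_left case_prod_beta' mult.assoc mult.left_commute)

context star_polygon
begin

text \<open>Combinations of traces are formed on relative interiors of edges only; the local problem
  does not notice the difference to a pointwise combination.\<close>

lemma local_problem_cong:
  assumes "\<And>a b t. (a, b) \<in> edge_ends K \<Longrightarrow> 0 < t \<Longrightarrow> t < 1 \<Longrightarrow> \<eta>t (linepath a b t) = \<eta>t' (linepath a b t)"
    and "\<And>a b t. (a, b) \<in> edge_ends K \<Longrightarrow> 0 < t \<Longrightarrow> t < 1 \<Longrightarrow> \<eta>n (linepath a b t) = \<eta>n' (linepath a b t)"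
  shows "local_problem k \<alpha> \<tau> K \<eta>t \<eta>n g = local_problem k \<alpha> \<tau> K \<eta>t' \<eta>n' g"
proof -
  have "bip K (tangential K \<eta>t) \<xi> = bip K (tangential K \<eta>t') \<xi>"
    "bip K (normal_comp K \<eta>n) \<xi> = bip K (normal_comp K \<eta>n') \<xi>"
    "bip K (check_trace \<alpha> K S U \<eta>t) \<xi> = bip K (check_trace \<alpha> K S U \<eta>t') \<xi>"
    "bip K (hat_trace \<tau> K S U \<eta>n) \<xi> = bip K (hat_trace \<tau> K S U \<eta>n') \<xi>" for \<xi> S U
    by (intro bip_cong; simp add: assms check_trace_def hat_trace_def)+
  then show ?thesis by (simp add: local_problem_def)
qed

lemma trace_solves:
  assumes "\<eta>t \<in> L2_bdry K" "\<eta>n \<in> L2_bdry K" "\<alpha> > 0" "\<tau> > 0"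
  shows "local_problem k \<alpha> \<tau> K \<eta>t \<eta>n (\<lambda>_. 0)
    (Sigma_trace k \<alpha> \<tau> K \<eta>t \<eta>n, Phi_trace k \<alpha> \<tau> K \<eta>t \<eta>n, U_trace k \<alpha> \<tau> K \<eta>t \<eta>n)"
  using theI'[OF local_problem_ex1[OF assms(1,2) L2_zero assms(3,4)], of k]
  by (simp add: Sigma_trace_def Phi_trace_def U_trace_def trace_sol_def local_problem_trace_eq)

lemma source_solves:
  assumes "g \<in> L2 (cell K)" "\<alpha> > 0" "\<tau> > 0"
  shows "local_problem k \<alpha> \<tau> K (\<lambda>_. 0) (\<lambda>_. 0) g
    (Sigma_source k \<alpha> \<tau> K g, Phi_source k \<alpha> \<tau> K g, U_source k \<alpha> \<tau> K g)"
  using theI'[OF local_problem_ex1[OF zero_L2_bdry zero_L2_bdry assms], of k]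
  by (simp add: Sigma_source_def Phi_source_def U_source_def source_sol_def local_problem_source_eq)

lemma normal_components_zero:
  assumes "(a, b) \<in> edge_ends K" "v \<bullet> edge_normal a b = 0" "v \<bullet> perp (edge_normal a b) = 0"
  shows "v = 0"
proof -
  define n where "n = edge_normal a b"
  have n: "(fst n)\<^sup>2 + (snd n)\<^sup>2 = 1"
    using edge_normal_norm[OF assms(1)] by (simp add: n_def norm_prod_def real_sqrt_eq_1_iff)
  have e: "fst v * fst n + snd v * snd n = 0" "fst v * snd n - snd v * fst n = 0"
    using assms by (simp_all add: n_def inner_prod_def perp_def)
  have f: "fst v * ((fst n)\<^sup>2 + (snd n)\<^sup>2) = fst n * (fst v * fst n + snd v * snd n) + snd n * (fst v * snd n - snd v * fst n)"
    "snd v * ((fst n)\<^sup>2 + (snd n)\<^sup>2) = snd n * (fst v * fst n + snd v * snd n) - fst n * (fst v * snd n - snd v * fst n)"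
    by (simp_all add: power2_eq_square algebra_simps)
  have "fst v = 0" "snd v = 0" using f unfolding e n by simp_all
  then show ?thesis by (simp add: prod_eq_iff)
qed

end

lemma edge_point:
  assumes "polygon K" "(a, b) \<in> edge_ends K" "0 < t" "t < 1"
  shows "linepath a b t \<in> rel_interior (closed_segment a b)"
  unfolding rel_interior_edge[OF assms(1,2)] using assms(3,4) by blast

section \<open>Traces on the skeleton\<close>

lemma has_integral_linepath_commute:
  fixes h :: "point \<Rightarrow> real"
  assumes "((\<lambda>t. h (linepath a b t)) has_integral i) {0..1}"
  shows "((\<lambda>t. h (linepath b a t)) has_integral i) {0..1}"
proof -
  have "((\<lambda>t. h (linepath a b ((-1) *\<^sub>R t + 1))) has_integral (1 / (\<bar>-1\<bar> ^ DIM(real))) *\<^sub>R i)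
    ((\<lambda>x. (1 / (-1)) *\<^sub>R x + - ((1 / (-1)) *\<^sub>R (1::real))) ` cbox 0 1)"
    by (rule has_integral_affinity) (use assms in auto)
  moreover have "(\<lambda>x. (1 / (-1)) *\<^sub>R x + - ((1 / (-1)) *\<^sub>R (1::real))) ` cbox 0 1 = {0..1::real}"
    by (auto simp: image_iff intro!: bexI[of _ "1 - _"])
  moreover have "linepath a b ((-1) *\<^sub>R t + 1) = linepath b a t" for t
    by (simp add: linepath_def algebra_simps)
  ultimately show ?thesis by simp
qed

text \<open>Well defined: the choice of the end points only affects the orientation of the segment.\<close>

definition segment_integral :: "point set \<Rightarrow> (point \<Rightarrow> real) \<Rightarrow> real" where
  "segment_integral F h = (let e = (SOME e. F = closed_segment (fst e) (snd e)) in
     norm (snd e - fst e) * integral {0..1} (\<lambda>t. h (linepath (fst e) (snd e) t)))"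

definition segment_integrable :: "point set \<Rightarrow> (point \<Rightarrow> real) \<Rightarrow> bool" where
  "segment_integrable F h = (let e = (SOME e. F = closed_segment (fst e) (snd e)) in
     (\<lambda>t. h (linepath (fst e) (snd e) t)) integrable_on {0..1})"

lemma
  shows segment_integral_eq: "segment_integral (closed_segment a b) h = norm (b - a) * integral {0..1} (\<lambda>t. h (linepath a b t))"
    and segment_integrable_eq: "segment_integrable (closed_segment a b) h \<longleftrightarrow> (\<lambda>t. h (linepath a b t)) integrable_on {0..1}"
proof -
  define e where "e = (SOME e. closed_segment a b = closed_segment (fst e) (snd e))"
  have "closed_segment a b = closed_segment (fst e) (snd e)"
    unfolding e_def by (rule someI[of _ "(a, b)"]) simp
  then have "e = (a, b) \<or> e = (b, a)" by (auto simp: doubleton_eq_iff prod_eq_iff)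
  moreover have iff: "((\<lambda>t. h (linepath b a t)) has_integral i) {0..1} \<longleftrightarrow> ((\<lambda>t. h (linepath a b t)) has_integral i) {0..1}" for i
    using has_integral_linepath_commute by blast
  ultimately show "segment_integral (closed_segment a b) h = norm (b - a) * integral {0..1} (\<lambda>t. h (linepath a b t))"
    "segment_integrable (closed_segment a b) h \<longleftrightarrow> (\<lambda>t. h (linepath a b t)) integrable_on {0..1}"
    unfolding segment_integral_def segment_integrable_def Let_def e_def[symmetric] integral_def integrable_on_def
    by (auto simp: norm_minus_commute iff)
qed

text \<open>Two elements may run through a shared edge in opposite directions. Integrals over edges
  as point sets make their contributions comparable.\<close>

lemma bip_segment_integral:
  assumes "polygon K" "g \<in> L2_bdry K" "h \<in> L2_bdry K"
  shows "bip K g h = (\<Sum>F\<in>edges K. segment_integral F (\<lambda>x. g x * h x))"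
    and "F \<in> edges K \<Longrightarrow> segment_integrable F (\<lambda>x. g x * h x)"
proof -
  have i: "integrable (lebesgue_on {0..1}) (\<lambda>t. g (linepath a b t) * h (linepath a b t))" if "(a, b) \<in> edge_ends K" for a b
    using L2_bdry_integrable[OF assms(2,3) that] .
  have "(\<Sum>F\<in>edges K. segment_integral F (\<lambda>x. g x * h x))
      = (\<Sum>e\<in>edge_ends K. segment_integral (case e of (a, b) \<Rightarrow> closed_segment a b) (\<lambda>x. g x * h x))"
    unfolding edges_def by (rule sum.reindex[OF inj_on_closed_segment_edge_ends[OF assms(1)], unfolded o_def])
  also have "\<dots> = bip K g h" unfolding bip_def
    by (intro sum.cong refl)
      (auto simp: segment_integral_eq lebesgue_integral_eq_integral[OF i])
  finally show "bip K g h = (\<Sum>F\<in>edges K. segment_integral F (\<lambda>x. g x * h x))" by simp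
  show "segment_integrable F (\<lambda>x. g x * h x)" if "F \<in> edges K"
    using that i by (auto simp: edges_def segment_integrable_eq intro!: integrable_on_lebesgue_on)
qed

lemma segment_integral_add:
  assumes "segment_integrable F g" "segment_integrable F h"
  shows "segment_integral F (\<lambda>x. g x + h x) = segment_integral F g + segment_integral F h"
  using assms unfolding segment_integral_def segment_integrable_def Let_def
  by (simp add: Henstock_Kurzweil_Integration.integral_add distrib_left)

lemma segment_integral_zero:
  assumes "polygon K" "F \<in> edges K" "\<And>x. x \<in> rel_interior F \<Longrightarrow> h x = 0"
  shows "segment_integral F h = 0"
proof -
  obtain a b where F: "F = closed_segment a b" "(a, b) \<in> edge_ends K" using assms(2) by (auto simp: edges_def)
  have "integral {0..1} (\<lambda>t. h (linepath a b t)) = integral {0..1} (\<lambda>t::real. 0::real)"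
  proof (rule integral_spike[of "{0, 1}"])
    show "0 = h (linepath a b t)" if "t \<in> {0..1} - {0, 1}" for t
    proof -
      have "linepath a b t \<in> rel_interior F"
        unfolding F(1) using that by (intro edge_point[OF assms(1) F(2)]) auto
      then show ?thesis using assms(3) by simp
    qed
  qed auto
  then show ?thesis by (simp add: F segment_integral_eq)
qed

text \<open>With a third index, pairwise cancellation forces every term to vanish; with exactly two
  it is the claim. This handles an edge without counting the elements that share it.\<close>

lemma sum_pairwise_zero:
  fixes s :: "'a \<Rightarrow> real"
  assumes "finite S" "i \<in> S" "j \<in> S" "i \<noteq> j" and p: "\<And>a b. a \<in> S \<Longrightarrow> b \<in> S \<Longrightarrow> a \<noteq> b \<Longrightarrow> s a + s b = 0"
  shows "sum s S = 0"
proof (cases "S = {i, j}")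
  case True
  then show ?thesis using assms by simp
next
  case False
  then obtain l where l: "l \<in> S" "l \<noteq> i" "l \<noteq> j" using assms by blast
  have "s i + s j = 0" "s i + s l = 0" "s j + s l = 0" using p l assms(2-4) by auto
  then have "s i = 0" by linarith
  then have "s a = 0" if "a \<in> S" for a using p[of i a] that assms(2) by (cases "a = i") auto
  then show ?thesis by simp
qed

text \<open>After exchanging the sums over elements and edges, a boundary edge contributes zero
  termwise, and an interior edge by the jump conditions, because \<phi> has the same value from all
  sides.\<close>

lemma skeleton_cancellation:
  assumes fin: "finite T" and poly: "\<And>K. K \<in> T \<Longrightarrow> polygon K"
    and cover: "all_edges T = interior_edges T \<union> boundary_edges \<Omega> T"
    and g: "\<And>K. K \<in> T \<Longrightarrow> g K \<in> L2_bdry K" and \<phi>: "\<And>K. K \<in> T \<Longrightarrow> \<phi> \<in> L2_bdry K"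
    and int: "\<And>K K' F x. K \<in> T \<Longrightarrow> K' \<in> T \<Longrightarrow> K \<noteq> K' \<Longrightarrow> F \<in> edges K \<inter> edges K' \<Longrightarrow> x \<in> rel_interior F \<Longrightarrow>
      g K x + g K' x = 0"
    and bd: "\<And>K F x. K \<in> T \<Longrightarrow> F \<in> edges K \<inter> boundary_edges \<Omega> T \<Longrightarrow> x \<in> rel_interior F \<Longrightarrow> g K x = 0"
  shows "(\<Sum>K\<in>T. bip K \<phi> (g K)) = 0"
proof -
  define s where "s K F = segment_integral F (\<lambda>x. \<phi> x * g K x)" for K F
  have finE: "finite (all_edges T)" using fin by (auto simp: all_edges_def edges_def)
  have "(\<Sum>K\<in>T. bip K \<phi> (g K)) = (\<Sum>K\<in>T. \<Sum>F\<in>{F \<in> all_edges T. F \<in> edges K}. s K F)"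
  proof (intro sum.cong refl)
    fix K assume K: "K \<in> T"
    then have "{F \<in> all_edges T. F \<in> edges K} = edges K" by (auto simp: all_edges_def)
    then show "bip K \<phi> (g K) = (\<Sum>F\<in>{F \<in> all_edges T. F \<in> edges K}. s K F)"
      using bip_segment_integral(1)[OF poly[OF K] \<phi>[OF K] g[OF K]] by (simp add: s_def)
  qed
  also have "\<dots> = (\<Sum>F\<in>all_edges T. \<Sum>K\<in>{K \<in> T. F \<in> edges K}. s K F)"
    by (rule sum.swap_restrict[OF fin finE])
  also have "\<dots> = 0"
  proof (rule sum.neutral, rule ballI)
    fix F assume F: "F \<in> all_edges T"
    show "(\<Sum>K\<in>{K \<in> T. F \<in> edges K}. s K F) = 0"
    proof (cases "F \<in> boundary_edges \<Omega> T")
      case True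
      then show ?thesis unfolding s_def
        by (intro sum.neutral ballI) (auto intro!: segment_integral_zero[OF poly] simp: bd)
    next
      case False
      then have "F \<in> interior_edges T" using F cover by blast
      then obtain K K' where K: "K \<in> T" "K' \<in> T" "K \<noteq> K'" "F \<in> edges K" "F \<in> edges K'"
        unfolding interior_edges_def by blast
      show ?thesis
      proof (rule sum_pairwise_zero[of _ K K'])
        fix L L' assume L: "L \<in> {K \<in> T. F \<in> edges K}" "L' \<in> {K \<in> T. F \<in> edges K}" "L \<noteq> L'"
        have "s L F + s L' F = segment_integral F (\<lambda>x. \<phi> x * g L x + \<phi> x * g L' x)"
          unfolding s_def
        proof (rule segment_integral_add[symmetric])
          show "segment_integrable F (\<lambda>x. \<phi> x * g L x)"
            by (rule bip_segment_integral(2)[OF poly[of L] \<phi>[of L] g[of L]]) (use L in auto)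
          show "segment_integrable F (\<lambda>x. \<phi> x * g L' x)"
            by (rule bip_segment_integral(2)[OF poly[of L'] \<phi>[of L'] g[of L']]) (use L in auto)
        qed
        also have "\<dots> = 0"
          using L int[of L L' F] by (intro segment_integral_zero[OF poly[of L]]) (auto simp flip: distrib_left)
        finally show "s L F + s L' F = 0" .
      qed (use K fin in auto)
    qed
  qed
  finally show ?thesis .
qed

section \<open>Linear structure of the trace spaces\<close>

definition skeleton :: "element \<Rightarrow> point set" where
  "skeleton K = (\<Union>F\<in>edges K. rel_interior F)"

text \<open>Restriction to the skeleton is needed since pointwise combination would alter the value
  \<open>undefined\<close> that extensional traces take elsewhere.\<close>

definition trace_comb :: "element set \<Rightarrow> (element \<Rightarrow> point \<Rightarrow> point) \<Rightarrow> real \<Rightarrow> (element \<Rightarrow> point \<Rightarrow> point) \<Rightarrow> element \<Rightarrow> point \<Rightarrow> point" where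
  "trace_comb T \<mu> d \<nu> = (\<lambda>K\<in>T. \<lambda>x\<in>skeleton K. \<mu> K x + d *\<^sub>R \<nu> K x)"

definition trace_zero :: "element set \<Rightarrow> element \<Rightarrow> point \<Rightarrow> point" where
  "trace_zero T = (\<lambda>K\<in>T. \<lambda>x\<in>skeleton K. 0)"

lemma trace_comb_apply: "K \<in> T \<Longrightarrow> F \<in> edges K \<Longrightarrow> x \<in> rel_interior F \<Longrightarrow> trace_comb T \<mu> d \<nu> K x = \<mu> K x + d *\<^sub>R \<nu> K x"
  and trace_zero_apply: "K \<in> T \<Longrightarrow> F \<in> edges K \<Longrightarrow> x \<in> rel_interior F \<Longrightarrow> trace_zero T K x = 0"
  by (auto simp: trace_comb_def trace_zero_def skeleton_def)

lemma M_space_memI: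
  assumes "\<mu> \<in> extensional T" "\<And>K. K \<in> T \<Longrightarrow> \<mu> K \<in> extensional (skeleton K)"
    and "\<And>K F. K \<in> T \<Longrightarrow> F \<in> edges K \<Longrightarrow> \<exists>p\<in>vpolys k. \<forall>x\<in>rel_interior F. \<mu> K x = p x"
  shows "\<mu> \<in> M_space T k"
  using assms unfolding M_space_def edge_poly_space_def skeleton_def by (auto simp: PiE_iff)

lemma M_space_comb:
  assumes "\<mu> \<in> M_space T k" "\<nu> \<in> M_space T k"
  shows "trace_comb T \<mu> d \<nu> \<in> M_space T k"
proof (rule M_space_memI)
  fix K F assume K: "K \<in> T" "F \<in> edges K"
  obtain p q where "p \<in> vpolys k" "q \<in> vpolys k" "\<forall>x\<in>rel_interior F. \<mu> K x = p x" "\<forall>x\<in>rel_interior F. \<nu> K x = q x"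
    using assms K unfolding M_space_def edge_poly_space_def by (auto simp: PiE_iff) blast
  then show "\<exists>p\<in>vpolys k. \<forall>x\<in>rel_interior F. trace_comb T \<mu> d \<nu> K x = p x"
    using K by (intro bexI[of _ "\<lambda>x. p x + d *\<^sub>R q x"]) (auto simp: trace_comb_apply vpolys_comb simp del: split_paired_All)
qed (auto simp: trace_comb_def)

lemma M_space_zero: "trace_zero T \<in> M_space T k"
proof (rule M_space_memI)
  fix K F assume K: "K \<in> T" "F \<in> edges K"
  then show "\<exists>p\<in>vpolys k. \<forall>x\<in>rel_interior F. trace_zero T K x = p x"
    using vpolys_zero by (intro bexI[of _ "\<lambda>_. 0"]) (auto simp: trace_zero_apply)
qed (auto simp: trace_zero_def)

lemma M_space_eqI:
  assumes "\<mu> \<in> M_space T k" "\<nu> \<in> M_space T k"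
    and "\<And>K F x. K \<in> T \<Longrightarrow> F \<in> edges K \<Longrightarrow> x \<in> rel_interior F \<Longrightarrow> \<mu> K x = \<nu> K x"
  shows "\<mu> = \<nu>"
proof (rule PiE_ext[OF assms(1,2)[unfolded M_space_def]])
  fix K assume K: "K \<in> T"
  then have "\<mu> K \<in> extensional (skeleton K)" "\<nu> K \<in> extensional (skeleton K)"
    using assms(1,2) by (auto simp: M_space_def edge_poly_space_def skeleton_def PiE_iff)
  then show "\<mu> K = \<nu> K"
    by (rule extensionalityI) (use assms(3)[OF K] in \<open>auto simp: skeleton_def\<close>)
qed

lemma Nt_space_M: "\<mu> \<in> Nt_space \<Omega> T k \<Longrightarrow> \<mu> \<in> M_space T k"
  and Nn_space_M: "\<mu> \<in> Nn_space \<Omega> T k \<Longrightarrow> \<mu> \<in> M_space T k"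
  by (auto simp: Nt_space_def Nn_space_def)

lemma Nt_space_comb:
  assumes "\<mu> \<in> Nt_space \<Omega> T k" "\<nu> \<in> Nt_space \<Omega> T k"
  shows "trace_comb T \<mu> d \<nu> \<in> Nt_space \<Omega> T k"
proof -
  have *: "(u + d *\<^sub>R v) \<bullet> n + (u' + d *\<^sub>R v') \<bullet> n' = (u \<bullet> n + u' \<bullet> n') + d * (v \<bullet> n + v' \<bullet> n')" for u v u' v' n n' :: point
    by (simp add: inner_add_left algebra_simps)
  show ?thesis
    unfolding Nt_space_def
  proof (intro CollectI conjI ballI impI)
    show "trace_comb T \<mu> d \<nu> \<in> M_space T k" using assms by (intro M_space_comb Nt_space_M)
    show "normal_comp K (trace_comb T \<mu> d \<nu> K) x = 0" if "K \<in> T" "F \<in> edges K" "x \<in> rel_interior F" for K F x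
      using assms that by (simp add: trace_comb_apply inner_add_left Nt_space_def)
    show "tangential K (trace_comb T \<mu> d \<nu> K) x = 0" if "K \<in> T" "F \<in> edges K \<inter> boundary_edges \<Omega> T" "x \<in> rel_interior F" for K F x
      using assms that by (simp add: trace_comb_apply[of K T F] inner_add_left Nt_space_def)
    fix K K' F x assume K: "K \<in> T" "K' \<in> T" "K \<noteq> K'" "F \<in> edges K \<inter> edges K'" "x \<in> rel_interior F"
    then have "trace_comb T \<mu> d \<nu> K x = \<mu> K x + d *\<^sub>R \<nu> K x" "trace_comb T \<mu> d \<nu> K' x = \<mu> K' x + d *\<^sub>R \<nu> K' x"
      by (auto intro: trace_comb_apply)
    moreover have "tangential K (\<mu> K) x + tangential K' (\<mu> K') x = 0" "tangential K (\<nu> K) x + tangential K' (\<nu> K') x = 0"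
      using assms K unfolding Nt_space_def by blast+
    ultimately show "tangential K (trace_comb T \<mu> d \<nu> K) x + tangential K' (trace_comb T \<mu> d \<nu> K') x = 0"
      by (simp only: * mult_zero_right add_0)
  qed
qed

lemma Nn_space_comb:
  assumes "\<mu> \<in> Nn_space \<Omega> T k" "\<nu> \<in> Nn_space \<Omega> T k"
  shows "trace_comb T \<mu> d \<nu> \<in> Nn_space \<Omega> T k"
proof -
  have *: "(u + d *\<^sub>R v) \<bullet> n + (u' + d *\<^sub>R v') \<bullet> n' = (u \<bullet> n + u' \<bullet> n') + d * (v \<bullet> n + v' \<bullet> n')" for u v u' v' n n' :: point
    by (simp add: inner_add_left algebra_simps)
  show ?thesis
    unfolding Nn_space_def
  proof (intro CollectI conjI ballI impI)
    show "trace_comb T \<mu> d \<nu> \<in> M_space T k" using assms by (intro M_space_comb Nn_space_M)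
    show "tangential K (trace_comb T \<mu> d \<nu> K) x = 0" if "K \<in> T" "F \<in> edges K" "x \<in> rel_interior F" for K F x
      using assms that by (simp add: trace_comb_apply inner_add_left Nn_space_def)
    show "normal_comp K (trace_comb T \<mu> d \<nu> K) x = 0" if "K \<in> T" "F \<in> edges K \<inter> boundary_edges \<Omega> T" "x \<in> rel_interior F" for K F x
      using assms that by (simp add: trace_comb_apply[of K T F] inner_add_left Nn_space_def)
    fix K K' F x assume K: "K \<in> T" "K' \<in> T" "K \<noteq> K'" "F \<in> edges K \<inter> edges K'" "x \<in> rel_interior F"
    then have "trace_comb T \<mu> d \<nu> K x = \<mu> K x + d *\<^sub>R \<nu> K x" "trace_comb T \<mu> d \<nu> K' x = \<mu> K' x + d *\<^sub>R \<nu> K' x"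
      by (auto intro: trace_comb_apply)
    moreover have "normal_comp K (\<mu> K) x + normal_comp K' (\<mu> K') x = 0" "normal_comp K (\<nu> K) x + normal_comp K' (\<nu> K') x = 0"
      using assms K unfolding Nn_space_def by blast+
    ultimately show "normal_comp K (trace_comb T \<mu> d \<nu> K) x + normal_comp K' (trace_comb T \<mu> d \<nu> K') x = 0"
      by (simp only: * mult_zero_right add_0)
  qed
qed

lemma Nt_space_zero: "trace_zero T \<in> Nt_space \<Omega> T k" and Nn_space_zero: "trace_zero T \<in> Nn_space \<Omega> T k"
  using M_space_zero[of T k] by (auto simp: Nt_space_def Nn_space_def trace_zero_apply)

lemma M_space_L2_bdry:
  assumes "\<mu> \<in> M_space T k" "K \<in> T" "polygon K"
  shows "\<mu> K \<in> L2_bdry K"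
  unfolding L2_bdry_def
proof clarify
  fix a b assume e: "(a, b) \<in> edge_ends K"
  then have "closed_segment a b \<in> edges K" by (auto simp: edges_def)
  moreover have "\<mu> K \<in> edge_poly_space K k" using assms(1,2) by (auto simp: M_space_def)
  then have "\<forall>F\<in>edges K. \<exists>p\<in>vpolys k. \<forall>x\<in>rel_interior F. \<mu> K x = p x" unfolding edge_poly_space_def by blast
  ultimately obtain p where p: "p \<in> vpolys k" "\<forall>x\<in>rel_interior (closed_segment a b). \<mu> K x = p x"
    by blast
  have "(\<lambda>t. p (linepath a b t)) \<in> L2 {0..1}"
    by (intro L2_continuous continuous_on_compose2[OF vpolys_continuous[OF p(1), of UNIV]] continuous_on_linepath) auto
  moreover have "p (linepath a b t) = \<mu> K (linepath a b t)" if "0 < t" "t < 1" for t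
    using bspec[OF p(2) edge_point[OF assms(3) e that]] by (rule sym)
  ultimately show "(\<lambda>t. \<mu> K (linepath a b t)) \<in> L2 {0..1}"
    by (intro L2_null_cong[OF _ null_endpoints _ \<open>(\<lambda>t. p (linepath a b t)) \<in> L2 {0..1}\<close>]) auto
qed

section \<open>The condensed problem and the HDG system\<close>

locale hdg_mesh =
  fixes \<Omega> :: "point set" and \<rho> :: real and T :: "element set" and k :: nat and \<alpha> \<tau> :: real
    and f :: "point \<Rightarrow> point"
  assumes domain: "polygonal_domain \<Omega>" and mesh: "quasi_uniform_mesh \<Omega> \<rho> T" and f: "f \<in> L2 \<Omega>"
    and pos: "\<alpha> > 0" "\<tau> > 0"
begin

lemma finite_T: "finite T" and polygon_T: "K \<in> T \<Longrightarrow> polygon K"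
  and cells_T: "(\<Union>K\<in>T. cell K) = closure \<Omega>"
  and cover_T: "all_edges T = interior_edges T \<union> boundary_edges \<Omega> T"
  and disjoint_T: "K \<in> T \<Longrightarrow> K' \<in> T \<Longrightarrow> K \<noteq> K' \<Longrightarrow> interior (cell K) \<inter> interior (cell K') = {}"
  using mesh by (auto simp: quasi_uniform_mesh_def)

lemma compact_closure: "compact (closure \<Omega>)"
  using domain by (auto simp: polygonal_domain_def compact_eq_bounded_closed)

lemma cell_subset: "K \<in> T \<Longrightarrow> cell K \<subseteq> closure \<Omega>"
  using cells_T by blast

text \<open>The mesh condition only bounds the radius from below by a multiple of the mesh size.
  This is positive, as the mesh size is at least the length of any edge.\<close>

lemma star_T:
  assumes K: "K \<in> T"
  shows "\<exists>c r. star_polygon K c r"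
proof -
  have "\<forall>K\<in>T. \<exists>c r. 2 * r \<ge> \<rho> * mesh_size T \<and> star_shaped_wrt_ball (cell K) c r"
    using mesh unfolding quasi_uniform_mesh_def by (elim conjE)
  then obtain c r where r: "2 * r \<ge> \<rho> * mesh_size T" "star_shaped_wrt_ball (cell K) c r"
    using K by blast
  obtain a b d L where Kl: "K = a # b # d # L" using polygon_length[OF polygon_T[OF K]] .
  then have e: "(a, b) \<in> edge_ends K" by (simp add: edge_ends_def)
  have "a \<noteq> b" using polygon_edge_distinct[OF polygon_T[OF K] e] by simp
  have "closed_segment a b \<subseteq> cell K"
    using bdry_Union[of K] e Kl unfolding cell_def by blast
  then have "a \<in> cell K" "b \<in> cell K" by auto
  moreover have "bounded (cell K)"
    using compact_closure cell_subset[OF K] bounded_subset compact_imp_bounded by blast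
  ultimately have "dist a b \<le> diameter (cell K)" by (intro diameter_bounded_bound)
  also have "\<dots> \<le> mesh_size T" unfolding mesh_size_def using finite_T K by (intro Max_ge) auto
  finally have "dist a b \<le> mesh_size T" .
  moreover have "0 < dist a b" using \<open>a \<noteq> b\<close> by simp
  ultimately have "0 < mesh_size T" by linarith
  moreover have "\<rho> > 0" using mesh by (simp add: quasi_uniform_mesh_def)
  ultimately have "0 < \<rho> * mesh_size T" by simp
  then have "0 < r" using r(1) by linarith
  then show ?thesis using r(2) polygon_T[OF K] by (intro exI) (rule star_polygon.intro)
qed

text \<open>The cell lies in the closure of \<Omega>, while the source is given on \<Omega>. The
  frontier is a finite union of segments and hence null, so extension by zero changes no
  integral.\<close>

lemma source_L2:
  assumes K: "K \<in> T"
  shows "f \<in> L2 (cell K)"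
proof -
  obtain c r where "star_polygon K c r" using star_T[OF K] by blast
  then interpret star_polygon K c r .
  have cellL: "cell K \<in> sets lebesgue" using cell_compact by (simp add: lmeasurable_compact fmeasurableD)
  have \<Omega>L: "\<Omega> \<in> sets lebesgue" using domain by (simp add: polygonal_domain_def)
  obtain S where S: "finite S" "frontier \<Omega> = (\<Union>(a, b)\<in>S. closed_segment a b)"
    using domain by (auto simp: polygonal_domain_def)
  have "negligible (frontier \<Omega>)" unfolding S(2)
    using S(1) negligible_segment by (intro negligible_Union) auto
  then have N: "frontier \<Omega> \<in> null_sets lebesgue" by (simp add: negligible_iff_null_sets)
  define g where "g = (\<lambda>x. if x \<in> \<Omega> then f x else 0)"
  have gm: "g \<in> borel_measurable lebesgue"
    using f \<Omega>L by (simp add: g_def borel_measurable_if L2_def)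
  have "integrable lebesgue (\<lambda>x. indicator \<Omega> x *\<^sub>R (norm (f x))\<^sup>2)"
    using f \<Omega>L by (simp add: L2_def integrable_restrict_space)
  moreover have "(\<lambda>x. indicator \<Omega> x *\<^sub>R (norm (f x))\<^sup>2) = (\<lambda>x. (norm (g x))\<^sup>2)"
    by (auto simp: g_def indicator_def)
  ultimately have "integrable lebesgue (\<lambda>x. (norm (g x))\<^sup>2)" by simp
  then have "integrable lebesgue (\<lambda>x. indicator (cell K) x *\<^sub>R (norm (g x))\<^sup>2)"
    using cellL by (rule integrable_mult_indicator[rotated])
  then have "g \<in> L2 (cell K)"
    using cellL gm by (simp add: L2_def integrable_restrict_space measurable_restrict_space1)
  then show ?thesis
  proof (rule L2_null_cong[OF cellL N, rotated])
    fix x assume "x \<in> cell K" "x \<notin> frontier \<Omega>"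
    then have "x \<in> \<Omega>" using cell_subset[OF K] closure_Un_frontier[of \<Omega>] by blast
    then show "g x = f x" by (simp add: g_def)
  qed
qed

abbreviation Nspace :: "trace_pair set" where
  "Nspace \<equiv> Nt_space \<Omega> T k \<times> Nn_space \<Omega> T k"

definition comb :: "trace_pair \<Rightarrow> real \<Rightarrow> trace_pair \<Rightarrow> trace_pair" where
  "comb \<mu> d \<nu> = (trace_comb T (fst \<mu>) d (fst \<nu>), trace_comb T (snd \<mu>) d (snd \<nu>))"

definition zero :: trace_pair where
  "zero = (trace_zero T, trace_zero T)"

abbreviation SS :: "trace_pair \<Rightarrow> element \<Rightarrow> point \<Rightarrow> real" where
  "SS \<mu> K \<equiv> Sigma_trace k \<alpha> \<tau> K (fst \<mu> K) (snd \<mu> K)"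

abbreviation PP :: "trace_pair \<Rightarrow> element \<Rightarrow> point \<Rightarrow> real" where
  "PP \<mu> K \<equiv> Phi_trace k \<alpha> \<tau> K (fst \<mu> K) (snd \<mu> K)"

abbreviation UU :: "trace_pair \<Rightarrow> element \<Rightarrow> point \<Rightarrow> point" where
  "UU \<mu> K \<equiv> U_trace k \<alpha> \<tau> K (fst \<mu> K) (snd \<mu> K)"

definition element_form :: "element \<Rightarrow> trace_pair \<Rightarrow> trace_pair \<Rightarrow> real" where
  "element_form K \<mu> \<nu> = ip K (SS \<mu> K) (SS \<nu> K) + ip K (PP \<mu> K) (PP \<nu> K)
    + inverse \<alpha> * bip K (tangential K (\<lambda>y. UU \<mu> K y - fst \<mu> K y)) (tangential K (\<lambda>y. UU \<nu> K y - fst \<nu> K y))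
    + inverse \<tau> * bip K (normal_comp K (\<lambda>y. UU \<mu> K y - snd \<mu> K y)) (normal_comp K (\<lambda>y. UU \<nu> K y - snd \<nu> K y))"

lemma a_form_eq: "a_form T k \<alpha> \<tau> \<mu> \<nu> = (\<Sum>K\<in>T. element_form K \<mu> \<nu>)"
  unfolding a_form_def element_form_def case_prod_beta' bip_scale_left by (simp add: sum.distrib)

lemma l_form_eq: "l_form T k \<alpha> \<tau> f \<mu> = (\<Sum>K\<in>T. ip K f (UU \<mu> K))"
  by (simp add: l_form_def case_prod_beta')

lemma N_comb: "\<mu> \<in> Nspace \<Longrightarrow> \<nu> \<in> Nspace \<Longrightarrow> comb \<mu> d \<nu> \<in> Nspace"
  by (auto simp: comb_def intro: Nt_space_comb Nn_space_comb)

lemma N_zero: "zero \<in> Nspace"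
  by (simp add: zero_def Nt_space_zero Nn_space_zero)

lemma N_L2:
  assumes "\<mu> \<in> Nspace" "K \<in> T"
  shows "fst \<mu> K \<in> L2_bdry K" "snd \<mu> K \<in> L2_bdry K"
proof -
  have "fst \<mu> \<in> M_space T k" "snd \<mu> \<in> M_space T k"
    using assms(1) by (auto dest: Nt_space_M Nn_space_M)
  then show "fst \<mu> K \<in> L2_bdry K" "snd \<mu> K \<in> L2_bdry K"
    using M_space_L2_bdry[OF _ assms(2) polygon_T[OF assms(2)]] by blast+
qed

lemma N_solves:
  assumes "\<mu> \<in> Nspace" "K \<in> T"
  shows "local_problem k \<alpha> \<tau> K (fst \<mu> K) (snd \<mu> K) (\<lambda>_. 0) (SS \<mu> K, PP \<mu> K, UU \<mu> K)"
proof -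
  obtain c r where "star_polygon K c r" using star_T[OF assms(2)] by blast
  then interpret star_polygon K c r .
  show ?thesis by (rule trace_solves[OF N_L2[OF assms] pos])
qed

lemma N_solves_polys:
  assumes "\<mu> \<in> Nspace" "K \<in> T"
  shows "SS \<mu> K \<in> polys k" "PP \<mu> K \<in> polys k" "UU \<mu> K \<in> vpolys k"
  using N_solves[OF assms] by (auto simp: local_problem_def)

lemma edge_in_edges: "(a, b) \<in> edge_ends K \<Longrightarrow> closed_segment a b \<in> edges K"
  by (auto simp: edges_def)

lemma comb_apply:
  assumes "K \<in> T" "(a, b) \<in> edge_ends K" "0 < t" "t < 1"
  shows "fst (comb \<mu> d \<nu>) K (linepath a b t) = fst \<mu> K (linepath a b t) + d *\<^sub>R fst \<nu> K (linepath a b t)"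
    "snd (comb \<mu> d \<nu>) K (linepath a b t) = snd \<mu> K (linepath a b t) + d *\<^sub>R snd \<nu> K (linepath a b t)"
  using edge_point[OF polygon_T[OF assms(1)] assms(2-4)] edge_in_edges[OF assms(2)] assms(1)
  by (simp_all add: comb_def trace_comb_apply)

text \<open>The combination of the two local solutions solves the local problem for the combined
  traces, and uniqueness identifies it with the definite description.\<close>

lemma solution_comb:
  assumes \<mu>: "\<mu> \<in> Nspace" and \<nu>: "\<nu> \<in> Nspace" and K: "K \<in> T"
  shows "SS (comb \<mu> d \<nu>) K = (\<lambda>x. SS \<mu> K x + d * SS \<nu> K x)"
    "PP (comb \<mu> d \<nu>) K = (\<lambda>x. PP \<mu> K x + d * PP \<nu> K x)"
    "UU (comb \<mu> d \<nu>) K = (\<lambda>x. UU \<mu> K x + d *\<^sub>R UU \<nu> K x)"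
proof -
  obtain c r where "star_polygon K c r" using star_T[OF K] by blast
  then interpret star_polygon K c r .
  have "local_problem k \<alpha> \<tau> K (\<lambda>x. fst \<mu> K x + d *\<^sub>R fst \<nu> K x) (\<lambda>x. snd \<mu> K x + d *\<^sub>R snd \<nu> K x) (\<lambda>_. 0)
    (\<lambda>x. SS \<mu> K x + d * SS \<nu> K x, \<lambda>x. PP \<mu> K x + d * PP \<nu> K x, \<lambda>x. UU \<mu> K x + d *\<^sub>R UU \<nu> K x)"
    using local_problem_comb[OF N_solves[OF \<mu> K] N_solves[OF \<nu> K] N_L2[OF \<mu> K] N_L2[OF \<nu> K] L2_zero L2_zero, of d] by simp
  also have "local_problem k \<alpha> \<tau> K (\<lambda>x. fst \<mu> K x + d *\<^sub>R fst \<nu> K x) (\<lambda>x. snd \<mu> K x + d *\<^sub>R snd \<nu> K x) (\<lambda>_. 0)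
    = local_problem k \<alpha> \<tau> K (fst (comb \<mu> d \<nu>) K) (snd (comb \<mu> d \<nu>) K) (\<lambda>_. 0)"
    by (rule local_problem_cong) (simp_all add: comb_apply[OF K])
  finally have s: "local_problem k \<alpha> \<tau> K (fst (comb \<mu> d \<nu>) K) (snd (comb \<mu> d \<nu>) K) (\<lambda>_. 0)
    (\<lambda>x. SS \<mu> K x + d * SS \<nu> K x, \<lambda>x. PP \<mu> K x + d * PP \<nu> K x, \<lambda>x. UU \<mu> K x + d *\<^sub>R UU \<nu> K x)" .
  note c = N_comb[OF \<mu> \<nu>, of d]
  show "SS (comb \<mu> d \<nu>) K = (\<lambda>x. SS \<mu> K x + d * SS \<nu> K x)"
    "PP (comb \<mu> d \<nu>) K = (\<lambda>x. PP \<mu> K x + d * PP \<nu> K x)"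
    "UU (comb \<mu> d \<nu>) K = (\<lambda>x. UU \<mu> K x + d *\<^sub>R UU \<nu> K x)"
    by (rule local_problem_unique[OF N_solves[OF c K] s N_L2[OF c K] L2_zero pos])+
qed

lemma element_form_commute: "element_form K \<mu> \<nu> = element_form K \<nu> \<mu>"
  by (simp add: element_form_def ip_commute bip_commute)

lemma element_form_nonneg: "0 \<le> element_form K \<mu> \<mu>"
  unfolding element_form_def using pos by (intro add_nonneg_nonneg mult_nonneg_nonneg ip_nonneg bip_nonneg) auto

lemma element_form_comb:
  assumes \<mu>: "\<mu> \<in> Nspace" and \<nu>: "\<nu> \<in> Nspace" and \<kappa>: "\<kappa> \<in> Nspace" and K: "K \<in> T"
  shows "element_form K (comb \<mu> d \<nu>) \<kappa> = element_form K \<mu> \<kappa> + d * element_form K \<nu> \<kappa>"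
proof -
  obtain c r where "star_polygon K c r" using star_T[OF K] by blast
  then interpret star_polygon K c r .
  have diff: "(\<lambda>y. UU \<xi> K y - fst \<xi> K y) \<in> L2_bdry K" "(\<lambda>y. UU \<xi> K y - snd \<xi> K y) \<in> L2_bdry K" if "\<xi> \<in> Nspace" for \<xi>
    using L2_bdry_comb[OF vpolys_L2_bdry[OF N_solves_polys(3)[OF that K]] N_L2(1)[OF that K], of "-1"]
      L2_bdry_comb[OF vpolys_L2_bdry[OF N_solves_polys(3)[OF that K]] N_L2(2)[OF that K], of "-1"] by simp_all
  note td = tangential_L2_bdry(1)[OF diff(1)] and nd = tangential_L2_bdry(2)[OF diff(2)]
  have t: "bip K (tangential K (\<lambda>y. UU (comb \<mu> d \<nu>) K y - fst (comb \<mu> d \<nu>) K y)) h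
    = bip K (\<lambda>x. tangential K (\<lambda>y. UU \<mu> K y - fst \<mu> K y) x + d * tangential K (\<lambda>y. UU \<nu> K y - fst \<nu> K y) x) h" for h
    by (rule bip_cong) (simp add: solution_comb[OF \<mu> \<nu> K] comb_apply[OF K] inner_diff_left inner_add_left algebra_simps)
  have n: "bip K (normal_comp K (\<lambda>y. UU (comb \<mu> d \<nu>) K y - snd (comb \<mu> d \<nu>) K y)) h
    = bip K (\<lambda>x. normal_comp K (\<lambda>y. UU \<mu> K y - snd \<mu> K y) x + d * normal_comp K (\<lambda>y. UU \<nu> K y - snd \<nu> K y) x) h" for h
    by (rule bip_cong) (simp add: solution_comb[OF \<mu> \<nu> K] comb_apply[OF K] inner_diff_left inner_add_left algebra_simps)
  have ipc: "ip K (\<lambda>x. p x + d * q x) w = ip K p w + d * ip K q w" if "p \<in> polys k" "q \<in> polys k" "w \<in> polys k" for p q w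
    using ip_comb_left[OF polys_L2[OF that(1)] polys_L2[OF that(2)] polys_L2[OF that(3)], of d] by simp
  note p\<mu> = N_solves_polys[OF \<mu> K] and p\<nu> = N_solves_polys[OF \<nu> K] and p\<kappa> = N_solves_polys[OF \<kappa> K]
  show ?thesis
    unfolding element_form_def t n bip_comb_left[OF td[OF \<mu>] td[OF \<nu>] td[OF \<kappa>]] bip_comb_left[OF nd[OF \<mu>] nd[OF \<nu>] nd[OF \<kappa>]]
      solution_comb(1,2)[OF \<mu> \<nu> K] ipc[OF p\<mu>(1) p\<nu>(1) p\<kappa>(1)] ipc[OF p\<mu>(2) p\<nu>(2) p\<kappa>(2)]
    by (simp only: distrib_left mult.left_commute[of d])
qed

lemma a_form_comb:
  assumes "\<mu> \<in> Nspace" "\<nu> \<in> Nspace" "\<kappa> \<in> Nspace"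
  shows "a_form T k \<alpha> \<tau> (comb \<mu> d \<nu>) \<kappa> = a_form T k \<alpha> \<tau> \<mu> \<kappa> + d * a_form T k \<alpha> \<tau> \<nu> \<kappa>"
  unfolding a_form_eq by (simp add: element_form_comb[OF assms] sum.distrib sum_distrib_left)

lemma a_form_commute: "a_form T k \<alpha> \<tau> \<mu> \<nu> = a_form T k \<alpha> \<tau> \<nu> \<mu>"
  unfolding a_form_eq by (simp add: element_form_commute)

lemma l_form_comb:
  assumes \<mu>: "\<mu> \<in> Nspace" and \<nu>: "\<nu> \<in> Nspace"
  shows "l_form T k \<alpha> \<tau> f (comb \<mu> d \<nu>) = l_form T k \<alpha> \<tau> f \<mu> + d * l_form T k \<alpha> \<tau> f \<nu>"
proof -
  have "ip K f (UU (comb \<mu> d \<nu>) K) = ip K f (UU \<mu> K) + d * ip K f (UU \<nu> K)" if K: "K \<in> T" for K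
  proof -
    obtain c r where "star_polygon K c r" using star_T[OF K] by blast
    then interpret star_polygon K c r .
    show ?thesis unfolding solution_comb[OF \<mu> \<nu> K]
      by (intro ip_comb_right vpolys_L2[OF N_solves_polys(3)] source_L2 assms K)
  qed
  then show ?thesis unfolding l_form_eq by (simp add: sum.distrib sum_distrib_left)
qed

text \<open>Weierstrass approximation on \<open>closure \<Omega>\<close> reduces to continuous test functions, and testing with
  \<open>V K\<^sub>0\<close> times a bump supported in the element \<open>K\<^sub>0\<close> isolates that element.\<close>

lemma moments_zero:
  assumes V: "\<And>K. K \<in> T \<Longrightarrow> V K \<in> polys k"
    and m: "\<And>m. real_polynomial_function m \<Longrightarrow> (\<Sum>K\<in>T. ip K (V K) m) = 0"
    and K0: "K0 \<in> T"
  shows "V K0 = (\<lambda>_. 0)"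
proof -
  have cont: "continuous_on S (V K)" if "K \<in> T" for K S using V[OF that] by (rule polys_continuous)
  have cpt: "compact (cell K)" if "K \<in> T" for K
    using star_T[OF that] star_polygon.cell_compact by blast
  have zero: "(\<Sum>K\<in>T. ip K (V K) h) = 0" if h: "continuous_on UNIV h" for h
  proof (rule ccontr)
    define C where "C = (\<Sum>K\<in>T. LINT x|lebesgue_on (cell K). \<bar>V K x\<bar>)"
    define A where "A = (\<Sum>K\<in>T. ip K (V K) h)"
    assume "(\<Sum>K\<in>T. ip K (V K) h) \<noteq> 0"
    then have A: "\<bar>A\<bar> > 0" by (simp add: A_def)
    have C: "0 \<le> C" unfolding C_def by (intro sum_nonneg) auto
    \<comment> \<open>The approximation error is at most \<open>e * C\<close>, which has to stay
      below the assumed nonzero sum; adding 1 keeps the denominator positive when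
      \<open>C = 0\<close>.\<close>
    define e where "e = \<bar>A\<bar> / (2 * (C + 1))"
    have e: "0 < e" using A C by (simp add: e_def)
    obtain p where p: "real_polynomial_function p" "\<And>x. x \<in> closure \<Omega> \<Longrightarrow> \<bar>h x - p x\<bar> < e"
      using Stone_Weierstrass_real_polynomial_function[OF compact_closure continuous_on_subset[OF h subset_UNIV] e] by metis
    have cp: "continuous_on S p" for S using p(1) by (rule real_polynomial_continuous)
    have ch: "continuous_on S h" for S using h continuous_on_subset by blast
    have le: "\<bar>ip K (V K) h - ip K (V K) p\<bar> \<le> e * (LINT x|lebesgue_on (cell K). \<bar>V K x\<bar>)" if K: "K \<in> T" for K
    proof -
      have "ip K (V K) h - ip K (V K) p = (LINT x|lebesgue_on (cell K). V K x * (h x - p x))"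
        unfolding ip_def using K
        by (subst Bochner_Integration.integral_diff[symmetric])
          (auto intro!: integrable_lebesgue_on_compact cpt continuous_intros cont ch cp simp: algebra_simps)
      also have "\<bar>\<dots>\<bar> \<le> (LINT x|lebesgue_on (cell K). \<bar>V K x * (h x - p x)\<bar>)"
        by (rule integral_abs_bound)
      also have "\<dots> \<le> (LINT x|lebesgue_on (cell K). e * \<bar>V K x\<bar>)"
      proof (rule integral_mono)
        show "\<bar>V K x * (h x - p x)\<bar> \<le> e * \<bar>V K x\<bar>" if "x \<in> space (lebesgue_on (cell K))" for x
          using p(2)[of x] that cell_subset[OF K] mult_left_mono[of "\<bar>h x - p x\<bar>" e "\<bar>V K x\<bar>"]
          by (auto simp: abs_mult mult.commute intro: less_imp_le)
      qed (intro integrable_lebesgue_on_compact cpt K continuous_intros cont ch cp)+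
      finally show ?thesis by simp
    qed
    have "A = (\<Sum>K\<in>T. ip K (V K) h - ip K (V K) p)" using m[OF p(1)] by (simp add: A_def sum_subtractf)
    also have "\<bar>\<dots>\<bar> \<le> (\<Sum>K\<in>T. \<bar>ip K (V K) h - ip K (V K) p\<bar>)" by (rule sum_abs)
    also have "\<dots> \<le> (\<Sum>K\<in>T. e * (LINT x|lebesgue_on (cell K). \<bar>V K x\<bar>))" using le by (intro sum_mono)
    also have "\<dots> = e * C" by (simp add: C_def sum_distrib_left)
    also have "\<dots> \<le> \<bar>A\<bar> / 2" using C A by (simp add: e_def field_simps)
    finally show False using A by simp
  qed
  obtain c r where "star_polygon K0 c r" using star_T[OF K0] by blast
  then interpret star_polygon K0 c r .
  obtain x0 d where d: "d > 0" "ball x0 d \<subseteq> interior (cell K0)"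
    using interior_ne open_interior[of "cell K0"] by (metis all_not_in_conv openE)
  \<comment> \<open>A cone over the ball: continuous on the whole plane, positive exactly inside the
    ball.\<close>
  define b where "b x = max 0 (d - dist x0 x)" for x
  define h where "h x = V K0 x * b x" for x
  have cb: "continuous_on S b" for S unfolding b_def by (intro continuous_intros)
  have ch: "continuous_on S h" for S unfolding h_def by (intro continuous_intros cb cont K0)
  have off: "ip K (V K) h = 0" if K: "K \<in> T - {K0}" for K
  proof -
    have "h x = 0" if "x \<in> cell K" for x
    proof -
      obtain c' r' where st: "star_polygon K c' r'" using star_T K by blast
      have "interior (cell K0) \<inter> interior (cell K) = {}" using disjoint_T[OF K0, of K] K by auto
      \<comment> \<open>Disjoint interiors suffice, since a cell is the closure of its interior and
        so cannot reach the open interior of another cell.\<close>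
      then have "interior (cell K0) \<inter> cell K = {}"
        using star_polygon.cell_closure[OF st] open_Int_closure_eq_empty[OF open_interior] by metis
      then have "x \<notin> ball x0 d" using d that by blast
      then show ?thesis by (simp add: h_def b_def)
    qed
    then have "ip K (V K) h = (LINT x|lebesgue_on (cell K). 0)"
      unfolding ip_def by (intro Bochner_Integration.integral_cong) auto
    then show ?thesis by simp
  qed
  have "ip K0 (V K0) h = 0"
    using zero[OF ch] sum.remove[OF finite_T K0, of "\<lambda>K. ip K (V K) h"] off by simp
  then have z: "(LINT x|lebesgue_on (cell K0). V K0 x * (V K0 x * b x)) = 0" by (simp add: ip_def h_def)
  have "V K0 x = 0" if x: "x \<in> ball x0 d" for x
  proof -
    have "V K0 x * (V K0 x * b x) = 0"
    proof (rule continuous_integral_zero[OF cell_compact _ _ z])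
      show "x \<in> interior (cell K0)" using d x by blast
      show "continuous_on (cell K0) (\<lambda>x. V K0 x * (V K0 x * b x))" by (intro continuous_intros cb cont K0)
      show "0 \<le> V K0 x * (V K0 x * b x)" for x
        by (simp add: b_def mult.assoc[symmetric])
    qed
    then show ?thesis using x by (simp add: b_def)
  qed
  then show ?thesis using polys_vanish_open[OF V[OF K0] open_ball, of x0 x0 d] d(1) by simp
qed

section \<open>Definiteness and solvability of the condensed problem\<close>

lemma a_form_definite:
  assumes \<mu>: "\<mu> \<in> Nspace" and z: "a_form T k \<alpha> \<tau> \<mu> \<mu> = 0"
  shows "\<mu> = zero"
proof -
  have Nt: "fst \<mu> \<in> Nt_space \<Omega> T k" and Nn: "snd \<mu> \<in> Nn_space \<Omega> T k" using \<mu> by auto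
  have ez: "element_form K \<mu> \<mu> = 0" if "K \<in> T" for K
    using z that finite_T element_form_nonneg unfolding a_form_eq by (simp add: sum_nonneg_eq_0_iff)
  \<comment> \<open>On one element, vanishing energy turns the moments of \<open>U\<close> against
    gradients and curls into pairings with the given traces; only these can be compared across
    elements.\<close>
  have elem: "(\<forall>a b t. (a, b) \<in> edge_ends K \<longrightarrow> 0 < t \<longrightarrow> t < 1 \<longrightarrow>
        tangential K (UU \<mu> K) (linepath a b t) = tangential K (fst \<mu> K) (linepath a b t) \<and>
        normal_comp K (UU \<mu> K) (linepath a b t) = normal_comp K (snd \<mu> K) (linepath a b t)) \<and>
      (\<forall>\<phi>. real_polynomial_function \<phi> \<longrightarrow>
        ip K (UU \<mu> K) (curl \<phi>) = bip K \<phi> (tangential K (fst \<mu> K)) \<and>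
        ip K (UU \<mu> K) (grad \<phi>) = bip K \<phi> (normal_comp K (snd \<mu> K)))" if K: "K \<in> T" for K
  proof -
    obtain c r where "star_polygon K c r" using star_T[OF K] by blast
    then interpret star_polygon K c r .
    note s = N_solves[OF \<mu> K] and P = N_solves_polys[OF \<mu> K]
    have "0 \<le> inverse \<alpha> * bip K (tangential K (\<lambda>y. UU \<mu> K y - fst \<mu> K y)) (tangential K (\<lambda>y. UU \<mu> K y - fst \<mu> K y))"
      "0 \<le> inverse \<tau> * bip K (normal_comp K (\<lambda>y. UU \<mu> K y - snd \<mu> K y)) (normal_comp K (\<lambda>y. UU \<mu> K y - snd \<mu> K y))"
      using pos by (intro mult_nonneg_nonneg bip_nonneg; simp)+
    then have zs: "ip K (SS \<mu> K) (SS \<mu> K) = 0" "ip K (PP \<mu> K) (PP \<mu> K) = 0"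
      "inverse \<alpha> * bip K (tangential K (\<lambda>y. UU \<mu> K y - fst \<mu> K y)) (tangential K (\<lambda>y. UU \<mu> K y - fst \<mu> K y)) = 0"
      "inverse \<tau> * bip K (normal_comp K (\<lambda>y. UU \<mu> K y - snd \<mu> K y)) (normal_comp K (\<lambda>y. UU \<mu> K y - snd \<mu> K y)) = 0"
      using ez[OF K] ip_nonneg[of K "SS \<mu> K"] ip_nonneg[of K "PP \<mu> K"] unfolding element_form_def by linarith+
    have S0: "SS \<mu> K = (\<lambda>_. 0)" and P0: "PP \<mu> K = (\<lambda>_. 0)" using polys_ip_definite P zs by blast+
    have bz: "bip K (tangential K (\<lambda>y. UU \<mu> K y - fst \<mu> K y)) (tangential K (\<lambda>y. UU \<mu> K y - fst \<mu> K y)) = 0"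
      "bip K (normal_comp K (\<lambda>y. UU \<mu> K y - snd \<mu> K y)) (normal_comp K (\<lambda>y. UU \<mu> K y - snd \<mu> K y)) = 0"
      using zs(3,4) pos by simp_all
    have edge: "tangential K (UU \<mu> K) (linepath a b t) = tangential K (fst \<mu> K) (linepath a b t) \<and>
        normal_comp K (UU \<mu> K) (linepath a b t) = normal_comp K (snd \<mu> K) (linepath a b t)"
      if e: "(a, b) \<in> edge_ends K" and t: "0 < t" "t < 1" for a b t
    proof -
      have ab: "a \<noteq> b" using edge_distinct[OF e] by simp
      have "fst \<mu> K \<in> edge_poly_space K k" "snd \<mu> K \<in> edge_poly_space K k"
        using K Nt_space_M[OF Nt] Nn_space_M[OF Nn] by (auto simp: M_space_def)
      \<comment> \<open>The edge polynomials supply the continuous representatives up to the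
        vertices, where the traces themselves are unspecified.\<close>
      then obtain p q where p: "p \<in> vpolys k" "\<forall>x\<in>rel_interior (closed_segment a b). fst \<mu> K x = p x"
        and q: "q \<in> vpolys k" "\<forall>x\<in>rel_interior (closed_segment a b). snd \<mu> K x = q x"
        using edge_in_edges[OF e] unfolding edge_poly_space_def by blast
      have eqs: "fst \<mu> K (linepath a b t) = p (linepath a b t)" "snd \<mu> K (linepath a b t) = q (linepath a b t)"
        if "0 < t" "t < 1" for t
        using bspec[OF p(2) edge_point[OF polygon e that]] bspec[OF q(2) edge_point[OF polygon e that]] by simp_all
      have cont: "continuous_on {0..1} (\<lambda>t. w (linepath a b t))" if "w \<in> vpolys k" for w
        by (intro continuous_on_compose2[OF vpolys_continuous[OF that, of UNIV]] continuous_on_linepath) auto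
      have "tangential K (\<lambda>y. UU \<mu> K y - fst \<mu> K y) (linepath a b t) = 0"
        by (rule bip_eq_zeroD[OF bz(1) e ab, where h = "\<lambda>t. (UU \<mu> K (linepath a b t) - p (linepath a b t)) \<bullet> perp (edge_normal a b)"])
          (use t in \<open>auto intro!: continuous_on_inner continuous_on_diff[OF cont[OF P(3)] cont[OF p(1)]] simp: eqs outward_normal_linepath[OF e]\<close>)
      moreover have "normal_comp K (\<lambda>y. UU \<mu> K y - snd \<mu> K y) (linepath a b t) = 0"
        by (rule bip_eq_zeroD[OF bz(2) e ab, where h = "\<lambda>t. (UU \<mu> K (linepath a b t) - q (linepath a b t)) \<bullet> edge_normal a b"])
          (use t in \<open>auto intro!: continuous_on_inner continuous_on_diff[OF cont[OF P(3)] cont[OF q(1)]] simp: eqs outward_normal_linepath[OF e]\<close>)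
      ultimately show ?thesis by (simp add: inner_diff_left)
    qed
    have bt: "bip K (tangential K (UU \<mu> K)) \<phi> = bip K (tangential K (fst \<mu> K)) \<phi>"
      and bn: "bip K (normal_comp K (UU \<mu> K)) \<phi> = bip K (normal_comp K (snd \<mu> K)) \<phi>" for \<phi>
      by (intro bip_cong; simp add: edge)+
    have rd: "rot (UU \<mu> K) = (\<lambda>_. 0)" "divg (UU \<mu> K) = (\<lambda>_. 0)"
      using s unfolding S0 P0
      by (auto simp: local_problem_def ip_zero_left bt bn intro!: div_rot_zero[OF P(3)])
    have "ip K (UU \<mu> K) (curl \<phi>) = bip K \<phi> (tangential K (fst \<mu> K)) \<and>
        ip K (UU \<mu> K) (grad \<phi>) = bip K \<phi> (normal_comp K (snd \<mu> K))" if "real_polynomial_function \<phi>" for \<phi>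
      using ibp_curl[OF that P(3)] ibp_grad[OF that P(3)] bt[of \<phi>] bn[of \<phi>]
      by (simp add: rd ip_zero_right bip_commute[of K \<phi>])
    then show ?thesis using edge by blast
  qed
  have L2s: "tangential K (fst \<mu> K) \<in> L2_bdry K" "normal_comp K (snd \<mu> K) \<in> L2_bdry K" if K: "K \<in> T" for K
  proof -
    obtain c r where "star_polygon K c r" using star_T[OF K] by blast
    then interpret star_polygon K c r .
    show "tangential K (fst \<mu> K) \<in> L2_bdry K" "normal_comp K (snd \<mu> K) \<in> L2_bdry K"
      using tangential_L2_bdry N_L2[OF \<mu> K] by blast+
  qed
  have sums: "(\<Sum>K\<in>T. ip K (UU \<mu> K) (curl \<phi>)) = 0" "(\<Sum>K\<in>T. ip K (UU \<mu> K) (grad \<phi>)) = 0"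
    if \<phi>: "real_polynomial_function \<phi>" for \<phi>
  proof -
    have \<phi>L: "\<phi> \<in> L2_bdry K" for K by (intro L2_bdry_continuous real_polynomial_continuous \<phi>)
    have "(\<Sum>K\<in>T. bip K \<phi> (tangential K (fst \<mu> K))) = 0"
      by (rule skeleton_cancellation[OF finite_T polygon_T cover_T L2s(1) \<phi>L]) (use Nt in \<open>unfold Nt_space_def, blast+\<close>)
    moreover have "(\<Sum>K\<in>T. bip K \<phi> (normal_comp K (snd \<mu> K))) = 0"
      by (rule skeleton_cancellation[OF finite_T polygon_T cover_T L2s(2) \<phi>L]) (use Nn in \<open>unfold Nn_space_def, blast+\<close>)
    ultimately show "(\<Sum>K\<in>T. ip K (UU \<mu> K) (curl \<phi>)) = 0" "(\<Sum>K\<in>T. ip K (UU \<mu> K) (grad \<phi>)) = 0"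
      using elem \<phi> by simp_all
  qed
  have U0: "UU \<mu> K = (\<lambda>_. 0)" if K: "K \<in> T" for K
  proof -
    have split: "ip K (UU \<mu> K) (\<lambda>x. grad \<phi> x + curl \<psi> x) = ip K (UU \<mu> K) (grad \<phi>) + ip K (UU \<mu> K) (curl \<psi>)"
      if K: "K \<in> T" and p: "real_polynomial_function \<phi>" "real_polynomial_function \<psi>" for K \<phi> \<psi>
    proof -
      obtain c r where "star_polygon K c r" using star_T[OF K] by blast
      then interpret star_polygon K c r .
      show ?thesis
        using ip_comb_right[OF grad_L2[OF p(1)] curl_L2[OF p(2)] vpolys_L2[OF N_solves_polys(3)[OF \<mu> K]], of 1] by simp
    qed
    have "(\<Sum>K\<in>T. ip K (\<lambda>x. fst (UU \<mu> K x)) m) = 0" "(\<Sum>K\<in>T. ip K (\<lambda>x. snd (UU \<mu> K x)) m) = 0"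
      if m: "real_polynomial_function m" for m
    proof -
      obtain \<phi> \<psi> where p: "real_polynomial_function \<phi>" "real_polynomial_function \<psi>"
        and eq: "\<forall>x. (m x, 0) = grad \<phi> x + curl \<psi> x" using polynomial_helmholtz(1)[OF m] by blast
      have "ip K (\<lambda>x. fst (UU \<mu> K x)) m = ip K (UU \<mu> K) (\<lambda>x. (m x, 0))" for K
        by (simp add: ip_def inner_prod_def)
      then show "(\<Sum>K\<in>T. ip K (\<lambda>x. fst (UU \<mu> K x)) m) = 0"
        by (simp add: eq split p sum.distrib sums del: split_paired_All)
      obtain \<phi> \<psi> where p: "real_polynomial_function \<phi>" "real_polynomial_function \<psi>"
        and eq: "\<forall>x. (0, m x) = grad \<phi> x + curl \<psi> x" using polynomial_helmholtz(2)[OF m] by blast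
      have "ip K (\<lambda>x. snd (UU \<mu> K x)) m = ip K (UU \<mu> K) (\<lambda>x. (0, m x))" for K
        by (simp add: ip_def inner_prod_def)
      then show "(\<Sum>K\<in>T. ip K (\<lambda>x. snd (UU \<mu> K x)) m) = 0"
        by (simp add: eq split p sum.distrib sums del: split_paired_All)
    qed
    then have "(\<lambda>x. fst (UU \<mu> K x)) = (\<lambda>_. 0)" "(\<lambda>x. snd (UU \<mu> K x)) = (\<lambda>_. 0)"
      using N_solves_polys(3)[OF \<mu>]
      by (intro moments_zero[where V = "\<lambda>K x. fst (UU \<mu> K x)", OF _ _ K] moments_zero[where V = "\<lambda>K x. snd (UU \<mu> K x)", OF _ _ K];
          simp add: vpolys_def)+
    then show ?thesis by (simp add: fun_eq_iff prod_eq_iff)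
  qed
  \<comment> \<open>Of the two components of each trace, one equals a component of
    \<open>U = 0\<close> and the other vanishes by the definition of its space.\<close>
  have "fst \<mu> K x = 0 \<and> snd \<mu> K x = 0" if K: "K \<in> T" and F: "F \<in> edges K" and x: "x \<in> rel_interior F" for K F x
  proof -
    obtain c r where "star_polygon K c r" using star_T[OF K] by blast
    then interpret star_polygon K c r .
    obtain a b where e: "(a, b) \<in> edge_ends K" "F = closed_segment a b" using F by (auto simp: edges_def)
    obtain t where t: "0 < t" "t < 1" "x = linepath a b t"
      using x unfolding e(2) rel_interior_edge[OF polygon e(1)] by blast
    have n: "outward_normal K x = edge_normal a b" using outward_normal_linepath[OF e(1) t(1,2)] t(3) by simp
    have "tangential K (UU \<mu> K) x = tangential K (fst \<mu> K) x" "normal_comp K (UU \<mu> K) x = normal_comp K (snd \<mu> K) x"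
      using elem[OF K] e(1) t by blast+
    then have "fst \<mu> K x \<bullet> perp (edge_normal a b) = 0" "snd \<mu> K x \<bullet> edge_normal a b = 0"
      by (simp_all add: U0[OF K] n)
    moreover have "\<forall>K\<in>T. \<forall>F\<in>edges K. \<forall>x\<in>rel_interior F. normal_comp K (fst \<mu> K) x = 0"
      using Nt unfolding Nt_space_def mem_Collect_eq by (elim conjE)
    then have "normal_comp K (fst \<mu> K) x = 0" using K F x by blast
    moreover have "\<forall>K\<in>T. \<forall>F\<in>edges K. \<forall>x\<in>rel_interior F. tangential K (snd \<mu> K) x = 0"
      using Nn unfolding Nn_space_def mem_Collect_eq by (elim conjE)
    then have "tangential K (snd \<mu> K) x = 0" using K F x by blast
    ultimately show ?thesis using normal_components_zero[OF e(1)] by (simp add: n)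
  qed
  then have "fst \<mu> = trace_zero T" "snd \<mu> = trace_zero T"
    by (auto intro!: M_space_eqI[OF Nt_space_M[OF Nt] M_space_zero] M_space_eqI[OF Nn_space_M[OF Nn] M_space_zero]
        simp: trace_zero_apply)
  then show ?thesis by (simp add: zero_def prod_eq_iff)
qed

text \<open>A polynomial of degree \<open>k\<close> on an edge is determined by \<open>k + 1\<close>
  nodes. The shift by one in numerator and denominator keeps the nodes strictly between the ends,
  where traces are defined.\<close>

lemma M_space_separation:
  assumes \<mu>: "\<mu> \<in> M_space T k"
    and z: "\<And>K a b j. K \<in> T \<Longrightarrow> (a, b) \<in> edge_ends K \<Longrightarrow> j \<le> k \<Longrightarrow>
      \<mu> K (linepath a b ((real j + 1) / (real k + 2))) = 0"
  shows "\<mu> = trace_zero T"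
proof (rule M_space_eqI[OF \<mu> M_space_zero])
  fix K F x assume K: "K \<in> T" and F: "F \<in> edges K" and x: "x \<in> rel_interior F"
  obtain a b where e: "(a, b) \<in> edge_ends K" "F = closed_segment a b" using F by (auto simp: edges_def)
  obtain t where t: "x = linepath a b t"
    using x unfolding e(2) rel_interior_edge[OF polygon_T[OF K] e(1)] by blast
  have "\<mu> K \<in> edge_poly_space K k" using K \<mu> by (auto simp: M_space_def)
  then obtain p where p: "p \<in> vpolys k" "\<forall>x\<in>rel_interior F. \<mu> K x = p x"
    using F unfolding edge_poly_space_def by blast
  define A where "A = (\<lambda>j. (real j + 1) / (real k + 2)) ` {..k}"
  have "card A = k + 1" unfolding A_def by (subst card_image) (auto simp: inj_on_def)
  then have A: "infinite A \<or> card A > k" by simp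
  have "p (linepath a b s) = 0" if "s \<in> A" for s
  proof -
    obtain j where j: "j \<le> k" "s = (real j + 1) / (real k + 2)" using \<open>s \<in> A\<close> by (auto simp: A_def)
    then have "0 < s" "s < 1" by auto
    then have "linepath a b s \<in> rel_interior F" unfolding e(2) by (rule edge_point[OF polygon_T[OF K] e(1)])
    then have "\<mu> K (linepath a b s) = p (linepath a b s)" using p(2) by blast
    then show ?thesis using z[OF K e(1) j(1)] j(2) by simp
  qed
  then have "fst (p x) = 0" "snd (p x) = 0"
    using polys_vanish_line[of "\<lambda>x. fst (p x)" k, OF _ A, of a b t] polys_vanish_line[of "\<lambda>x. snd (p x)" k, OF _ A, of a b t] p(1)
    by (simp_all add: vpolys_def t)
  moreover have "\<mu> K x = p x" using p(2) x by blast
  ultimately show "\<mu> K x = trace_zero T K x" using K F x by (simp add: trace_zero_apply prod_eq_iff)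
qed

lemma condensed_ex: "\<exists>\<eta>. condensed_solution \<Omega> T k \<alpha> \<tau> f \<eta>"
proof -
  define pt where "pt = (\<lambda>a b j. linepath a b ((real j + 1) / (real k + 2)) :: point)"
  \<comment> \<open>Nodal values as separating functionals: \<open>i\<close> selects the trace of
    the pair, \<open>l\<close> the coordinate.\<close>
  define ev :: "(element \<times> (point \<times> point) \<times> nat) \<times> bool \<times> bool \<Rightarrow> trace_pair \<Rightarrow> real" where
    "ev = (\<lambda>((K, e, j), i, l) \<mu>. (if l then fst else snd) ((if i then fst \<mu> else snd \<mu>) K (pt (fst e) (snd e) j)))"
  define D where "D = (SIGMA K:T. edge_ends K \<times> {..k}) \<times> (UNIV :: (bool \<times> bool) set)"
  have "\<exists>\<eta>\<in>Nspace. \<forall>\<mu>\<in>Nspace. a_form T k \<alpha> \<tau> \<eta> \<mu> = l_form T k \<alpha> \<tau> f \<mu>"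
  proof (rule finite_riesz[where D = D and ev = ev and cb = comb and z = zero])
    show "finite D" using finite_T by (simp add: D_def)
    show "ev d (comb x c y) = ev d x + c * ev d y" if d: "d \<in> D" for d x y c
    proof -
      obtain K a b j i l where deq: "d = ((K, (a, b), j), i, l)" and K: "K \<in> T" "(a, b) \<in> edge_ends K" "j \<le> k"
        using d by (auto simp: D_def)
      have "fst (comb x c y) K (pt a b j) = fst x K (pt a b j) + c *\<^sub>R fst y K (pt a b j)"
        "snd (comb x c y) K (pt a b j) = snd x K (pt a b j) + c *\<^sub>R snd y K (pt a b j)"
        unfolding pt_def using K(3) by (intro comb_apply[OF K(1,2)]; simp)+
      then show ?thesis by (simp add: ev_def deq)
    qed
    show "w = zero" if w: "w \<in> Nspace" "\<forall>d\<in>D. ev d w = 0" for w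
    proof -
      have "fst w K (pt a b j) = 0 \<and> snd w K (pt a b j) = 0" if "K \<in> T" "(a, b) \<in> edge_ends K" "j \<le> k" for K a b j
      proof -
        have "((K, (a, b), j), i, l) \<in> D" for i l using that by (simp add: D_def)
        then have "ev ((K, (a, b), j), i, l) w = 0" for i l using w(2) by blast
        from this[of True True] this[of True False] this[of False True] this[of False False]
        show ?thesis by (simp add: ev_def prod_eq_iff zero_prod_def)
      qed
      moreover have "fst w \<in> M_space T k" "snd w \<in> M_space T k" using w(1) by (auto dest: Nt_space_M Nn_space_M)
      ultimately have "fst w = trace_zero T" "snd w = trace_zero T"
        by (auto intro!: M_space_separation simp: pt_def)
      then show ?thesis by (simp add: zero_def prod_eq_iff)
    qed
    show "zero \<in> Nspace" by (rule N_zero)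
  qed (simp_all only: N_comb a_form_comb l_form_comb a_form_definite, rule a_form_commute)
  then show ?thesis unfolding condensed_solution_def by blast
qed

lemma condensed_unique:
  assumes "condensed_solution \<Omega> T k \<alpha> \<tau> f \<eta>" "condensed_solution \<Omega> T k \<alpha> \<tau> f \<eta>'"
  shows "\<eta> = \<eta>'"
proof -
  have N: "\<eta> \<in> Nspace" "\<eta>' \<in> Nspace" using assms by (auto simp: condensed_solution_def)
  define \<delta> where "\<delta> = comb \<eta> (-1) \<eta>'"
  have \<delta>: "\<delta> \<in> Nspace" unfolding \<delta>_def by (rule N_comb[OF N])
  have "a_form T k \<alpha> \<tau> \<delta> \<delta> = a_form T k \<alpha> \<tau> \<eta> \<delta> - a_form T k \<alpha> \<tau> \<eta>' \<delta>"
    using a_form_comb[OF N \<delta>, of "-1"] by (simp add: \<delta>_def)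
  moreover have "a_form T k \<alpha> \<tau> \<eta> \<delta> = l_form T k \<alpha> \<tau> f \<delta>" "a_form T k \<alpha> \<tau> \<eta>' \<delta> = l_form T k \<alpha> \<tau> f \<delta>"
    using assms \<delta> unfolding condensed_solution_def by blast+
  ultimately have d0: "\<delta> = zero" by (intro a_form_definite[OF \<delta>]) simp
  have M: "fst \<eta> \<in> M_space T k" "snd \<eta> \<in> M_space T k" "fst \<eta>' \<in> M_space T k" "snd \<eta>' \<in> M_space T k"
    using N by (auto dest: Nt_space_M Nn_space_M)
  have "trace_comb T (fst \<eta>) (-1) (fst \<eta>') = trace_zero T" "trace_comb T (snd \<eta>) (-1) (snd \<eta>') = trace_zero T"
    using d0 by (simp_all add: \<delta>_def comb_def zero_def)
  then have "fst \<eta> K x + (-1) *\<^sub>R fst \<eta>' K x = 0" "snd \<eta> K x + (-1) *\<^sub>R snd \<eta>' K x = 0"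
    if "K \<in> T" "F \<in> edges K" "x \<in> rel_interior F" for K F x
    using trace_comb_apply[OF that, of "fst \<eta>" "-1" "fst \<eta>'"] trace_comb_apply[OF that, of "snd \<eta>" "-1" "snd \<eta>'"]
      trace_zero_apply[OF that] by simp_all
  then have "fst \<eta> = fst \<eta>'" "snd \<eta> = snd \<eta>'"
    by (intro M_space_eqI[OF M(1,3)] M_space_eqI[OF M(2,4)]; simp)+
  then show ?thesis by (simp add: prod_eq_iff)
qed

lemma a_form_nonneg: "0 \<le> a_form T k \<alpha> \<tau> \<mu> \<mu>"
  unfolding a_form_eq by (intro sum_nonneg element_form_nonneg)

text \<open>Completing the square: the energy of \<mu> exceeds that of \<eta> by half of the form at
  the difference \<mu> minus \<eta>, which is nonnegative.\<close>

lemma condensed_minimizes: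
  assumes \<eta>: "condensed_solution \<Omega> T k \<alpha> \<tau> f \<eta>" and \<mu>: "\<mu> \<in> Nspace"
  shows "energy T k \<alpha> \<tau> f \<eta> \<le> energy T k \<alpha> \<tau> f \<mu>"
proof -
  have l: "l_form T k \<alpha> \<tau> f \<nu> = a_form T k \<alpha> \<tau> \<eta> \<nu>" if "\<nu> \<in> Nspace" for \<nu>
    using \<eta> that by (auto simp: condensed_solution_def)
  have N: "\<eta> \<in> Nspace" using \<eta> by (auto simp: condensed_solution_def)
  define \<delta> where "\<delta> = comb \<mu> (-1) \<eta>"
  have \<delta>: "\<delta> \<in> Nspace" unfolding \<delta>_def by (rule N_comb[OF \<mu> N])
  have "a_form T k \<alpha> \<tau> \<delta> \<kappa> = a_form T k \<alpha> \<tau> \<mu> \<kappa> - a_form T k \<alpha> \<tau> \<eta> \<kappa>" if "\<kappa> \<in> Nspace" for \<kappa>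
    using a_form_comb[OF \<mu> N that, of "-1"] by (simp add: \<delta>_def)
  from this[OF \<delta>] this[OF \<mu>] this[OF N]
  have "a_form T k \<alpha> \<tau> \<delta> \<delta> = a_form T k \<alpha> \<tau> \<mu> \<mu> - 2 * a_form T k \<alpha> \<tau> \<eta> \<mu> + a_form T k \<alpha> \<tau> \<eta> \<eta>"
    using a_form_commute[of \<mu> \<delta>] a_form_commute[of \<eta> \<delta>] a_form_commute[of \<mu> \<eta>] by linarith
  then have "0 \<le> a_form T k \<alpha> \<tau> \<mu> \<mu> - 2 * a_form T k \<alpha> \<tau> \<eta> \<mu> + a_form T k \<alpha> \<tau> \<eta> \<eta>"
    using a_form_nonneg[of \<delta>] by simp
  then show ?thesis unfolding energy_def l[OF \<mu>] l[OF N] by linarith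
qed

text \<open>Only the first two equations of the second argument enter the reciprocity identity, so the full
  solution may be replaced there by the one with source zero.\<close>

lemma element_form_reciprocity:
  assumes \<eta>: "\<eta> \<in> Nspace" and \<mu>: "\<mu> \<in> Nspace" and K: "K \<in> T"
    and s: "local_problem k \<alpha> \<tau> K (fst \<eta> K) (snd \<eta> K) f (S, P, U)"
  shows "element_form K \<eta> \<mu> = ip K f (UU \<mu> K)
    - bip K (check_trace \<alpha> K S U (fst \<eta> K)) (tangential K (fst \<mu> K))
    - bip K (hat_trace \<tau> K P U (snd \<eta> K)) (normal_comp K (snd \<mu> K))"
proof -
  obtain c r where "star_polygon K c r" using star_T[OF K] by blast
  then interpret star_polygon K c r .
  note L\<eta> = N_L2[OF \<eta> K] and L\<mu> = N_L2[OF \<mu> K]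
  have "element_form K \<eta> \<mu> = element_form K \<mu> \<eta>" by (rule element_form_commute)
  also have "\<dots> = ip K (\<lambda>_. 0) (UU \<eta> K) - bip K (check_trace \<alpha> K (SS \<mu> K) (UU \<mu> K) (fst \<mu> K)) (tangential K (fst \<eta> K))
    - bip K (hat_trace \<tau> K (PP \<mu> K) (UU \<mu> K) (snd \<mu> K)) (normal_comp K (snd \<eta> K))"
    unfolding element_form_def by (rule reciprocity[OF N_solves[OF \<mu> K] N_solves[OF \<eta> K] L\<mu> L\<eta>])
  \<comment> \<open>With source zero on the \<mu> side, the right-hand side depends on the other
    solution only through its trace data, which \<open>U\<close> and \<open>UU \<eta> K\<close>
    share.\<close>
  also have "\<dots> = ip K (\<lambda>_. 0) U - bip K (check_trace \<alpha> K (SS \<mu> K) (UU \<mu> K) (fst \<mu> K)) (tangential K (fst \<eta> K))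
    - bip K (hat_trace \<tau> K (PP \<mu> K) (UU \<mu> K) (snd \<mu> K)) (normal_comp K (snd \<eta> K))"
    by (simp only: ip_zero_left)
  also note reciprocity[OF N_solves[OF \<mu> K] s L\<mu> L\<eta>, symmetric]
  also have "ip K (SS \<mu> K) S + ip K (PP \<mu> K) P
      + inverse \<alpha> * bip K (tangential K (\<lambda>y. UU \<mu> K y - fst \<mu> K y)) (tangential K (\<lambda>y. U y - fst \<eta> K y))
      + inverse \<tau> * bip K (normal_comp K (\<lambda>y. UU \<mu> K y - snd \<mu> K y)) (normal_comp K (\<lambda>y. U y - snd \<eta> K y))
    = ip K S (SS \<mu> K) + ip K P (PP \<mu> K)
      + inverse \<alpha> * bip K (tangential K (\<lambda>y. U y - fst \<eta> K y)) (tangential K (\<lambda>y. UU \<mu> K y - fst \<mu> K y))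
      + inverse \<tau> * bip K (normal_comp K (\<lambda>y. U y - snd \<eta> K y)) (normal_comp K (\<lambda>y. UU \<mu> K y - snd \<mu> K y))"
    by (simp only: ip_commute bip_commute)
  also note reciprocity[OF s N_solves[OF \<mu> K] L\<eta> L\<mu>]
  finally show ?thesis .
qed

section \<open>Equivalence of the HDG system and the condensed problem\<close>

definition pick :: "element \<Rightarrow> (point \<Rightarrow> 'b::zero) \<Rightarrow> element \<Rightarrow> point \<Rightarrow> 'b" where
  "pick K w = (\<lambda>K'\<in>T. if K' = K then w else (\<lambda>_. 0))"

lemma sum_pick:
  assumes "K \<in> T" "\<And>K'. G K' (\<lambda>_. 0) = (0::real)"
  shows "(\<Sum>K'\<in>T. G K' (pick K w K')) = G K w"
proof -
  have "(\<Sum>K'\<in>T. G K' (pick K w K')) = (\<Sum>K'\<in>T. if K' = K then G K w else 0)"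
    by (rule sum.cong) (auto simp: pick_def assms(2))
  then show ?thesis using assms(1) finite_T by simp
qed

lemma zero_field_derivatives: "curl (\<lambda>_. 0) = (\<lambda>_. 0)" "grad (\<lambda>_. 0) = (\<lambda>_. 0)" "rot (\<lambda>_. 0) = (\<lambda>_. 0)" "divg (\<lambda>_. 0) = (\<lambda>_. 0)"
  by (simp_all add: fun_eq_iff curl_def grad_def rot_def divg_def dx_def dy_def zero_prod_def)

text \<open>The element spaces are not coupled to each other, so test functions supported on one
  element reduce the first three global equations to the local ones.\<close>

lemma hdg_local:
  assumes s: "hdg_solution \<Omega> T k \<alpha> \<tau> f (\<sigma>, \<phi>, u, uc, uh)" and K: "K \<in> T"
  shows "local_problem k \<alpha> \<tau> K (uc K) (uh K) f (\<sigma> K, \<phi> K, u K)"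
proof -
  have W: "pick K w \<in> W_space T k" if "w \<in> polys k" for w using that by (auto simp: pick_def W_space_def polys_zero)
  have V: "pick K w \<in> V_space T k" if "w \<in> vpolys k" for w using that by (auto simp: pick_def V_space_def vpolys_zero)
  note z = zero_field_derivatives ip_zero_right bip_zero_right
  have 1: "ip K (\<sigma> K) \<xi> - ip K (u K) (curl \<xi>) + bip K (tangential K (uc K)) \<xi> = 0" if "\<xi> \<in> polys k" for \<xi>
  proof -
    \<comment> \<open>The second name \<open>K'\<close> keeps the chosen element apart from the
      summation index.\<close>
    have "(\<Sum>K\<in>T. ip K (\<sigma> K) (pick K' \<xi> K)) - (\<Sum>K\<in>T. ip K (u K) (curl (pick K' \<xi> K)))
       + (\<Sum>K\<in>T. bip K (tangential K (uc K)) (pick K' \<xi> K)) = 0" if "K' = K" for K'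
      using s W[OF \<open>\<xi> \<in> polys k\<close>] that by (auto simp: hdg_solution_def)
    then show ?thesis
      using sum_pick[OF K, of "\<lambda>K w. ip K (\<sigma> K) w" \<xi>] sum_pick[OF K, of "\<lambda>K w. ip K (u K) (curl w)" \<xi>]
        sum_pick[OF K, of "\<lambda>K w. bip K (tangential K (uc K)) w" \<xi>] by (simp add: z)
  qed
  have 2: "ip K (\<phi> K) \<xi> - ip K (u K) (grad \<xi>) + bip K (normal_comp K (uh K)) \<xi> = 0" if "\<xi> \<in> polys k" for \<xi>
  proof -
    have "(\<Sum>K\<in>T. ip K (\<phi> K) (pick K' \<xi> K)) - (\<Sum>K\<in>T. ip K (u K) (grad (pick K' \<xi> K)))
       + (\<Sum>K\<in>T. bip K (normal_comp K (uh K)) (pick K' \<xi> K)) = 0" if "K' = K" for K'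
      using s W[OF \<open>\<xi> \<in> polys k\<close>] that by (auto simp: hdg_solution_def)
    then show ?thesis
      using sum_pick[OF K, of "\<lambda>K w. ip K (\<phi> K) w" \<xi>] sum_pick[OF K, of "\<lambda>K w. ip K (u K) (grad w)" \<xi>]
        sum_pick[OF K, of "\<lambda>K w. bip K (normal_comp K (uh K)) w" \<xi>] by (simp add: z)
  qed
  have 3: "ip K (\<sigma> K) (rot w) + bip K (check_trace \<alpha> K (\<sigma> K) (u K) (uc K)) (tangential K w)
       - ip K (\<phi> K) (divg w) + bip K (hat_trace \<tau> K (\<phi> K) (u K) (uh K)) (normal_comp K w) = ip K f w" if "w \<in> vpolys k" for w
  proof -
    have "(\<Sum>K\<in>T. ip K (\<sigma> K) (rot (pick K' w K)))
       + (\<Sum>K\<in>T. bip K (check_trace \<alpha> K (\<sigma> K) (u K) (uc K)) (tangential K (pick K' w K)))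
       - (\<Sum>K\<in>T. ip K (\<phi> K) (divg (pick K' w K)))
       + (\<Sum>K\<in>T. bip K (hat_trace \<tau> K (\<phi> K) (u K) (uh K)) (normal_comp K (pick K' w K)))
       = (\<Sum>K\<in>T. ip K f (pick K' w K))" if "K' = K" for K'
      using s V[OF \<open>w \<in> vpolys k\<close>] that by (auto simp: hdg_solution_def)
    then show ?thesis
      using sum_pick[OF K, of "\<lambda>K w. ip K (\<sigma> K) (rot w)" w] sum_pick[OF K, of "\<lambda>K w. ip K (\<phi> K) (divg w)" w]
        sum_pick[OF K, of "\<lambda>K w. bip K (check_trace \<alpha> K (\<sigma> K) (u K) (uc K)) (tangential K w)" w]
        sum_pick[OF K, of "\<lambda>K w. bip K (hat_trace \<tau> K (\<phi> K) (u K) (uh K)) (normal_comp K w)" w]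
        sum_pick[OF K, of "\<lambda>K w. ip K f w" w] by (simp add: z)
  qed
  have "\<sigma> K \<in> polys k" "\<phi> K \<in> polys k" "u K \<in> vpolys k"
    using s K by (auto simp: hdg_solution_def W_space_def V_space_def)
  then show ?thesis using 1 2 3 by (simp add: local_problem_def)
qed

text \<open>Superposition gives a solution, and unique solvability makes it the only one. The
  equivalence serves both to decompose a given HDG solution and to construct one.\<close>

lemma local_decomposition:
  assumes \<eta>: "\<eta> \<in> Nspace" and K: "K \<in> T"
  defines "S \<equiv> \<lambda>x. SS \<eta> K x + Sigma_source k \<alpha> \<tau> K f x" and "P \<equiv> \<lambda>x. PP \<eta> K x + Phi_source k \<alpha> \<tau> K f x"
    and "U \<equiv> \<lambda>x. UU \<eta> K x + U_source k \<alpha> \<tau> K f x"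
  shows "local_problem k \<alpha> \<tau> K (fst \<eta> K) (snd \<eta> K) f s \<longleftrightarrow> s = (S, P, U)"
proof -
  obtain c r where "star_polygon K c r" using star_T[OF K] by blast
  then interpret star_polygon K c r .
  have "local_problem k \<alpha> \<tau> K (fst \<eta> K) (snd \<eta> K) f (S, P, U)"
    using local_problem_comb[OF N_solves[OF \<eta> K] source_solves[OF source_L2[OF K] pos]
        N_L2[OF \<eta> K] zero_L2_bdry zero_L2_bdry L2_zero source_L2[OF K], of 1]
    by (simp add: S_def P_def U_def)
  then show ?thesis using local_problem_ex1[OF N_L2[OF \<eta> K] source_L2[OF K] pos, of k] by blast
qed

text \<open>The defect of the condensed equation is exactly the residual of the two conservation
  equations, so either problem can be derived from the other.\<close>

lemma a_form_hdg:
  assumes \<eta>: "\<eta> \<in> Nspace" and \<mu>: "\<mu> \<in> Nspace"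
    and s: "\<And>K. K \<in> T \<Longrightarrow> local_problem k \<alpha> \<tau> K (fst \<eta> K) (snd \<eta> K) f (\<sigma> K, \<phi> K, u K)"
  shows "a_form T k \<alpha> \<tau> \<eta> \<mu> = l_form T k \<alpha> \<tau> f \<mu>
    - (\<Sum>K\<in>T. bip K (check_trace \<alpha> K (\<sigma> K) (u K) (fst \<eta> K)) (tangential K (fst \<mu> K)))
    - (\<Sum>K\<in>T. bip K (hat_trace \<tau> K (\<phi> K) (u K) (snd \<eta> K)) (normal_comp K (snd \<mu> K)))"
proof -
  have "a_form T k \<alpha> \<tau> \<eta> \<mu> = (\<Sum>K\<in>T. ip K f (UU \<mu> K)
    - bip K (check_trace \<alpha> K (\<sigma> K) (u K) (fst \<eta> K)) (tangential K (fst \<mu> K))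
    - bip K (hat_trace \<tau> K (\<phi> K) (u K) (snd \<eta> K)) (normal_comp K (snd \<mu> K)))"
    unfolding a_form_eq by (intro sum.cong refl element_form_reciprocity \<eta> \<mu> s)
  then show ?thesis by (simp add: l_form_eq sum_subtractf)
qed

lemma hdg_condensed:
  assumes s: "hdg_solution \<Omega> T k \<alpha> \<tau> f (\<sigma>, \<phi>, u, uc, uh)"
  shows "condensed_solution \<Omega> T k \<alpha> \<tau> f (uc, uh)"
proof -
  have N: "(uc, uh) \<in> Nspace" using s by (auto simp: hdg_solution_def)
  have "a_form T k \<alpha> \<tau> (uc, uh) \<mu> = l_form T k \<alpha> \<tau> f \<mu>" if "\<mu> \<in> Nspace" for \<mu>
    using a_form_hdg[OF N that, of \<sigma> \<phi> u] hdg_local[OF s] s that by (auto simp: hdg_solution_def)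
  then show ?thesis using N by (simp add: condensed_solution_def)
qed

lemma trace_zero_bip:
  assumes "K \<in> T"
  shows "bip K g (tangential K (trace_zero T K)) = 0" "bip K g (normal_comp K (trace_zero T K)) = 0"
proof -
  have "trace_zero T K (linepath a b t) = 0" if "(a, b) \<in> edge_ends K" "0 < t" "t < 1" for a b t
    using trace_zero_apply[OF assms edge_in_edges[OF that(1)] edge_point[OF polygon_T[OF assms] that]] .
  then have "bip K g (tangential K (trace_zero T K)) = bip K g (\<lambda>_. 0)" "bip K g (normal_comp K (trace_zero T K)) = bip K g (\<lambda>_. 0)"
    by (auto intro!: bip_cong)
  then show "bip K g (tangential K (trace_zero T K)) = 0" "bip K g (normal_comp K (trace_zero T K)) = 0"
    by (simp_all add: bip_zero_right)
qed

text \<open>The element unknowns are defined by the decomposition, which secures the first three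
  equations; the condensed equation then yields the conservation of the numerical traces.\<close>

lemma condensed_hdg:
  assumes c: "condensed_solution \<Omega> T k \<alpha> \<tau> f (uc, uh)"
  defines "\<sigma> \<equiv> \<lambda>K\<in>T. \<lambda>x. SS (uc, uh) K x + Sigma_source k \<alpha> \<tau> K f x"
    and "\<phi> \<equiv> \<lambda>K\<in>T. \<lambda>x. PP (uc, uh) K x + Phi_source k \<alpha> \<tau> K f x"
    and "u \<equiv> \<lambda>K\<in>T. \<lambda>x. UU (uc, uh) K x + U_source k \<alpha> \<tau> K f x"
  shows "hdg_solution \<Omega> T k \<alpha> \<tau> f (\<sigma>, \<phi>, u, uc, uh)"
proof -
  have N: "(uc, uh) \<in> Nspace" and eq: "\<And>\<mu>. \<mu> \<in> Nspace \<Longrightarrow> a_form T k \<alpha> \<tau> (uc, uh) \<mu> = l_form T k \<alpha> \<tau> f \<mu>"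
    using c by (auto simp: condensed_solution_def)
  have s: "local_problem k \<alpha> \<tau> K (uc K) (uh K) f (\<sigma> K, \<phi> K, u K)" if "K \<in> T" for K
    using local_decomposition[OF N that] that by (simp add: \<sigma>_def \<phi>_def u_def)
  then have P: "\<sigma> K \<in> polys k" "\<phi> K \<in> polys k" "u K \<in> vpolys k" if "K \<in> T" for K
    using that by (auto simp: local_problem_def)
  have ext: "\<sigma> \<in> extensional T" "\<phi> \<in> extensional T" "u \<in> extensional T" by (simp_all add: \<sigma>_def \<phi>_def u_def)
  have sums: "(\<Sum>K\<in>T. bip K (check_trace \<alpha> K (\<sigma> K) (u K) (uc K)) (tangential K (fst \<mu> K)))
    + (\<Sum>K\<in>T. bip K (hat_trace \<tau> K (\<phi> K) (u K) (uh K)) (normal_comp K (snd \<mu> K))) = 0" if "\<mu> \<in> Nspace" for \<mu>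
    using a_form_hdg[OF N that, of \<sigma> \<phi> u] eq[OF that] s by simp
  show ?thesis
    unfolding hdg_solution_def prod.case
  proof (intro conjI ballI)
    show "\<sigma> \<in> W_space T k" "\<phi> \<in> W_space T k" "u \<in> V_space T k"
      using P ext by (auto simp: W_space_def V_space_def PiE_iff)
    show "uc \<in> Nt_space \<Omega> T k" "uh \<in> Nn_space \<Omega> T k" using N by auto
    fix \<xi> assume "\<xi> \<in> W_space T k"
    then have x: "\<xi> K \<in> polys k" if "K \<in> T" for K using that by (auto simp: W_space_def)
    have "(\<Sum>K\<in>T. ip K (\<sigma> K) (\<xi> K) - ip K (u K) (curl (\<xi> K)) + bip K (tangential K (uc K)) (\<xi> K)) = 0"
      "(\<Sum>K\<in>T. ip K (\<phi> K) (\<xi> K) - ip K (u K) (grad (\<xi> K)) + bip K (normal_comp K (uh K)) (\<xi> K)) = 0"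
      using s x by (auto intro!: sum.neutral simp: local_problem_def)
    then show "(\<Sum>K\<in>T. ip K (\<sigma> K) (\<xi> K)) - (\<Sum>K\<in>T. ip K (u K) (curl (\<xi> K)))
       + (\<Sum>K\<in>T. bip K (tangential K (uc K)) (\<xi> K)) = 0"
      "(\<Sum>K\<in>T. ip K (\<phi> K) (\<xi> K)) - (\<Sum>K\<in>T. ip K (u K) (grad (\<xi> K)))
       + (\<Sum>K\<in>T. bip K (normal_comp K (uh K)) (\<xi> K)) = 0"
      by (simp_all only: sum.distrib sum_subtractf)
  next
    fix z assume "z \<in> V_space T k"
    then have z: "z K \<in> vpolys k" if "K \<in> T" for K using that by (auto simp: V_space_def)
    have "(\<Sum>K\<in>T. ip K (\<sigma> K) (rot (z K)) + bip K (check_trace \<alpha> K (\<sigma> K) (u K) (uc K)) (tangential K (z K))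
       - ip K (\<phi> K) (divg (z K)) + bip K (hat_trace \<tau> K (\<phi> K) (u K) (uh K)) (normal_comp K (z K))) = (\<Sum>K\<in>T. ip K f (z K))"
      using s z by (intro sum.cong refl) (simp add: local_problem_def)
    then show "(\<Sum>K\<in>T. ip K (\<sigma> K) (rot (z K)))
       + (\<Sum>K\<in>T. bip K (check_trace \<alpha> K (\<sigma> K) (u K) (uc K)) (tangential K (z K)))
       - (\<Sum>K\<in>T. ip K (\<phi> K) (divg (z K)))
       + (\<Sum>K\<in>T. bip K (hat_trace \<tau> K (\<phi> K) (u K) (uh K)) (normal_comp K (z K)))
       = (\<Sum>K\<in>T. ip K f (z K))"
      by (simp only: sum.distrib sum_subtractf)
  next
    fix \<mu> assume "\<mu> \<in> Nt_space \<Omega> T k"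
    \<comment> \<open>The condensed equation only yields the sum of the two residuals; a test pair
      with one zero component separates them.\<close>
    then have "(\<mu>, trace_zero T) \<in> Nspace" using Nn_space_zero by blast
    from sums[OF this] show "(\<Sum>K\<in>T. bip K (check_trace \<alpha> K (\<sigma> K) (u K) (uc K)) (tangential K (\<mu> K))) = 0"
      by (simp add: trace_zero_bip)
  next
    fix \<mu> assume "\<mu> \<in> Nn_space \<Omega> T k"
    then have "(trace_zero T, \<mu>) \<in> Nspace" using Nt_space_zero by blast
    from sums[OF this] show "(\<Sum>K\<in>T. bip K (hat_trace \<tau> K (\<phi> K) (u K) (uh K)) (normal_comp K (\<mu> K))) = 0"
      by (simp add: trace_zero_bip)
  qed
qed

lemma hdg_decomposition:
  assumes s: "hdg_solution \<Omega> T k \<alpha> \<tau> f (\<sigma>, \<phi>, u, uc, uh)" and K: "K \<in> T"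
  shows "\<sigma> K = (\<lambda>x. Sigma_trace k \<alpha> \<tau> K (uc K) (uh K) x + Sigma_source k \<alpha> \<tau> K f x)"
    "\<phi> K = (\<lambda>x. Phi_trace k \<alpha> \<tau> K (uc K) (uh K) x + Phi_source k \<alpha> \<tau> K f x)"
    "u K = (\<lambda>x. U_trace k \<alpha> \<tau> K (uc K) (uh K) x + U_source k \<alpha> \<tau> K f x)"
proof -
  have "(uc, uh) \<in> Nspace" using s by (auto simp: hdg_solution_def)
  then show "\<sigma> K = (\<lambda>x. Sigma_trace k \<alpha> \<tau> K (uc K) (uh K) x + Sigma_source k \<alpha> \<tau> K f x)"
    "\<phi> K = (\<lambda>x. Phi_trace k \<alpha> \<tau> K (uc K) (uh K) x + Phi_source k \<alpha> \<tau> K f x)"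
    "u K = (\<lambda>x. U_trace k \<alpha> \<tau> K (uc K) (uh K) x + U_source k \<alpha> \<tau> K f x)"
    using local_decomposition[of "(uc, uh)" K "(\<sigma> K, \<phi> K, u K)"] hdg_local[OF s K] K by simp_all
qed

lemma hdg_unique:
  assumes s: "hdg_solution \<Omega> T k \<alpha> \<tau> f (\<sigma>, \<phi>, u, uc, uh)" and s': "hdg_solution \<Omega> T k \<alpha> \<tau> f (\<sigma>', \<phi>', u', uc', uh')"
  shows "(\<sigma>, \<phi>, u, uc, uh) = (\<sigma>', \<phi>', u', uc', uh')"
proof -
  have eq: "uc = uc'" "uh = uh'"
    using condensed_unique[OF hdg_condensed[OF s] hdg_condensed[OF s']] by simp_all
  have W: "\<sigma> \<in> W_space T k" "\<sigma>' \<in> W_space T k" "\<phi> \<in> W_space T k" "\<phi>' \<in> W_space T k"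
    and V: "u \<in> V_space T k" "u' \<in> V_space T k"
    using s s' by (auto simp: hdg_solution_def)
  have dec: "\<sigma> K = \<sigma>' K" "\<phi> K = \<phi>' K" "u K = u' K" if "K \<in> T" for K
    unfolding hdg_decomposition[OF s that] hdg_decomposition[OF s' that] eq by (rule refl)+
  have "\<sigma> = \<sigma>'" by (rule PiE_ext[OF W(1,2)[unfolded W_space_def] dec(1)])
  moreover have "\<phi> = \<phi>'" by (rule PiE_ext[OF W(3,4)[unfolded W_space_def] dec(2)])
  moreover have "u = u'" by (rule PiE_ext[OF V[unfolded V_space_def] dec(3)])
  ultimately show ?thesis using eq by simp
qed

end

text \<open>The solutions that the claim calls "the solution" enter as definite descriptions or as
  relations, so unique solvability of the two local problems, of the HDG system and of the condensed
  problem belongs to the conclusion.\<close>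

theorem theorem3:
  fixes \<Omega> :: "point set" and T :: "element set" and f :: "point \<Rightarrow> point"
    and \<rho> \<alpha> \<tau> :: real and k :: nat
  assumes "polygonal_domain \<Omega>"
    and "quasi_uniform_mesh \<Omega> \<rho> T"
    and "f \<in> L2 \<Omega>"
    and "\<alpha> > 0" and "\<tau> > 0"
  shows "(\<forall>K\<in>T. \<forall>\<eta>t\<in>L2_bdry K. \<forall>\<eta>n\<in>L2_bdry K. \<exists>!s. local_problem_trace k \<alpha> \<tau> K \<eta>t \<eta>n s) \<and>
    (\<forall>K\<in>T. \<forall>g\<in>L2 (cell K). \<exists>!s. local_problem_source k \<alpha> \<tau> K g s) \<and>
    (\<exists>!s. hdg_solution \<Omega> T k \<alpha> \<tau> f s) \<and>
    (\<exists>!\<eta>. condensed_solution \<Omega> T k \<alpha> \<tau> f \<eta>) \<and>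
    (\<forall>\<sigma> \<phi> u uc uh. hdg_solution \<Omega> T k \<alpha> \<tau> f (\<sigma>, \<phi>, u, uc, uh) \<longrightarrow>
      (\<forall>K\<in>T.
        \<sigma> K = (\<lambda>x. Sigma_trace k \<alpha> \<tau> K (uc K) (uh K) x + Sigma_source k \<alpha> \<tau> K f x) \<and>
        \<phi> K = (\<lambda>x. Phi_trace k \<alpha> \<tau> K (uc K) (uh K) x + Phi_source k \<alpha> \<tau> K f x) \<and>
        u K = (\<lambda>x. U_trace k \<alpha> \<tau> K (uc K) (uh K) x + U_source k \<alpha> \<tau> K f x)) \<and>
      condensed_solution \<Omega> T k \<alpha> \<tau> f (uc, uh) \<and>
      is_arg_min (energy T k \<alpha> \<tau> f) (\<lambda>\<mu>. \<mu> \<in> Nt_space \<Omega> T k \<times> Nn_space \<Omega> T k) (uc, uh))"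
proof -
  interpret hdg_mesh \<Omega> \<rho> T k \<alpha> \<tau> f using assms by unfold_locales
  have local: "\<exists>!s. local_problem k \<alpha> \<tau> K \<eta>t \<eta>n g s"
    if K: "K \<in> T" and d: "\<eta>t \<in> L2_bdry K" "\<eta>n \<in> L2_bdry K" "g \<in> L2 (cell K)" for K \<eta>t \<eta>n g
  proof -
    obtain c r where "star_polygon K c r" using star_T[OF K] by blast
    then show ?thesis using star_polygon.local_problem_ex1 d pos by blast
  qed
  have zero: "(\<lambda>_. 0) \<in> L2 (cell K)" "(\<lambda>_. 0) \<in> L2_bdry K" if K: "K \<in> T" for K
    using star_T[OF K] star_polygon.L2_zero star_polygon.zero_L2_bdry by blast+
  show ?thesis
  proof (intro conjI ballI allI impI)
    show "\<exists>!s. local_problem_trace k \<alpha> \<tau> K \<eta>t \<eta>n s" if "K \<in> T" "\<eta>t \<in> L2_bdry K" "\<eta>n \<in> L2_bdry K" for K \<eta>t \<eta>n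
      unfolding local_problem_trace_eq by (rule local[OF that zero(1)[OF that(1)]])
    show "\<exists>!s. local_problem_source k \<alpha> \<tau> K g s" if "K \<in> T" "g \<in> L2 (cell K)" for K g
      unfolding local_problem_source_eq by (rule local[OF that(1) zero(2,2)[OF that(1)] that(2)])
    \<comment> \<open>Existence for the HDG system is inherited from the condensed problem, whose
      form is symmetric and definite.\<close>
    obtain \<eta> where \<eta>: "condensed_solution \<Omega> T k \<alpha> \<tau> f \<eta>" using condensed_ex by blast
    then show "\<exists>!\<eta>. condensed_solution \<Omega> T k \<alpha> \<tau> f \<eta>" using condensed_unique by blast
    obtain uc uh where "\<eta> = (uc, uh)" by (cases \<eta>)
    then obtain \<sigma> \<phi> u where s: "hdg_solution \<Omega> T k \<alpha> \<tau> f (\<sigma>, \<phi>, u, uc, uh)"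
      using condensed_hdg[of uc uh] \<eta> by blast
    show "\<exists>!s. hdg_solution \<Omega> T k \<alpha> \<tau> f s"
    proof (rule ex1I)
      show "hdg_solution \<Omega> T k \<alpha> \<tau> f (\<sigma>, \<phi>, u, uc, uh)" by (rule s)
      fix s' assume "hdg_solution \<Omega> T k \<alpha> \<tau> f s'"
      then show "s' = (\<sigma>, \<phi>, u, uc, uh)" using hdg_unique[OF _ s] by (cases s') simp
    qed
  next
    fix \<sigma> \<phi> u uc uh assume s: "hdg_solution \<Omega> T k \<alpha> \<tau> f (\<sigma>, \<phi>, u, uc, uh)"
    show "\<sigma> K = (\<lambda>x. Sigma_trace k \<alpha> \<tau> K (uc K) (uh K) x + Sigma_source k \<alpha> \<tau> K f x)"
      "\<phi> K = (\<lambda>x. Phi_trace k \<alpha> \<tau> K (uc K) (uh K) x + Phi_source k \<alpha> \<tau> K f x)"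
      "u K = (\<lambda>x. U_trace k \<alpha> \<tau> K (uc K) (uh K) x + U_source k \<alpha> \<tau> K f x)" if "K \<in> T" for K
      by (rule hdg_decomposition[OF s that])+
    show c: "condensed_solution \<Omega> T k \<alpha> \<tau> f (uc, uh)" by (rule hdg_condensed[OF s])
    show "is_arg_min (energy T k \<alpha> \<tau> f) (\<lambda>\<mu>. \<mu> \<in> Nt_space \<Omega> T k \<times> Nn_space \<Omega> T k) (uc, uh)"
      unfolding is_arg_min_def using c condensed_minimizes[OF c] by (auto simp: condensed_solution_def not_less)
  qed
qed

end
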